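(* Let $2\le p<\infty$, let $\Omega\subset\mathbb{H}$ be a bounded domain, and let $u$ be a smooth function in $\Omega_E$ with $\nabla_{\mathbb{H}}u\ne0$ in $\Omega_E$. Let $$c_p=\frac{2}{(p+2)(p+4)}\left(\frac{\Gamma(\frac p4+\frac32)}{\Gamma(\frac p4+1)}\right)^2,$$ where $\Gamma$ is the Euler Gamma function. Then there exist $C>0$ and $\hat\varepsilon>0$ such that $$\left|\mu^{\mathbb{H}}_p(u,\varepsilon)(x_0)-u(x_0)-c_p\,\varepsilon^2\,\Delta^N_{\mathbb{H},p}u(x_0)\right|\le C\varepsilon^3$$ for all $0<\varepsilon<\hat\varepsilon$ and all $x_0\in\overline\Omega$. In particular, the constants $C$ and $\hat\varepsilon$ are uniform in $x_0\in\overline\Omega$ and depend only on $p$ and the derivatives of $u$.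
   Context: Heisenberg group: $\mathbb{H}=(\mathbb{R}^3,* )$ with $(x_1,x_2,x_3)*(y_1,y_2,y_3)=(x_1+y_1,\,x_2+y_2,\,x_3+y_3+\tfrac12(x_1y_2-x_2y_1))$. The Korányi gauge is $|x|_{\mathbb{H}}=((x_1^2+x_2^2)^2+16x_3^2)^{1/4}$, the metric is $d_{\mathbb{H}}(x,y)=|x^{-1}*y|_{\mathbb{H}}$, and $B^{\mathbb{H}}_r(x_0)=\{x\in\mathbb{H}: d_{\mathbb{H}}(x_0,x)<r\}$. Horizontal operators: $X_1=\partial_{x_1}-\tfrac{x_2}{2}\partial_{x_3}$, $X_2=\partial_{x_2}+\tfrac{x_1}{2}\partial_{x_3}$; $\nabla_{\mathbb{H}}u=(X_1u,X_2u)$; $\Delta_{\mathbb{H}}u=X_1^2u+X_2^2u$; $D^{2,*}_{\mathbb{H}}u$ is the $2\times2$ matrix with entries $\tfrac12(X_iX_ju+X_jX_iu)$. Where $\nabla_{\mathbb{H}}u\ne0$, the normalized $p$-Laplacian is $$\Delta^N_{\mathbb{H},p}u=(p-2)\Big\langle D^{2,*}_{\mathbb{H}}u\,\tfrac{\nabla_{\mathbb{H}}u}{|\nabla_{\mathbb{H}}u|},\tfrac{\nabla_{\mathbb{H}}u}{|\nabla_{\mathbb{H}}u|}\Big\rangle+\Delta_{\mathbb{H}}u .$$ Extended domain: $\Omega_E=\Omega\cup\Gamma^{\mathbb{H}}_1$ with $\Gamma^{\mathbb{H}}_1=\{x\in\mathbb{H}\setminus\Omega:\operatorname{dist}_{\mathbb{H}}(x,\Omega)\le1\}$.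 Since $\Omega_E$ is compact, "smooth in $\Omega_E$" means $C^\infty$ in an open neighbourhood of $\Omega_E$. Natural $p$-mean: for $1<p<\infty$, $0<\varepsilon<1$, $\phi$ bounded and Lebesgue measurable on $\Omega_E$, and $x\in\overline\Omega$, $\mu^{\mathbb{H}}_p(\phi,\varepsilon)(x)$ is the unique real number $\lambda$ minimizing $\|\phi-\lambda\|_{L^p(\overline{B^{\mathbb{H}}_\varepsilon(x)})}$ (with respect to Lebesgue measure on $\mathbb{R}^3$). *)

theory Defs
  imports "HOL-Analysis.Analysis"
begin

section \<open>The Heisenberg group\<close>

definition heis_mult :: "real^3 \<Rightarrow> real^3 \<Rightarrow> real^3" where
  "heis_mult x y = vector [x $ 1 + y $ 1, x $ 2 + y $ 2,
     x $ 3 + y $ 3 + (1/2) * (x $ 1 * y $ 2 - x $ 2 * y $ 1)]"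

definition heis_inv :: "real^3 \<Rightarrow> real^3" where
  "heis_inv x = - x"

lemma heis_mult_inv:
  "heis_mult x (heis_inv x) = 0" "heis_mult (heis_inv x) x = 0"
  by (simp_all add: heis_mult_def heis_inv_def vec_eq_iff forall_3)

definition koranyi_gauge :: "real^3 \<Rightarrow> real" where
  "koranyi_gauge x = root 4 (((x $ 1)\<^sup>2 + (x $ 2)\<^sup>2)\<^sup>2 + 16 * (x $ 3)\<^sup>2)"

definition heis_dist :: "real^3 \<Rightarrow> real^3 \<Rightarrow> real" where
  "heis_dist x y = koranyi_gauge (heis_mult (heis_inv x) y)"

definition heis_ball :: "real^3 \<Rightarrow> real \<Rightarrow> (real^3) set" where
  "heis_ball x0 r = {x. heis_dist x0 x < r}"

definition heis_setdist :: "real^3 \<Rightarrow> (real^3) set \<Rightarrow> real" where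
  "heis_setdist x A = (INF y\<in>A. heis_dist x y)"

text \<open>The metric \<open>heis_dist\<close> induces the Euclidean topology and has the same bounded
  sets, so \<open>open\<close>, \<open>connected\<close>, \<open>bounded\<close> and \<open>closure\<close> may be taken in \<open>real^3\<close>.\<close>

definition bounded_domain :: "(real^3) set \<Rightarrow> bool" where
  "bounded_domain \<Omega> \<longleftrightarrow> open \<Omega> \<and> connected \<Omega> \<and> \<Omega> \<noteq> {} \<and> bounded \<Omega>"

definition ext_domain :: "(real^3) set \<Rightarrow> (real^3) set" where
  "ext_domain \<Omega> = \<Omega> \<union> {x. x \<notin> \<Omega> \<and> heis_setdist x \<Omega> \<le> 1}"

section \<open>Smoothness and horizontal operators\<close>

definition partial_deriv :: "'n::finite \<Rightarrow> (real^'n \<Rightarrow> real) \<Rightarrow> real^'n \<Rightarrow> real" where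
  "partial_deriv i f x = frechet_derivative f (at x) (axis i 1)"

text \<open>Only for open \<open>U\<close>, where \<open>differentiable_on\<close> agrees with differentiability at each
  point, so that \<open>partial_deriv\<close> is the actual partial derivative.\<close>

fun Ck_on :: "nat \<Rightarrow> (real^'n::finite) set \<Rightarrow> (real^'n \<Rightarrow> real) \<Rightarrow> bool" where
  "Ck_on 0 U f \<longleftrightarrow> continuous_on U f"
| "Ck_on (Suc k) U f \<longleftrightarrow> f differentiable_on U \<and> (\<forall>i. Ck_on k U (partial_deriv i f))"

definition smooth_in :: "(real^'n::finite) set \<Rightarrow> (real^'n \<Rightarrow> real) \<Rightarrow> bool" where
  "smooth_in S f \<longleftrightarrow> (\<exists>U. open U \<and> S \<subseteq> U \<and> (\<forall>k. Ck_on k U f))"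

definition X1 :: "(real^3 \<Rightarrow> real) \<Rightarrow> real^3 \<Rightarrow> real" where
  "X1 u x = partial_deriv 1 u x - x $ 2 / 2 * partial_deriv 3 u x"

definition X2 :: "(real^3 \<Rightarrow> real) \<Rightarrow> real^3 \<Rightarrow> real" where
  "X2 u x = partial_deriv 2 u x + x $ 1 / 2 * partial_deriv 3 u x"

definition Xh :: "2 \<Rightarrow> (real^3 \<Rightarrow> real) \<Rightarrow> real^3 \<Rightarrow> real" where
  "Xh i = (if i = 1 then X1 else X2)"

definition heis_grad :: "(real^3 \<Rightarrow> real) \<Rightarrow> real^3 \<Rightarrow> real^2" where
  "heis_grad u x = (\<chi> i. Xh i u x)"

definition heis_laplace :: "(real^3 \<Rightarrow> real) \<Rightarrow> real^3 \<Rightarrow> real" where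
  "heis_laplace u x = X1 (X1 u) x + X2 (X2 u) x"

definition heis_hess :: "(real^3 \<Rightarrow> real) \<Rightarrow> real^3 \<Rightarrow> real^2^2" where
  "heis_hess u x = (\<chi> i j. (1/2) * (Xh i (Xh j u) x + Xh j (Xh i u) x))"

text \<open>Meaningful only where \<open>heis_grad u x \<noteq> 0\<close>; \<open>sgn v\<close> is \<open>v / norm v\<close>.\<close>

definition norm_p_laplace :: "real \<Rightarrow> (real^3 \<Rightarrow> real) \<Rightarrow> real^3 \<Rightarrow> real" where
  "norm_p_laplace p u x =
     (p - 2) * ((heis_hess u x *v sgn (heis_grad u x)) \<bullet> sgn (heis_grad u x))
     + heis_laplace u x"

text \<open>For a word \<open>w = [i, j, \<dots>, k]\<close> this is \<open>Xh i (Xh j (\<dots> (Xh k u)))\<close>. Since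
  \<open>\<partial>\<^sub>3 u = X1 (X2 u) - X2 (X1 u)\<close> for smooth \<open>u\<close>, these control all left-invariant
  derivatives.\<close>

definition horiz_deriv :: "2 list \<Rightarrow> (real^3 \<Rightarrow> real) \<Rightarrow> real^3 \<Rightarrow> real" where
  "horiz_deriv w u = foldr Xh w u"

section \<open>Natural p-means\<close>

definition Lp_norm_on :: "real \<Rightarrow> (real^3) set \<Rightarrow> (real^3 \<Rightarrow> real) \<Rightarrow> real" where
  "Lp_norm_on p A f = (LINT y:A|lebesgue. \<bar>f y\<bar> powr p) powr (1 / p)"

definition p_mean :: "real \<Rightarrow> (real^3 \<Rightarrow> real) \<Rightarrow> real \<Rightarrow> real^3 \<Rightarrow> real" where
  "p_mean p \<phi> \<epsilon> x = (THE l. \<forall>l'.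
      Lp_norm_on p (closure (heis_ball x \<epsilon>)) (\<lambda>y. \<phi> y - l)
      \<le> Lp_norm_on p (closure (heis_ball x \<epsilon>)) (\<lambda>y. \<phi> y - l'))"

definition c_const :: "real \<Rightarrow> real" where
  "c_const p = 2 / ((p + 2) * (p + 4)) * (Gamma (p / 4 + 3 / 2) / Gamma (p / 4 + 1))\<^sup>2"

end

theory Submission
  imports Defs
begin

text \<open>Left translation, dilation and a rotation about the third axis turn the minimisation over the
  ball of radius \<open>\<epsilon>\<close> into the minimisation over the unit ball of \<open>\<integral> \<bar>f - t\<bar>\<^sup>p\<close> with
  \<open>f(z) = z\<^sub>1 + \<epsilon> q(z) + O(\<epsilon>\<^sup>2)\<close>, where \<open>q\<close> is the second-order horizontal Taylor polynomial divided by
  the length of the horizontal gradient. The minimiser is the unique zero of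
  \<open>t \<mapsto> \<integral> sgn (f - t) \<bar>f - t\<bar>\<^bsup>p-1\<^esup>\<close>. Expanding the integrand around \<open>z\<^sub>1\<close>, the zeroth order term is odd and
  the first order term vanishes exactly for \<open>t = \<epsilon> \<integral> \<bar>z\<^sub>1\<bar>\<^bsup>p-2\<^esup> q / \<integral> \<bar>z\<^sub>1\<bar>\<^bsup>p-2\<^esup>\<close>, a quotient of Beta integrals that gives
  \<open>c\<^sub>p\<close> times the normalised \<open>p\<close>-Laplacian. Uniform second-order error bounds then produce a sign change of the
  integral within \<open>O(\<epsilon>\<^sup>2)\<close> of this value. Only horizontal derivatives of length at most four enter, because
  \<open>\<partial>\<^sub>3\<close> is the commutator of \<open>X1\<close> and \<open>X2\<close>.\<close>

section \<open>Smooth functions on open sets\<close>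

text \<open>For 2 < p < 3 the signed power of exponent p - 1 has an unbounded second derivative, so
  the remainder near the plane z_1 = 0 is only of size |z_1| powr (p - 3). This is integrable
  because p - 3 > -1, and it is the reason why moments of the unit ball are computed for all real
  exponents above -1. The antisymmetric part of the second horizontal derivatives multiplies z_3 and
  disappears by reflection, so only the symmetrised Hessian survives. The squared Gamma quotient in
  \<open>c_const\<close> comes from the vertical integration: the two moments carry different powers
  of the slice radius, and their vertical Beta factors are reciprocal Gamma quotients up to a
  rational factor. Dividing by the length of the gradient makes the leading term exactly z_1, at the
  price of a lower bound m for that length. That the constants depend only on p and on the
  derivatives of u is expressed by the order of quantifiers: they are chosen after p, m and the
  bounds M, but before \<Omega> and u. This uniform version is proved first; compactness of the
  extended domain then supplies m and M for a single u.\<close>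

definition smooth_on :: "(real^'n::finite) set \<Rightarrow> (real^'n \<Rightarrow> real) \<Rightarrow> bool" where
  "smooth_on U f \<longleftrightarrow> (\<forall>k. Ck_on k U f)"

lemma has_derivative_cong_open:
  assumes "open U" "x \<in> U" "\<And>y. y \<in> U \<Longrightarrow> f y = g y"
  shows "(f has_derivative D) (at x) \<longleftrightarrow> (g has_derivative D) (at x)"
  using has_derivative_transform_within_open[OF _ assms(1,2)] assms(3) by metis

lemma partial_deriv_cong:
  assumes "open U" "x \<in> U" "\<And>y. y \<in> U \<Longrightarrow> f y = g y"
  shows "partial_deriv i f x = partial_deriv i g x"
  by (simp add: partial_deriv_def frechet_derivative_def has_derivative_cong_open[OF assms])

text \<open>\<open>Ck_on\<close> iterates \<open>partial_deriv\<close>, but the sum and product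
  rules for \<open>partial_deriv\<close> are equations only at points where both functions are
  differentiable. Agreement on the open set U must therefore suffice for replacing a
  function.\<close>

lemma Ck_on_cong:
  assumes "open U" "\<And>y. y \<in> U \<Longrightarrow> f y = g y"
  shows "Ck_on k U f \<longleftrightarrow> Ck_on k U g"
  using assms(2)
proof (induction k arbitrary: f g)
  case 0
  then show ?case by (auto cong: continuous_on_cong)
next
  case (Suc k)
  have "f differentiable_on U \<longleftrightarrow> g differentiable_on U"
    unfolding differentiable_on_eq_differentiable_at[OF assms(1)] differentiable_def
    using has_derivative_cong_open[OF assms(1), of _ f g] Suc.prems by simp
  moreover have "Ck_on k U (partial_deriv i f) \<longleftrightarrow> Ck_on k U (partial_deriv i g)" for i
    using Suc.prems by (intro Suc.IH partial_deriv_cong[OF assms(1)])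
  ultimately show ?case by simp
qed

lemma smooth_on_partial_deriv: "smooth_on U f \<Longrightarrow> smooth_on U (partial_deriv i f)"
  unfolding smooth_on_def using Ck_on.simps(2) by blast

lemma smooth_on_differentiable:
  assumes "smooth_on U f" "open U" "x \<in> U"
  shows "f differentiable (at x)"
  using assms Ck_on.simps(2)[of 0 U f] differentiable_on_eq_differentiable_at
  unfolding smooth_on_def by blast

lemma smooth_on_continuous_on: "smooth_on U f \<Longrightarrow> continuous_on U f"
  unfolding smooth_on_def using Ck_on.simps(1) by blast

lemma has_derivative_partial_deriv:
  assumes "f differentiable (at x)"
  shows "(f has_derivative (\<lambda>h. \<Sum>i\<in>UNIV. h $ i * partial_deriv i f x)) (at x)"
proof -
  have D: "(f has_derivative frechet_derivative f (at x)) (at x)"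
    using assms frechet_derivative_works by blast
  then interpret bounded_linear "frechet_derivative f (at x)"
    by (rule has_derivative_bounded_linear)
  have "frechet_derivative f (at x) h = (\<Sum>i\<in>UNIV. h $ i * partial_deriv i f x)" for h
    by (subst basis_expansion[of h, symmetric])
      (simp add: sum scaleR scalar_mult_eq_scaleR partial_deriv_def)
  then show ?thesis using D by presburger
qed

lemma partial_derivI:
  assumes "(f has_derivative D) (at x)"
  shows "partial_deriv i f x = D (axis i 1)"
  unfolding partial_deriv_def using frechet_derivative_at[OF assms] by simp

lemma partial_deriv_add:
  assumes "f differentiable (at x)" "g differentiable (at x)"
  shows "partial_deriv i (\<lambda>x. f x + g x) x = partial_deriv i f x + partial_deriv i g x"
  by (subst partial_derivI[OF has_derivative_add[OF
        frechet_derivative_works[THEN iffD1, OF assms(1)] frechet_derivative_works[THEN iffD1, OF assms(2)]]])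
     (simp add: partial_deriv_def)

lemma partial_deriv_mult:
  assumes "f differentiable (at x)" "g differentiable (at x)"
  shows "partial_deriv i (\<lambda>x. f x * g x) x = f x * partial_deriv i g x + partial_deriv i f x * g x"
  by (subst partial_derivI[OF has_derivative_mult[OF
        frechet_derivative_works[THEN iffD1, OF assms(1)] frechet_derivative_works[THEN iffD1, OF assms(2)]]])
     (simp add: partial_deriv_def)

lemma partial_deriv_const: "partial_deriv i (\<lambda>x. c) x = 0"
  by (subst partial_derivI[OF has_derivative_const]) simp

lemma partial_deriv_component: "partial_deriv i (\<lambda>x. x $ j) x = (if i = j then 1 else 0)"
  by (subst partial_derivI[OF bounded_linear_imp_has_derivative[OF bounded_linear_vec_nth]])
     (simp add: axis_def)

lemma Ck_on_const: "Ck_on k U (\<lambda>x. c)"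
  by (induction k arbitrary: c) (auto simp: partial_deriv_const[abs_def])

lemma smooth_on_const: "smooth_on U (\<lambda>x. c)"
  by (simp add: smooth_on_def Ck_on_const)

lemma smooth_on_component: "smooth_on (U :: (real^'n::finite) set) (\<lambda>x. x $ j)"
  unfolding smooth_on_def
proof
  have d: "(\<lambda>x. x $ j) differentiable_on U"
    by (intro linear_imp_differentiable_on bounded_linear.linear bounded_linear_vec_nth)
  show "Ck_on k U (\<lambda>x. x $ j)" for k
    using d by (cases k) (auto simp: partial_deriv_component[abs_def] Ck_on_const
        intro: differentiable_imp_continuous_on)
qed

lemma Ck_on_add:
  assumes "open U" "Ck_on k U f" "Ck_on k U g"
  shows "Ck_on k U (\<lambda>x. f x + g x)"
  using assms(2,3)
proof (induction k arbitrary: f g)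
  case 0
  then show ?case by (auto intro: continuous_intros)
next
  case (Suc k)
  have "Ck_on k U (partial_deriv i (\<lambda>x. f x + g x))" for i
    by (rule Ck_on_cong[OF assms(1), THEN iffD2, OF partial_deriv_add])
      (use Suc in \<open>auto simp: differentiable_on_eq_differentiable_at[OF assms(1)]\<close>)
  then show ?case using Suc.prems by auto
qed

lemma smooth_on_add:
  "open U \<Longrightarrow> smooth_on U f \<Longrightarrow> smooth_on U g \<Longrightarrow> smooth_on U (\<lambda>x. f x + g x)"
  by (simp add: smooth_on_def Ck_on_add)

text \<open>The induction keeps full smoothness of both factors: the product rule leaves
  undifferentiated factors next to partial derivatives, so a hypothesis on a single order would also
  need that order k + 1 implies order k.\<close>

lemma smooth_on_mult:
  assumes "open U" "smooth_on U f" "smooth_on U g"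
  shows "smooth_on U (\<lambda>x. f x * g x)"
proof -
  have "Ck_on k U (\<lambda>x. f x * g x)" for k
    using assms(2,3)
  proof (induction k arbitrary: f g)
    case 0
    then show ?case by (auto intro: continuous_intros smooth_on_continuous_on)
  next
    case (Suc k)
    have "(\<lambda>x. f x * g x) differentiable_on U"
      using Suc.prems smooth_on_differentiable[OF _ assms(1)]
      by (auto simp: differentiable_on_eq_differentiable_at[OF assms(1)] intro: differentiable_mult)
    moreover have "Ck_on k U (partial_deriv i (\<lambda>x. f x * g x))" for i
    proof (rule Ck_on_cong[OF assms(1), THEN iffD2, OF partial_deriv_mult])
      show "Ck_on k U (\<lambda>x. f x * partial_deriv i g x + partial_deriv i f x * g x)"
        using Suc smooth_on_partial_deriv by (intro Ck_on_add assms(1)) blast+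
    qed (use Suc.prems smooth_on_differentiable[OF _ assms(1)] in auto)
    ultimately show ?case by simp
  qed
  then show ?thesis by (simp add: smooth_on_def)
qed

section \<open>Symmetry of second partial derivatives\<close>

lemma partial_deriv_line:
  assumes "f differentiable (at (x + t *\<^sub>R axis i 1))"
  shows "((\<lambda>t. f (x + t *\<^sub>R axis i 1)) has_real_derivative partial_deriv i f (x + t *\<^sub>R axis i 1)) (at t)"
proof -
  have "((\<lambda>t. x + t *\<^sub>R axis i 1) has_vector_derivative axis i 1) (at t)"
    by (auto intro!: derivative_eq_intros)
  then have "((\<lambda>t. x + t *\<^sub>R axis i 1) has_derivative (\<lambda>h. h *\<^sub>R axis i 1)) (at t)"
    by (simp add: has_vector_derivative_def)
  note D = has_derivative_compose[OF this has_derivative_partial_deriv[OF assms]]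
  have ax: "(h *\<^sub>R axis i 1) $ j * c = (if i = j then c * h else 0)" for h c :: real and j
    by (simp add: axis_def)
  have sum: "(\<lambda>h. \<Sum>j\<in>UNIV. (h *\<^sub>R axis i 1) $ j * partial_deriv j f (x + t *\<^sub>R axis i 1))
     = (*) (partial_deriv i f (x + t *\<^sub>R axis i 1))"
    by (simp only: ax sum.delta' finite_class.finite_UNIV) auto
  from D show ?thesis
    unfolding has_field_derivative_def sum .
qed

text \<open>The mean value theorem is applied twice: in direction i to the increment
  \<open>F\<close>, then in direction j to \<open>partial_deriv i f\<close>. The second difference
  on the left is symmetric in i and j, although the right-hand side is not visibly so.\<close>

lemma second_difference_mean_value:
  fixes f :: "real^'n::finite \<Rightarrow> real"
  assumes "h > 0"
    and f: "\<And>s t. 0 \<le> s \<Longrightarrow> s \<le> h \<Longrightarrow> 0 \<le> t \<Longrightarrow> t \<le> h \<Longrightarrow>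
       f differentiable (at (x + s *\<^sub>R axis i 1 + t *\<^sub>R axis j 1))"
    and fi: "\<And>s t. 0 \<le> s \<Longrightarrow> s \<le> h \<Longrightarrow> 0 \<le> t \<Longrightarrow> t \<le> h \<Longrightarrow>
       partial_deriv i f differentiable (at (x + s *\<^sub>R axis i 1 + t *\<^sub>R axis j 1))"
  obtains s t where "0 < s" "s < h" "0 < t" "t < h"
    "f (x + h *\<^sub>R axis i 1 + h *\<^sub>R axis j 1) - f (x + h *\<^sub>R axis i 1) - f (x + h *\<^sub>R axis j 1) + f x
      = h\<^sup>2 * partial_deriv j (partial_deriv i f) (x + s *\<^sub>R axis i 1 + t *\<^sub>R axis j 1)"
proof -
  have sw: "x + s *\<^sub>R axis i 1 + t *\<^sub>R axis j 1 = (x + t *\<^sub>R axis j 1) + s *\<^sub>R axis i 1" for s t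
    by (simp add: algebra_simps)
  define F where "F = (\<lambda>s. f (x + s *\<^sub>R axis i 1 + h *\<^sub>R axis j 1) - f (x + s *\<^sub>R axis i 1))"
  have "DERIV F s :> partial_deriv i f (x + s *\<^sub>R axis i 1 + h *\<^sub>R axis j 1)
          - partial_deriv i f (x + s *\<^sub>R axis i 1)" if "0 \<le> s" "s \<le> h" for s
    unfolding F_def sw
    using f[of s h] f[of s 0] that assms(1)
    by (intro derivative_intros partial_deriv_line) (auto simp: sw)
  from MVT2[OF assms(1) this] obtain s where s: "0 < s" "s < h"
    "F h - F 0 = h * (partial_deriv i f (x + s *\<^sub>R axis i 1 + h *\<^sub>R axis j 1)
          - partial_deriv i f (x + s *\<^sub>R axis i 1))" by auto
  have "DERIV (\<lambda>t. partial_deriv i f (x + s *\<^sub>R axis i 1 + t *\<^sub>R axis j 1)) t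
     :> partial_deriv j (partial_deriv i f) (x + s *\<^sub>R axis i 1 + t *\<^sub>R axis j 1)"
    if "0 \<le> t" "t \<le> h" for t
    using fi[of s t] that s by (intro partial_deriv_line) auto
  from MVT2[OF assms(1) this] obtain t where t: "0 < t" "t < h"
    "partial_deriv i f (x + s *\<^sub>R axis i 1 + h *\<^sub>R axis j 1) - partial_deriv i f (x + s *\<^sub>R axis i 1)
      = h * partial_deriv j (partial_deriv i f) (x + s *\<^sub>R axis i 1 + t *\<^sub>R axis j 1)" by auto
  show thesis
    using s(3) t(3) by (intro that[OF s(1,2) t(1,2)])
      (simp add: F_def power2_eq_square algebra_simps)
qed

text \<open>One and the same second difference equals h^2 times either mixed derivative at some
  point near x. If the two derivatives differed at x, continuity would keep them apart at all such
  points.\<close>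

lemma partial_deriv_commute:
  assumes "smooth_on U f" "open U" "x \<in> U"
  shows "partial_deriv i (partial_deriv j f) x = partial_deriv j (partial_deriv i f) x"
proof (rule ccontr)
  define A where "A = partial_deriv i (partial_deriv j f)"
  define B where "B = partial_deriv j (partial_deriv i f)"
  assume "\<not> ?thesis"
  then have ne: "\<bar>A x - B x\<bar> / 2 > 0" by (simp add: A_def B_def)
  have cont: "isCont A x" "isCont B x"
    using smooth_on_continuous_on[OF smooth_on_partial_deriv[OF smooth_on_partial_deriv[OF assms(1)]]]
      assms(3) unfolding A_def B_def continuous_on_eq_continuous_at[OF assms(2)] by blast+
  obtain dA where dA: "dA > 0" "\<And>y. dist y x < dA \<Longrightarrow> \<bar>A y - A x\<bar> < \<bar>A x - B x\<bar> / 2"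
    using cont(1)[unfolded continuous_at_eps_delta] ne by (metis dist_real_def)
  obtain dB where dB: "dB > 0" "\<And>y. dist y x < dB \<Longrightarrow> \<bar>B y - B x\<bar> < \<bar>A x - B x\<bar> / 2"
    using cont(2)[unfolded continuous_at_eps_delta] ne by (metis dist_real_def)
  obtain dU where dU: "dU > 0" "ball x dU \<subseteq> U"
    using assms(2,3) open_contains_ball by blast
  \<comment> \<open>Two displacements of length at most h move x by less than 3h, hence the division
    by three.\<close>
  define h where "h = min (min dA dB) dU / 3"
  have h: "h > 0" "3 * h \<le> dA" "3 * h \<le> dB" "3 * h \<le> dU"
    using dA dB dU by (auto simp: h_def)
  have near: "dist (x + s *\<^sub>R axis k 1 + t *\<^sub>R axis l 1) x < 3 * h"
    if "0 \<le> s" "s \<le> h" "0 \<le> t" "t \<le> h" for s t and k l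
  proof -
    have "dist (x + s *\<^sub>R axis k 1 + t *\<^sub>R axis l 1) x \<le> norm (s *\<^sub>R axis k (1::real)) + norm (t *\<^sub>R axis l (1::real))"
      using norm_triangle_ineq[of "s *\<^sub>R axis k (1::real)" "t *\<^sub>R axis l (1::real)"] by (simp add: dist_norm add.assoc)
    then show ?thesis using that h(1) by simp
  qed
  have inU: "x + s *\<^sub>R axis k 1 + t *\<^sub>R axis l 1 \<in> U"
    if "0 \<le> s" "s \<le> h" "0 \<le> t" "t \<le> h" for s t k l
    using near[OF that, of k l] dU h by (auto simp: dist_commute subset_iff)
  have diff: "g differentiable (at (x + s *\<^sub>R axis k 1 + t *\<^sub>R axis l 1))"
    if "smooth_on U g" "0 \<le> s" "s \<le> h" "0 \<le> t" "t \<le> h" for g s t k l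
    using smooth_on_differentiable[OF that(1) assms(2) inU] that by blast
  have sm: "smooth_on U (partial_deriv k f)" for k
    using assms(1) smooth_on_partial_deriv by blast
  obtain s t where st: "0 < s" "s < h" "0 < t" "t < h"
    "f (x + h *\<^sub>R axis i 1 + h *\<^sub>R axis j 1) - f (x + h *\<^sub>R axis i 1) - f (x + h *\<^sub>R axis j 1) + f x
      = h\<^sup>2 * B (x + s *\<^sub>R axis i 1 + t *\<^sub>R axis j 1)"
    using second_difference_mean_value[OF h(1) diff[OF assms(1)] diff[OF sm], where i = i and j = j]
    unfolding B_def by blast
  obtain s' t' where st': "0 < s'" "s' < h" "0 < t'" "t' < h"
    "f (x + h *\<^sub>R axis j 1 + h *\<^sub>R axis i 1) - f (x + h *\<^sub>R axis j 1) - f (x + h *\<^sub>R axis i 1) + f x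
      = h\<^sup>2 * A (x + s' *\<^sub>R axis j 1 + t' *\<^sub>R axis i 1)"
    using second_difference_mean_value[OF h(1) diff[OF assms(1)] diff[OF sm], where i = j and j = i]
    unfolding A_def by blast
  have "h\<^sup>2 * A (x + s' *\<^sub>R axis j 1 + t' *\<^sub>R axis i 1) = h\<^sup>2 * B (x + s *\<^sub>R axis i 1 + t *\<^sub>R axis j 1)"
    using st(5) st'(5) unfolding add.assoc add.commute[of "h *\<^sub>R axis i 1"] by linarith
  then have "A (x + s' *\<^sub>R axis j 1 + t' *\<^sub>R axis i 1) = B (x + s *\<^sub>R axis i 1 + t *\<^sub>R axis j 1)"
    using h(1) by simp
  moreover have "\<bar>A (x + s' *\<^sub>R axis j 1 + t' *\<^sub>R axis i 1) - A x\<bar> < \<bar>A x - B x\<bar> / 2"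
    using near[of s' t' j i] st' h by (intro dA) auto
  moreover have "\<bar>B (x + s *\<^sub>R axis i 1 + t *\<^sub>R axis j 1) - B x\<bar> < \<bar>A x - B x\<bar> / 2"
    using near[of s t i j] st h by (intro dB) auto
  moreover have "a = b \<Longrightarrow> \<bar>a - p\<bar> < \<bar>p - q\<bar> / 2 \<Longrightarrow> \<bar>b - q\<bar> < \<bar>p - q\<bar> / 2 \<Longrightarrow> False"
    for a b p q :: real using abs_triangle_ineq4[of "a - q" "a - p"] by simp
  ultimately show False by blast
qed

section \<open>Horizontal derivatives and Taylor expansion\<close>

lemma smooth_on_Xh:
  assumes "open U" "smooth_on U f"
  shows "smooth_on U (Xh i f)"
proof -
  have "smooth_on U (\<lambda>x. partial_deriv 1 f x + (-1/2) * x $ 2 * partial_deriv 3 f x)"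
    "smooth_on U (\<lambda>x. partial_deriv 2 f x + 1/2 * x $ 1 * partial_deriv 3 f x)"
    by (intro smooth_on_add smooth_on_mult smooth_on_const smooth_on_component
        smooth_on_partial_deriv assms)+
  then show ?thesis by (simp add: Xh_def X1_def[abs_def] X2_def[abs_def])
qed

lemma smooth_on_horiz_deriv:
  assumes "open U" "smooth_on U f"
  shows "smooth_on U (horiz_deriv w f)"
  by (induction w) (auto simp: horiz_deriv_def assms smooth_on_Xh)

lemma horiz_deriv_simps:
  "horiz_deriv [] u = u" "horiz_deriv (i # w) u = Xh i (horiz_deriv w u)"
  by (simp_all add: horiz_deriv_def)

lemma Xh_simps: "Xh 1 u = X1 u" "Xh 2 u = X2 u"
  by (simp_all add: Xh_def)

text \<open>The second-order terms of the commutator cancel by symmetry of mixed derivatives. What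
  remains comes from differentiating the coefficients x_1/2 and -x_2/2, each of which contributes
  half of the vertical derivative.\<close>

lemma partial_deriv_3_eq_commutator:
  fixes x :: "real^3"
  assumes "open U" "smooth_on U v" "x \<in> U"
  shows "partial_deriv 3 v x = X1 (X2 v) x - X2 (X1 v) x"
proof -
  have d: "partial_deriv i v differentiable at x" for i
    using smooth_on_differentiable smooth_on_partial_deriv assms by blast
  have c: "(\<lambda>x::real^3. a * x $ i) differentiable at x" for a i
    using smooth_on_differentiable[OF smooth_on_mult[OF _ smooth_on_const smooth_on_component], of UNIV] by simp
  have pc: "partial_deriv j (\<lambda>x::real^3. a * x $ i) x = (if j = i then a else 0)" for a i j
    using partial_deriv_mult[of "\<lambda>x. a" x "\<lambda>x::real^3. x $ i" j] smooth_on_differentiable[OF smooth_on_component, of UNIV x i]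
    by (simp add: partial_deriv_const partial_deriv_component)
  have X1: "partial_deriv j (X1 v) x = partial_deriv j (partial_deriv 1 v) x
     - x $ 2 / 2 * partial_deriv j (partial_deriv 3 v) x - (if j = 2 then 1/2 * partial_deriv 3 v x else 0)" for j
  proof -
    have "X1 v = (\<lambda>x. partial_deriv 1 v x + (-1/2) * x $ 2 * partial_deriv 3 v x)"
      by (auto simp: X1_def)
    then show ?thesis
      by (simp only: partial_deriv_add[OF d differentiable_mult[OF c d]] partial_deriv_mult[OF c d] pc) simp
  qed
  have X2: "partial_deriv j (X2 v) x = partial_deriv j (partial_deriv 2 v) x
     + x $ 1 / 2 * partial_deriv j (partial_deriv 3 v) x + (if j = 1 then 1/2 * partial_deriv 3 v x else 0)" for j
  proof -
    have "X2 v = (\<lambda>x. partial_deriv 2 v x + (1/2) * x $ 1 * partial_deriv 3 v x)"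
      by (auto simp: X2_def)
    then show ?thesis
      by (simp only: partial_deriv_add[OF d differentiable_mult[OF c d]] partial_deriv_mult[OF c d] pc) simp
  qed
  have comm: "partial_deriv i (partial_deriv j v) x = partial_deriv j (partial_deriv i v) x" for i j
    using partial_deriv_commute assms by blast
  show ?thesis
    unfolding X1_def[of "X2 v"] X2_def[of "X1 v"] X1 X2
    using comm[of 1 2] comm[of 1 3] comm[of 2 3] by (simp add: algebra_simps)
qed

text \<open>The weight 2 of the vertical coordinate makes these maps group homomorphisms and the
  fourth power of the gauge homogeneous of degree four.\<close>

definition heis_dil :: "real \<Rightarrow> real^3 \<Rightarrow> real^3" where
  "heis_dil s y = vector [s * y $ 1, s * y $ 2, s\<^sup>2 * y $ 3]"

lemma heis_dil_nth [simp]: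
  "heis_dil s y $ 1 = s * y $ 1" "heis_dil s y $ 2 = s * y $ 2" "heis_dil s y $ 3 = s\<^sup>2 * y $ 3"
  by (simp_all add: heis_dil_def)

lemma heis_mult_nth [simp]:
  "heis_mult x y $ 1 = x $ 1 + y $ 1" "heis_mult x y $ 2 = x $ 2 + y $ 2"
  "heis_mult x y $ 3 = x $ 3 + y $ 3 + (1/2) * (x $ 1 * y $ 2 - x $ 2 * y $ 1)"
  by (simp_all add: heis_mult_def)

text \<open>Along the path the s-dependent parts of the coefficients of \<open>X1\<close> and
  \<open>X2\<close> cancel in y_1 X1 + y_2 X2. So this combination accounts for the whole velocity
  except the vertical speed 2 s y_3, and the vertical derivative is then written as a
  commutator.\<close>

lemma heis_path_derivative:
  assumes "open U" "smooth_on U v" "heis_mult x (heis_dil s y) \<in> U"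
  shows "((\<lambda>s. v (heis_mult x (heis_dil s y))) has_real_derivative
    (let z = heis_mult x (heis_dil s y) in y $ 1 * X1 v z + y $ 2 * X2 v z
       + 2 * s * y $ 3 * (X1 (X2 v) z - X2 (X1 v) z))) (at s)"
proof -
  let ?g = "\<lambda>s. heis_mult x (heis_dil s y)"
  let ?D = "vector [y $ 1, y $ 2, 2 * s * y $ 3 + (1/2) * (x $ 1 * y $ 2 - x $ 2 * y $ 1)] :: real^3"
  have "(?g has_derivative (\<lambda>h. h *\<^sub>R ?D)) (at s)"
    by (subst has_derivative_componentwise_within)
      (auto simp: Basis_vec_def inner_axis forall_3 UNIV_3 has_field_derivative_def[symmetric]
        mult.commute[of _ "_ :: real"] algebra_simps power2_eq_square intro!: derivative_eq_intros)
  moreover have "v differentiable at (?g s)"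
    using smooth_on_differentiable assms by blast
  ultimately have "((\<lambda>s. v (?g s)) has_derivative
      (\<lambda>h. \<Sum>i\<in>UNIV. (h *\<^sub>R ?D) $ i * partial_deriv i v (?g s))) (at s)"
    by (rule has_derivative_compose[OF _ has_derivative_partial_deriv])
  moreover have "(\<lambda>h. \<Sum>i\<in>UNIV. (h *\<^sub>R ?D) $ i * partial_deriv i v (?g s))
     = (*) (let z = ?g s in y $ 1 * X1 v z + y $ 2 * X2 v z + 2 * s * y $ 3 * partial_deriv 3 v z)"
    by (simp add: sum_3 X1_def X2_def Let_def field_simps fun_eq_iff)
  ultimately show ?thesis
    unfolding has_field_derivative_def Let_def partial_deriv_3_eq_commutator[OF assms] by simp
qed

lemma heis_mult_dil_0 [simp]: "heis_mult x (heis_dil 0 y) = x"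
  by (simp add: vec_eq_iff forall_3)

lemma abs_sub_bound: "\<bar>a\<bar> \<le> (A::real) \<Longrightarrow> \<bar>b\<bar> \<le> B \<Longrightarrow> \<bar>a - b\<bar> \<le> A + B"
  by linarith

lemma abs_sum4_bound:
  "x = a + b + c + d \<Longrightarrow> \<bar>a\<bar> \<le> A \<Longrightarrow> \<bar>b\<bar> \<le> B \<Longrightarrow> \<bar>c\<bar> \<le> C \<Longrightarrow> \<bar>d\<bar> \<le> D \<Longrightarrow> A + B + C + D \<le> M
   \<Longrightarrow> \<bar>x :: real\<bar> \<le> M"
  by simp

text \<open>A second-order Maclaurin expansion of u along the dilation path from x. The remainder is
  controlled by the Lipschitz estimate for the second derivative \<open>g2\<close> at 0, so no third
  derivative of the path function has to be computed; 18 is half of the Lipschitz constant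
  36.\<close>

lemma heis_taylor:
  assumes U: "open U" "smooth_on U u"
    and \<epsilon>: "0 < \<epsilon>"
    and y: "\<bar>y $ 1\<bar> \<le> 1" "\<bar>y $ 2\<bar> \<le> 1" "2 * \<bar>y $ 3\<bar> \<le> 1" and "\<epsilon> \<le> 1"
    and inU: "\<And>s. 0 \<le> s \<Longrightarrow> s \<le> \<epsilon> \<Longrightarrow> heis_mult x (heis_dil s y) \<in> U"
    and K: "\<And>s w. 0 \<le> s \<Longrightarrow> s \<le> \<epsilon> \<Longrightarrow> w \<noteq> [] \<Longrightarrow> length w \<le> 4 \<Longrightarrow>
       \<bar>horiz_deriv w u (heis_mult x (heis_dil s y))\<bar> \<le> K"
  shows "\<bar>u (heis_mult x (heis_dil \<epsilon> y)) - u x - \<epsilon> * (y $ 1 * X1 u x + y $ 2 * X2 u x)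
     - \<epsilon>\<^sup>2 * (1/2 * ((y $ 1)\<^sup>2 * X1 (X1 u) x + y $ 1 * y $ 2 * (X1 (X2 u) x + X2 (X1 u) x)
        + (y $ 2)\<^sup>2 * X2 (X2 u) x) + y $ 3 * (X1 (X2 u) x - X2 (X1 u) x))\<bar> \<le> 18 * K * \<epsilon>^3"
proof -
  let ?g = "\<lambda>s. heis_mult x (heis_dil s y)"
  define h where "h w s = horiz_deriv w u (?g s)" for w s
  define E where "E w s = y $ 1 * h (1 # w) s + y $ 2 * h (2 # w) s
       + 2 * s * y $ 3 * (h (1 # 2 # w) s - h (2 # 1 # w) s)" for w s
  have Kpos: "0 \<le> K"
    using K[of 0 "[1]"] \<epsilon> by simp
  have hK: "\<bar>h w s\<bar> \<le> K" if "0 \<le> s" "s \<le> \<epsilon>" "w \<noteq> []" "length w \<le> 4" for w s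
    using K that by (simp add: h_def)
  have DE: "(h w has_real_derivative E w s) (at s)" if "0 \<le> s" "s \<le> \<epsilon>" for w s
    using heis_path_derivative[OF U(1) smooth_on_horiz_deriv[OF U] inU[OF that], of w]
    unfolding h_def[abs_def] E_def by (simp add: horiz_deriv_simps Xh_simps Let_def)
  have prod1: "\<bar>c * a\<bar> \<le> A" if "\<bar>c\<bar> \<le> 1" "\<bar>a\<bar> \<le> A" for c a A :: real
    using that mult_mono[of "\<bar>c\<bar>" 1 "\<bar>a\<bar>" A] by (simp add: abs_mult)
  have prods: "\<bar>2 * s * y $ 3 * a\<bar> \<le> s * A" if "0 \<le> s" "\<bar>a\<bar> \<le> A" for a A s
  proof -
    have "\<bar>2 * y $ 3 * a\<bar> \<le> A" using y(3) that by (intro prod1[of "2 * y $ 3"]) (auto simp: abs_mult)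
    then have "s * \<bar>2 * y $ 3 * a\<bar> \<le> s * A" using that by (intro mult_left_mono)
    then show ?thesis using that by (simp add: abs_mult mult_ac)
  qed
  \<comment> \<open>The bound is K + K + 2K, using s \<le> 1 and 2 |y_3| \<le> 1. The commutator
    prepends two letters to w, so words of length two reach the maximal length four.\<close>
  have EK: "\<bar>E w s\<bar> \<le> 4 * K" if "0 \<le> s" "s \<le> \<epsilon>" "length w \<le> 2" for w s
  proof -
    have "\<bar>2 * s * y $ 3 * (h (1 # 2 # w) s - h (2 # 1 # w) s)\<bar> \<le> s * (K + K)"
      using that by (intro prods abs_sub_bound hK) auto
    also have "\<dots> \<le> 2 * K"
      using mult_right_mono[of s 1 "2 * K"] that \<open>\<epsilon> \<le> 1\<close> Kpos by simp
    finally show ?thesis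
      using prod1[OF y(1) hK[of s "1 # w"]] prod1[OF y(2) hK[of s "2 # w"]] that
      unfolding E_def by simp
  qed
  have lip: "\<bar>h w s - h w 0\<bar> \<le> 4 * K * s" if "0 \<le> s" "s \<le> \<epsilon>" "length w \<le> 2" for w s
  proof (cases "s = 0")
    case False
    then have "0 < s" using \<open>0 \<le> s\<close> by simp
    obtain z where "0 < z" "z < s" "h w s - h w 0 = (s - 0) * E w z"
      using MVT2[OF \<open>0 < s\<close>, of "h w" "E w"] DE[of _ w] order_trans[OF _ \<open>s \<le> \<epsilon>\<close>] by blast
    then show ?thesis using EK[of z w] that \<open>0 < s\<close> by (simp add: abs_mult mult.commute)
  qed simp
  \<comment> \<open>The derivative of \<open>E []\<close>; its third summand comes from the explicit
    factor s in \<open>E []\<close>.\<close>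
  define g2 where "g2 s = y $ 1 * E [1] s + y $ 2 * E [2] s + 2 * y $ 3 * (h [1,2] s - h [2,1] s)
      + 2 * s * y $ 3 * (E [1,2] s - E [2,1] s)" for s
  have D2: "(E [] has_real_derivative g2 s) (at s)" if "0 \<le> s" "s \<le> \<epsilon>" for s
    unfolding E_def[of "[]", abs_def] g2_def
    by (auto intro!: derivative_eq_intros DE[OF that] simp: algebra_simps)
  \<comment> \<open>36 = 10 + 10 + 8 + 8. Terms with an explicit factor s vanish at 0, so for them a
    plain bound replaces a Lipschitz estimate, and words longer than four letters are
    avoided.\<close>
  have g2lip: "\<bar>g2 s - g2 0\<bar> \<le> 36 * K * s" if s: "0 \<le> s" "s \<le> \<epsilon>" for s
  proof -
    have E1: "\<bar>E [i] s - E [i] 0\<bar> \<le> 10 * K * s" for i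
    proof -
      have eq: "E [i] s - E [i] 0 = y $ 1 * (h [1,i] s - h [1,i] 0) + y $ 2 * (h [2,i] s - h [2,i] 0)
         + 2 * s * y $ 3 * (h [1,2,i] s - h [2,1,i] s) + 0"
        by (simp add: E_def algebra_simps)
      have b3: "\<bar>2 * s * y $ 3 * (h [1,2,i] s - h [2,1,i] s)\<bar> \<le> s * (K + K)"
        using s by (intro prods abs_sub_bound hK) auto
      show ?thesis
        by (rule abs_sum4_bound[OF eq prod1[OF y(1) lip[OF s]] prod1[OF y(2) lip[OF s]] b3, of 0])
          (simp_all add: algebra_simps)
    qed
    have g2eq: "g2 s - g2 0 = y $ 1 * (E [1] s - E [1] 0) + y $ 2 * (E [2] s - E [2] 0)
       + 2 * y $ 3 * ((h [1,2] s - h [1,2] 0) - (h [2,1] s - h [2,1] 0))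
       + 2 * s * y $ 3 * (E [1,2] s - E [2,1] s)"
      by (simp add: g2_def algebra_simps)
    have b4: "\<bar>2 * s * y $ 3 * (E [1,2] s - E [2,1] s)\<bar> \<le> s * (4 * K + 4 * K)"
      using s by (intro prods abs_sub_bound EK) auto
    have b3: "\<bar>2 * y $ 3 * ((h [1,2] s - h [1,2] 0) - (h [2,1] s - h [2,1] 0))\<bar> \<le> 4 * K * s + 4 * K * s"
      using s y(3) by (intro prod1[of "2 * y $ 3"] abs_sub_bound lip) (auto simp: abs_mult)
    show ?thesis
      by (rule abs_sum4_bound[OF g2eq prod1[OF y(1) E1] prod1[OF y(2) E1] b3 b4]) (simp add: algebra_simps)
  qed
  define diff where "diff n = (if n = 0 then h [] else if n = 1 then E [] else g2)" for n :: nat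
  have "\<exists>t>0. t < \<epsilon> \<and> h [] \<epsilon> = (\<Sum>m<2. diff m 0 / fact m * \<epsilon> ^ m) + diff 2 t / fact 2 * \<epsilon> ^ 2"
    using \<epsilon> DE D2 by (intro Maclaurin) (auto simp: diff_def less_Suc_eq numeral_2_eq_2)
  then obtain t where t: "0 < t" "t < \<epsilon>" "h [] \<epsilon> = h [] 0 + E [] 0 * \<epsilon> + g2 t / 2 * \<epsilon>\<^sup>2"
    by (auto simp: diff_def numeral_2_eq_2)
  have "\<bar>h [] \<epsilon> - h [] 0 - \<epsilon> * E [] 0 - \<epsilon>\<^sup>2 * (g2 0 / 2)\<bar> = \<epsilon>\<^sup>2 * (\<bar>g2 t - g2 0\<bar> / 2)"
  proof -
    have "h [] \<epsilon> - h [] 0 - \<epsilon> * E [] 0 - \<epsilon>\<^sup>2 * (g2 0 / 2) = \<epsilon>\<^sup>2 * ((g2 t - g2 0) / 2)"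
      unfolding t(3) by (simp add: field_simps)
    then show ?thesis by (simp only: abs_mult abs_divide) simp
  qed
  also have "\<dots> \<le> \<epsilon>\<^sup>2 * ((36 * K * \<epsilon>) / 2)"
    using g2lip[of t] t Kpos mult_left_mono[of t \<epsilon> "36 * K"]
    by (intro mult_left_mono divide_right_mono) auto
  finally have "\<bar>h [] \<epsilon> - h [] 0 - \<epsilon> * E [] 0 - \<epsilon>\<^sup>2 * (g2 0 / 2)\<bar> \<le> 18 * K * \<epsilon>^3"
    by (simp add: power2_eq_square power3_eq_cube mult_ac)
  moreover have "E [] 0 = y $ 1 * X1 u x + y $ 2 * X2 u x"
    by (simp add: E_def h_def horiz_deriv_simps Xh_simps)
  moreover have "g2 0 / 2 = 1/2 * ((y $ 1)\<^sup>2 * X1 (X1 u) x + y $ 1 * y $ 2 * (X1 (X2 u) x + X2 (X1 u) x)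
        + (y $ 2)\<^sup>2 * X2 (X2 u) x) + y $ 3 * (X1 (X2 u) x - X2 (X1 u) x)"
    by (simp add: g2_def E_def h_def horiz_deriv_simps Xh_simps power2_eq_square field_simps)
  ultimately show ?thesis by (simp add: h_def horiz_deriv_simps)
qed

section \<open>Signed powers and natural means on finite measure spaces\<close>

text \<open>For q = p - 1 this is the derivative of |s| powr p divided by p, hence the integrand of
  the first-order condition for the p-mean.\<close>

definition spow :: "real \<Rightarrow> real \<Rightarrow> real" where
  "spow q s = sgn s * \<bar>s\<bar> powr q"

text \<open>This form has no \<open>sgn\<close>, so continuity at 0 reduces to that of positive
  powers of nonnegative functions.\<close>

lemma spow_eq_max: "spow q s = max s 0 powr q - max (- s) 0 powr q"
  by (auto simp: spow_def sgn_if max_def)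

lemma continuous_on_spow:
  assumes "q > 0"
  shows "continuous_on A (spow q)"
  unfolding spow_eq_max[abs_def] by (intro continuous_intros continuous_on_powr') (use assms in auto)

lemma borel_measurable_spow [measurable]: "spow q \<in> borel_measurable borel"
  unfolding spow_def[abs_def] by measurable

lemma abs_spow: "\<bar>spow q s\<bar> = \<bar>s\<bar> powr q"
  by (auto simp: spow_def abs_mult sgn_if)

lemma spow_minus: "spow q (- s) = - spow q s"
  by (simp add: spow_def sgn_minus)

section \<open>Strict convexity and the minimiser\<close>

lemma powr_gt_tangent_at_1:
  assumes "p > 1" "0 < t" "t \<noteq> (1::real)"
  shows "t powr p > 1 + p * (t - 1)"
proof -
  have D: "((\<lambda>t. t powr p) has_real_derivative p * x powr (p - 1)) (at x)" if "x > 0" for x :: real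
    using that by (auto intro!: derivative_eq_intros)
  show ?thesis
  proof (cases "t > 1")
    case True
    with D obtain z where z: "1 < z" "z < t" "t powr p - 1 powr p = (t - 1) * (p * z powr (p - 1))"
      using MVT2[of 1 t "\<lambda>t. t powr p" "\<lambda>x. p * x powr (p - 1)"] by auto
    have "z powr (p - 1) > 1" using z assms by (intro gr_one_powr) auto
    then have "(t - 1) * (p * z powr (p - 1)) > (t - 1) * (p * 1)"
      using assms True by (intro mult_strict_left_mono) auto
    then show ?thesis using z by (simp add: algebra_simps)
  next
    case False
    then have "t < 1" using assms by simp
    with D assms obtain z where z: "t < z" "z < 1" "1 powr p - t powr p = (1 - t) * (p * z powr (p - 1))"
      using MVT2[of t 1 "\<lambda>t. t powr p" "\<lambda>x. p * x powr (p - 1)"] by auto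
    have "z powr (p - 1) < 1" using z assms powr_less_mono2[of "p - 1" z 1] by auto
    then have "(1 - t) * (p * z powr (p - 1)) < (1 - t) * (p * 1)"
      using assms \<open>t < 1\<close> by (intro mult_strict_left_mono) auto
    then show ?thesis using z by (simp add: algebra_simps)
  qed
qed

text \<open>Strict convexity of |s| powr p. Homogeneity reduces it to t = b / a and the tangent at
  1; for t \<le> 0 that tangent is already negative. Strictness will give uniqueness of the
  minimiser.\<close>

lemma abs_powr_gt_tangent:
  assumes "p > 1" "a \<noteq> b"
  shows "\<bar>b\<bar> powr p > \<bar>a\<bar> powr p + p * spow (p - 1) a * (b - a)"
proof (cases "a = 0")
  case True
  then show ?thesis using assms by (simp add: spow_def)
next
  case False
  define t where "t = b / a"
  have b: "b = t * a" using False by (simp add: t_def)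
  have t1: "t \<noteq> 1" using assms b by auto
  have "\<bar>t\<bar> powr p > 1 + p * (t - 1)"
  proof (cases "t > 0")
    case True
    then show ?thesis using powr_gt_tangent_at_1[OF assms(1) True t1] by simp
  next
    case F: False
    then have "1 + p * (t - 1) \<le> 1 - p" using assms mult_nonneg_nonpos[of p t] by (simp add: algebra_simps)
    also have "\<dots> < 0" using assms by simp
    also have "0 \<le> \<bar>t\<bar> powr p" by simp
    finally show ?thesis .
  qed
  then have "\<bar>a\<bar> powr p * \<bar>t\<bar> powr p > \<bar>a\<bar> powr p * (1 + p * (t - 1))"
    using False by (intro mult_strict_left_mono) auto
  moreover have "\<bar>a\<bar> powr p * \<bar>t\<bar> powr p = \<bar>b\<bar> powr p"
    by (simp add: b abs_mult powr_mult mult.commute)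
  moreover have "spow (p - 1) a * (b - a) = \<bar>a\<bar> powr p * (t - 1)"
  proof -
    have "spow (p - 1) a * a = \<bar>a\<bar> powr (p - 1) * \<bar>a\<bar> powr 1"
      using False by (auto simp: spow_def sgn_if)
    also have "\<dots> = \<bar>a\<bar> powr p" by (simp only: powr_add[symmetric]) simp
    finally have "spow (p - 1) a * a * (t - 1) = \<bar>a\<bar> powr p * (t - 1)" by simp
    then show ?thesis by (simp add: b algebra_simps)
  qed
  ultimately show ?thesis
    by (metis (no_types, opaque_lifting) distrib_left mult.assoc mult.commute mult.right_neutral)
qed

text \<open>The integral of \<open>spow (p - 1) (f x - t)\<close> is continuous in t by dominated
  convergence, so it has a zero between t1 and t2. Convexity turns any zero into a strict global
  minimiser. Existence, uniqueness and location thus all follow from two sign estimates.\<close>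

lemma minimiser_between_sign_change:
  fixes f :: "'a \<Rightarrow> real"
  assumes "finite_measure M" "measure M (space M) > 0" "p > 1"
    and f [measurable]: "f \<in> borel_measurable M" and K: "\<And>x. x \<in> space M \<Longrightarrow> \<bar>f x\<bar> \<le> K"
    and "t1 \<le> t2"
    and G1: "(\<integral>x. spow (p - 1) (f x - t1) \<partial>M) \<ge> 0" and G2: "(\<integral>x. spow (p - 1) (f x - t2) \<partial>M) \<le> 0"
  shows "\<exists>t. t1 \<le> t \<and> t \<le> t2 \<and>
    (\<forall>t'. t' \<noteq> t \<longrightarrow> (\<integral>x. \<bar>f x - t\<bar> powr p \<partial>M) < (\<integral>x. \<bar>f x - t'\<bar> powr p \<partial>M))"
proof -
  interpret finite_measure M by fact
  have bd: "\<bar>f x - t\<bar> powr q \<le> (K + \<bar>t\<bar>) powr q" if "x \<in> space M" "q \<ge> 0" for x t q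
    using K[OF that(1)] that(2) by (intro powr_mono2) auto
  have int: "integrable M (\<lambda>x. \<bar>f x - t\<bar> powr p)" for t
    by (rule integrable_const_bound[of _ "(K + \<bar>t\<bar>) powr p"]) (use bd assms in auto)
  have ints: "integrable M (\<lambda>x. spow (p - 1) (f x - t))" for t
    by (rule integrable_const_bound[of _ "(K + \<bar>t\<bar>) powr (p - 1)"]) (use bd assms in \<open>auto simp: abs_spow\<close>)
  have cont: "continuous_on {t1..t2} (\<lambda>t. \<integral>x. spow (p - 1) (f x - t) \<partial>M)"
    unfolding continuous_on_sequentially comp_def
  proof (intro allI ballI impI)
    fix X t assume t: "t \<in> {t1..t2}" "(\<forall>n. X n \<in> {t1..t2}) \<and> X \<longlonglongrightarrow> t"
    show "(\<lambda>n. \<integral>x. spow (p - 1) (f x - X n) \<partial>M) \<longlonglongrightarrow> (\<integral>x. spow (p - 1) (f x - t) \<partial>M)"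
    proof (rule integral_dominated_convergence[where w = "\<lambda>x. (K + max \<bar>t1\<bar> \<bar>t2\<bar>) powr (p - 1)"])
      have "isCont (spow (p - 1)) z" for z
        using continuous_on_spow[of "p - 1" UNIV] assms by (simp add: continuous_on_eq_continuous_at)
      then show "AE x in M. (\<lambda>n. spow (p - 1) (f x - X n)) \<longlonglongrightarrow> spow (p - 1) (f x - t)"
        using t by (intro AE_I2 isCont_tendsto_compose[of _ "spow (p - 1)"] tendsto_intros) auto
      show "AE x in M. norm (spow (p - 1) (f x - X n)) \<le> (K + max \<bar>t1\<bar> \<bar>t2\<bar>) powr (p - 1)" for n
      proof (rule AE_I2)
        fix x assume x: "x \<in> space M"
        have "X n \<in> {t1..t2}" using t by blast
        then have "\<bar>f x - X n\<bar> \<le> K + max \<bar>t1\<bar> \<bar>t2\<bar>" using K[OF x] by auto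
        then show "norm (spow (p - 1) (f x - X n)) \<le> (K + max \<bar>t1\<bar> \<bar>t2\<bar>) powr (p - 1)"
          using assms by (simp add: abs_spow powr_mono2)
      qed
    qed auto
  qed
  obtain t where t: "t1 \<le> t" "t \<le> t2" "(\<integral>x. spow (p - 1) (f x - t) \<partial>M) = 0"
    using IVT2'[OF G2 G1 assms(6) cont] by auto
  have "(\<integral>x. \<bar>f x - t\<bar> powr p \<partial>M) < (\<integral>x. \<bar>f x - t'\<bar> powr p \<partial>M)" if "t' \<noteq> t" for t'
  proof -
    \<comment> \<open>The tangent inequality is integrated; its linear term has integral zero by the
      choice of t.\<close>
    have "(\<integral>x. \<bar>f x - t\<bar> powr p + p * spow (p - 1) (f x - t) * (t - t') \<partial>M) < (\<integral>x. \<bar>f x - t'\<bar> powr p \<partial>M)"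
    proof (rule integral_less_AE_space)
      show "AE x in M. \<bar>f x - t\<bar> powr p + p * spow (p - 1) (f x - t) * (t - t') < \<bar>f x - t'\<bar> powr p"
      proof (rule AE_I2)
        fix x
        show "\<bar>f x - t\<bar> powr p + p * spow (p - 1) (f x - t) * (t - t') < \<bar>f x - t'\<bar> powr p"
          using abs_powr_gt_tangent[OF assms(3), of "f x - t" "f x - t'"] that by simp
      qed
      show "emeasure M (space M) \<noteq> 0" using assms(2) by (auto simp: measure_def)
    qed (intro Bochner_Integration.integrable_add int integrable_mult_left integrable_mult_right ints)+
    moreover have "(\<integral>x. \<bar>f x - t\<bar> powr p + p * spow (p - 1) (f x - t) * (t - t') \<partial>M) = (\<integral>x. \<bar>f x - t\<bar> powr p \<partial>M)"
      using t(3) by (simp add: int ints)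
    ultimately show ?thesis by simp
  qed
  then show ?thesis using t by blast
qed

section \<open>Second-order expansion of signed powers\<close>

lemma powr_taylor2:
  fixes x y q :: real
  assumes "x > 0" "y > 0" "x \<noteq> y"
  shows "\<exists>z. min x y < z \<and> z < max x y \<and>
    y powr q = x powr q + q * x powr (q - 1) * (y - x) + q * (q - 1) * z powr (q - 2) / 2 * (y - x)\<^sup>2"
proof -
  define diff where "diff n z = (if n = 0 then z powr q else if n = 1 then q * z powr (q - 1)
     else q * (q - 1) * z powr (q - 2))" for n :: nat and z :: real
  have "\<exists>t. (if y < x then y < t \<and> t < x else x < t \<and> t < y) \<and>
     y powr q = (\<Sum>m<2. diff m x / fact m * (y - x) ^ m) + diff 2 t / fact 2 * (y - x) ^ 2"
  proof (rule Taylor[of _ _ _ "min x y" "max x y"])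
    show "\<forall>m t. m < 2 \<and> min x y \<le> t \<and> t \<le> max x y \<longrightarrow> (diff m has_real_derivative diff (Suc m) t) (at t)"
    proof (intro allI impI)
      fix m :: nat and t assume *: "m < 2 \<and> min x y \<le> t \<and> t \<le> max x y"
      then have "t > 0" using assms by auto
      moreover have "m = 0 \<or> m = 1" using * by auto
      ultimately show "(diff m has_real_derivative diff (Suc m) t) (at t)"
        unfolding diff_def[abs_def] by (auto intro!: derivative_eq_intros)
    qed
  qed (use assms in \<open>auto simp: diff_def\<close>)
  then obtain t where t: "if y < x then y < t \<and> t < x else x < t \<and> t < y"
     "y powr q = (\<Sum>m<2. diff m x / fact m * (y - x) ^ m) + diff 2 t / fact 2 * (y - x) ^ 2" by blast
  show ?thesis
    using t by (intro exI[of _ t]) (auto simp: diff_def numeral_2_eq_2 split: if_splits)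
qed

text \<open>For \<open>2 < p < 3\<close> the second derivative of \<open>spow (p - 1)\<close> blows up at the origin like
  \<open>\<bar>a\<bar> powr (p - 3)\<close>, which is still locally integrable.\<close>

lemma spow_taylor:
  assumes "p \<ge> 2"
  shows "\<exists>\<alpha> C. -1 < \<alpha> \<and> C \<ge> 0 \<and> (\<forall>a h. a \<noteq> 0 \<longrightarrow> \<bar>a\<bar> \<le> 1 \<longrightarrow> \<bar>h\<bar> \<le> 1 \<longrightarrow>
    \<bar>spow (p - 1) (a + h) - spow (p - 1) a - (p - 1) * \<bar>a\<bar> powr (p - 2) * h\<bar> \<le> C * h\<^sup>2 * \<bar>a\<bar> powr \<alpha>)"
proof (cases "p = 2")
  case True
  \<comment> \<open>For p = 2 the exponent p - 3 would be the non-integrable -1, but the signed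
    power is then the identity and the remainder is zero.\<close>
  have "spow 1 s = s" for s by (simp add: spow_def sgn_if)
  with True show ?thesis by (intro exI[of _ 0]) auto
next
  case False
  with assms have p: "p > 2" by simp
  \<comment> \<open>For p \<ge> 3 the second derivative is bounded near 0 and exponent 0 suffices;
    below that the exponent is p - 3, which exceeds -1 because p > 2.\<close>
  define \<alpha> where "\<alpha> = min (p - 3) 0"
  \<comment> \<open>\<open>C1\<close> serves the Lagrange remainder for small h and
    \<open>C2\<close> the crude estimate for large h. The sums of powers of 2 cover both signs of p
    - 3.\<close>
  define C1 where "C1 = (p - 1) * (p - 2) * (2 powr (p - 3) + 2 powr (- (p - 3)))"
  define C2 where "C2 = (3 powr (p - 1) + 2 powr (p - 1) + (p - 1) * 2 powr (p - 2)) * (2 powr (3 - p) + 1)"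
  have W: "z powr (p - 3) \<le> (2 powr (p - 3) + 2 powr (- (p - 3))) * a powr \<alpha>"
    if "a / 2 \<le> z" "z \<le> 2" "0 < a" for z a
  proof (cases "p \<ge> 3")
    case True
    then have "z powr (p - 3) \<le> 2 powr (p - 3)" using that by (intro powr_mono2) auto
    also have "\<dots> \<le> (2 powr (p - 3) + 2 powr (- (p - 3))) * 1" by simp
    finally show ?thesis using True that by (simp add: \<alpha>_def)
  next
    case False
    then have "z powr (p - 3) \<le> (a / 2) powr (p - 3)" using that by (intro powr_mono2') auto
    also have "\<dots> = a powr \<alpha> * 2 powr (- (p - 3))"
      using False that by (simp add: \<alpha>_def powr_divide powr_diff field_simps)
    also have "\<dots> \<le> a powr \<alpha> * (2 powr (p - 3) + 2 powr (- (p - 3)))"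
      by (intro mult_left_mono) auto
    finally show ?thesis by (simp add: mult.commute)
  qed
  have main: "\<bar>spow (p - 1) (a + h) - spow (p - 1) a - (p - 1) * \<bar>a\<bar> powr (p - 2) * h\<bar> \<le> (C1 + C2) * h\<^sup>2 * \<bar>a\<bar> powr \<alpha>"
    if a: "0 < a" "a \<le> 1" and h: "\<bar>h\<bar> \<le> 1" for a h
  proof (cases "\<bar>h\<bar> \<le> a / 2")
    \<comment> \<open>The segment from a to a + h stays within [a/2, 2], away from the singularity,
      so the Lagrange remainder applies.\<close>
    case True
    show ?thesis
    proof (cases "h = 0")
      case False
      have ah: "a + h > 0" using True a by linarith
      then obtain z where z: "min a (a + h) < z" "z < max a (a + h)"
        "(a + h) powr (p - 1) = a powr (p - 1) + (p - 1) * a powr (p - 1 - 1) * (a + h - a)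
           + (p - 1) * (p - 1 - 1) * z powr (p - 1 - 2) / 2 * (a + h - a)\<^sup>2"
        using powr_taylor2[of a "a + h" "p - 1"] a False by auto
      have zb: "a / 2 \<le> z" "z \<le> 2" using z(1,2) a True h by (auto simp: min_def max_def split: if_splits)
      have eq: "spow (p - 1) (a + h) - spow (p - 1) a - (p - 1) * \<bar>a\<bar> powr (p - 2) * h
         = (p - 1) * (p - 2) / 2 * h\<^sup>2 * z powr (p - 3)"
        using z(3) a ah by (simp add: spow_def)
      have "\<bar>spow (p - 1) (a + h) - spow (p - 1) a - (p - 1) * \<bar>a\<bar> powr (p - 2) * h\<bar>
         = (p - 1) * (p - 2) / 2 * h\<^sup>2 * z powr (p - 3)"
        unfolding eq using p by (simp add: abs_mult)
      also have "\<dots> \<le> (p - 1) * (p - 2) / 2 * h\<^sup>2 * ((2 powr (p - 3) + 2 powr (- (p - 3))) * a powr \<alpha>)"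
        using p W[OF zb a(1)] by (intro mult_left_mono) auto
      also have "\<dots> = C1 / 2 * (h\<^sup>2 * a powr \<alpha>)" by (simp add: C1_def)
      also have "\<dots> \<le> (C1 + C2) * (h\<^sup>2 * a powr \<alpha>)"
        using p by (intro mult_right_mono) (auto simp: C1_def C2_def)
      finally show ?thesis using a by (simp add: mult.assoc)
    qed simp
  next
    case False
    then have hp: "\<bar>h\<bar> > 0" "a / 2 < \<bar>h\<bar>" using a by auto
    have hh: "\<bar>h\<bar> powr (p - 1) = h\<^sup>2 * \<bar>h\<bar> powr (p - 3)"
      using hp powr_add[of "\<bar>h\<bar>" 2 "p - 3"] by (simp add: powr_numeral)
    have "\<bar>spow (p - 1) (a + h)\<bar> \<le> (3 * \<bar>h\<bar>) powr (p - 1)"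
      unfolding abs_spow using hp a p by (intro powr_mono2) auto
    moreover have "\<bar>spow (p - 1) a\<bar> \<le> (2 * \<bar>h\<bar>) powr (p - 1)"
      unfolding abs_spow using hp a p by (intro powr_mono2) auto
    moreover have "\<bar>(p - 1) * \<bar>a\<bar> powr (p - 2) * h\<bar> \<le> (p - 1) * (2 * \<bar>h\<bar>) powr (p - 2) * \<bar>h\<bar>"
    proof -
      have "\<bar>a\<bar> powr (p - 2) \<le> (2 * \<bar>h\<bar>) powr (p - 2)" using hp a p by (intro powr_mono2) auto
      then show ?thesis using p by (simp add: abs_mult mult_left_mono mult_right_mono)
    qed
    moreover have "\<bar>h\<bar> powr (p - 2) * \<bar>h\<bar> = \<bar>h\<bar> powr (p - 1)"
      using hp powr_add[of "\<bar>h\<bar>" "p - 2" 1] by simp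
    ultimately have "\<bar>spow (p - 1) (a + h) - spow (p - 1) a - (p - 1) * \<bar>a\<bar> powr (p - 2) * h\<bar>
       \<le> 3 powr (p - 1) * \<bar>h\<bar> powr (p - 1) + 2 powr (p - 1) * \<bar>h\<bar> powr (p - 1)
         + (p - 1) * 2 powr (p - 2) * \<bar>h\<bar> powr (p - 1)"
      using abs_triangle_ineq4[of "spow (p - 1) (a + h) - spow (p - 1) a" "(p - 1) * \<bar>a\<bar> powr (p - 2) * h"]
        abs_triangle_ineq4[of "spow (p - 1) (a + h)" "spow (p - 1) a"] by (simp add: powr_mult mult.assoc)
    also have "\<dots> = (3 powr (p - 1) + 2 powr (p - 1) + (p - 1) * 2 powr (p - 2)) * h\<^sup>2 * \<bar>h\<bar> powr (p - 3)"
      by (simp add: hh algebra_simps)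
    also have "\<dots> \<le> (3 powr (p - 1) + 2 powr (p - 1) + (p - 1) * 2 powr (p - 2)) * h\<^sup>2 * ((2 powr (3 - p) + 1) * a powr \<alpha>)"
    proof (intro mult_left_mono)
      show "\<bar>h\<bar> powr (p - 3) \<le> (2 powr (3 - p) + 1) * a powr \<alpha>"
      proof (cases "p \<ge> 3")
        case True
        then have "\<bar>h\<bar> powr (p - 3) \<le> 1" using h by (intro powr_le1) auto
        then show ?thesis using True a by (simp add: \<alpha>_def add_increasing)
      next
        case False
        then have "\<bar>h\<bar> powr (p - 3) \<le> (a / 2) powr (p - 3)" using hp a by (intro powr_mono2') auto
        also have "\<dots> = a powr \<alpha> * 2 powr (3 - p)"
          using False a by (simp add: \<alpha>_def powr_divide powr_diff field_simps)
        also have "\<dots> \<le> (2 powr (3 - p) + 1) * a powr \<alpha>"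
          by (simp add: algebra_simps)
        finally show ?thesis .
      qed
    qed (use p in auto)
    also have "\<dots> = C2 * (h\<^sup>2 * a powr \<alpha>)" by (simp add: C2_def)
    also have "\<dots> \<le> (C1 + C2) * (h\<^sup>2 * a powr \<alpha>)"
      using p by (intro mult_right_mono) (auto simp: C1_def C2_def)
    finally show ?thesis using a by (simp add: mult.assoc)
  qed
  show ?thesis
  proof (rule exI[of _ \<alpha>], rule exI[of _ "C1 + C2"], intro conjI allI impI)
    show "-1 < \<alpha>" using p by (simp add: \<alpha>_def)
    show "0 \<le> C1 + C2" using p by (simp add: C1_def C2_def)
    fix a h :: real assume *: "a \<noteq> 0" "\<bar>a\<bar> \<le> 1" "\<bar>h\<bar> \<le> 1"
    show "\<bar>spow (p - 1) (a + h) - spow (p - 1) a - (p - 1) * \<bar>a\<bar> powr (p - 2) * h\<bar> \<le> (C1 + C2) * h\<^sup>2 * \<bar>a\<bar> powr \<alpha>"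
    proof (cases "a > 0")
      case True
      then show ?thesis using main * by simp
    next
      case False
      \<comment> \<open>The remainder is odd under changing the signs of a and h together, which
        reduces negative a to positive a.\<close>
      have "spow (p - 1) (a + h) - spow (p - 1) a - (p - 1) * \<bar>a\<bar> powr (p - 2) * h
        = - (spow (p - 1) (- a + - h) - spow (p - 1) (- a) - (p - 1) * \<bar>- a\<bar> powr (p - 2) * (- h))"
        using spow_minus[of "p - 1" "a + h"] by (simp add: spow_minus)
      then show ?thesis using main[of "- a" "- h"] * False by simp
    qed
  qed
qed

text \<open>The analytic core, free of the Heisenberg group. \<open>L\<close> is the leading term
  z_1, and \<tau> is the average of q with weight |L| powr (p - 2). K and e are chosen before q, f
  and \<tau>, which is what makes the final constants uniform.\<close>

lemma perturbed_mean:
  fixes L :: "'a \<Rightarrow> real"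
  assumes M: "finite_measure M" and p: "p \<ge> 2"
    and L [measurable]: "L \<in> borel_measurable M" and L_le: "\<forall>x\<in>space M. \<bar>L x\<bar> \<le> 1"
    and L0: "AE x in M. L x \<noteq> 0"
    and odd: "(\<integral>x. spow (p - 1) (L x) \<partial>M) = 0"
    and D: "(\<integral>x. \<bar>L x\<bar> powr (p - 2) \<partial>M) > 0"
    and sing: "\<forall>\<alpha>>-1. integrable M (\<lambda>x. \<bar>L x\<bar> powr \<alpha>)"
    and QR: "Q \<ge> 0" "R \<ge> 0"
  shows "\<exists>K>0. \<exists>e>0. \<forall>\<epsilon> q f \<tau>. 0 < \<epsilon> \<longrightarrow> \<epsilon> < e \<longrightarrow> q \<in> borel_measurable M \<longrightarrow> f \<in> borel_measurable M \<longrightarrow>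
     (\<forall>x\<in>space M. \<bar>q x\<bar> \<le> Q) \<longrightarrow> (\<forall>x\<in>space M. \<bar>f x - L x - \<epsilon> * q x\<bar> \<le> R * \<epsilon>\<^sup>2) \<longrightarrow>
     (\<integral>x. \<bar>L x\<bar> powr (p - 2) * q x \<partial>M) = \<tau> * (\<integral>x. \<bar>L x\<bar> powr (p - 2) \<partial>M) \<longrightarrow>
     (\<exists>t. \<bar>t - \<epsilon> * \<tau>\<bar> \<le> K * \<epsilon>\<^sup>2 \<and>
       (\<forall>t'. t' \<noteq> t \<longrightarrow> (\<integral>x. \<bar>f x - t\<bar> powr p \<partial>M) < (\<integral>x. \<bar>f x - t'\<bar> powr p \<partial>M)))"
proof -
  interpret finite_measure M by fact
  note L1 = L_le[rule_format]
  let ?D = "\<integral>x. \<bar>L x\<bar> powr (p - 2) \<partial>M"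
  obtain \<alpha> C where \<alpha>: "-1 < \<alpha>" and C: "C \<ge> 0" and
    taylor: "\<And>a h. a \<noteq> 0 \<Longrightarrow> \<bar>a\<bar> \<le> 1 \<Longrightarrow> \<bar>h\<bar> \<le> 1 \<Longrightarrow>
    \<bar>spow (p - 1) (a + h) - spow (p - 1) a - (p - 1) * \<bar>a\<bar> powr (p - 2) * h\<bar> \<le> C * h\<^sup>2 * \<bar>a\<bar> powr \<alpha>"
    using spow_taylor[OF p] by metis
  define I where "I = (\<integral>x. \<bar>L x\<bar> powr \<alpha> \<partial>M)"
  have I0: "I \<ge> 0" unfolding I_def by (intro Bochner_Integration.integral_nonneg) auto
  \<comment> \<open>Bounds the perturbation q - \<tau> + \<epsilon> (r + s) used below: q and \<tau>
    contribute Q each, and the last term is at most 1 for small \<epsilon>.\<close>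
  define B where "B = 2 * Q + 1"
  define W where "W = C * B\<^sup>2 * I"
  have W0: "W \<ge> 0" using C I0 by (simp add: W_def)
  \<comment> \<open>R absorbs the average of the rescaled remainder, the quotient absorbs the Taylor
    error W, and the final 1 leaves a strict margin.\<close>
  define K where "K = R + W / ((p - 1) * ?D) + 1"
  define e where "e = 1 / (R + K + B)"
  have K: "K > 0" using QR W0 p D by (simp add: K_def add_nonneg_pos)
  have B: "B \<ge> 1" using QR by (simp add: B_def)
  \<comment> \<open>On a null space the weight would have integral zero.\<close>
  have pm: "measure M (space M) > 0"
  proof (rule ccontr)
    assume "\<not> ?thesis"
    then have "measure M (space M) = 0" using measure_nonneg[of M "space M"] by simp
    then have "emeasure M (space M) = 0" by (simp add: emeasure_eq_measure)
    then have "AE x in M. \<bar>L x\<bar> powr (p - 2) = 0"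
      by (intro AE_I'[of "space M"]) (auto intro: null_setsI)
    then have "?D = 0" by (rule integral_eq_zero_AE)
    then show False using D by simp
  qed
  \<comment> \<open>First-order expansion, uniform in k. The zeroth-order term vanishes by
    \<open>odd\<close>, and the pointwise Taylor error has an integrable majorant by
    \<open>sing\<close>, since \<alpha> > -1.\<close>
  have expand: "\<bar>(\<integral>x. spow (p - 1) (L x + \<epsilon> * k x) \<partial>M) - (p - 1) * \<epsilon> * (\<integral>x. \<bar>L x\<bar> powr (p - 2) * k x \<partial>M)\<bar> \<le> W * \<epsilon>\<^sup>2"
    if k[measurable]: "k \<in> borel_measurable M" and kB: "\<And>x. x \<in> space M \<Longrightarrow> \<bar>k x\<bar> \<le> B"
      and \<epsilon>: "0 < \<epsilon>" "\<epsilon> * B \<le> 1" for k \<epsilon>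
  proof -
    have ek: "\<bar>\<epsilon> * k x\<bar> \<le> \<epsilon> * B" if "x \<in> space M" for x
      using kB[OF that] \<epsilon> by (simp add: abs_mult)
    have i1: "integrable M (\<lambda>x. spow (p - 1) (L x + \<epsilon> * k x))"
    proof (rule integrable_const_bound[of _ "2 powr (p - 1)"])
      show "AE x in M. norm (spow (p - 1) (L x + \<epsilon> * k x)) \<le> 2 powr (p - 1)"
      proof (rule AE_I2)
        fix x assume x: "x \<in> space M"
        then have "\<bar>L x + \<epsilon> * k x\<bar> \<le> 2" using L1[OF x] ek[OF x] \<epsilon> by linarith
        then show "norm (spow (p - 1) (L x + \<epsilon> * k x)) \<le> 2 powr (p - 1)"
          using p by (auto simp: abs_spow intro!: powr_mono2)
      qed
    qed auto
    have i2: "integrable M (\<lambda>x. spow (p - 1) (L x))"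
      by (rule integrable_const_bound[of _ 1]) (use L1 p in \<open>auto simp: abs_spow intro!: powr_le1\<close>)
    have i3: "integrable M (\<lambda>x. \<bar>L x\<bar> powr (p - 2) * k x)"
    proof (rule integrable_const_bound[of _ B])
      show "AE x in M. norm (\<bar>L x\<bar> powr (p - 2) * k x) \<le> B"
      proof (rule AE_I2)
        fix x assume x: "x \<in> space M"
        have "\<bar>L x\<bar> powr (p - 2) \<le> 1" using L1[OF x] p by (intro powr_le1) auto
        then show "norm (\<bar>L x\<bar> powr (p - 2) * k x) \<le> B"
          using kB[OF x] B mult_mono[of "\<bar>L x\<bar> powr (p - 2)" 1 "\<bar>k x\<bar>" B] by (simp add: abs_mult)
      qed
    qed auto
    let ?r = "\<lambda>x. spow (p - 1) (L x + \<epsilon> * k x) - spow (p - 1) (L x) - (p - 1) * \<epsilon> * (\<bar>L x\<bar> powr (p - 2) * k x)"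
    have ir: "integrable M ?r"
      by (intro Bochner_Integration.integrable_diff i1 i2 integrable_mult_right i3)
    have eq: "(\<integral>x. spow (p - 1) (L x + \<epsilon> * k x) \<partial>M) - (p - 1) * \<epsilon> * (\<integral>x. \<bar>L x\<bar> powr (p - 2) * k x \<partial>M) = (\<integral>x. ?r x \<partial>M)"
      unfolding Bochner_Integration.integral_diff[OF Bochner_Integration.integrable_diff[OF i1 i2] integrable_mult_right[OF i3]]
        Bochner_Integration.integral_diff[OF i1 i2] odd integral_mult_right_zero by simp
    have "\<bar>(\<integral>x. spow (p - 1) (L x + \<epsilon> * k x) \<partial>M) - (p - 1) * \<epsilon> * (\<integral>x. \<bar>L x\<bar> powr (p - 2) * k x \<partial>M)\<bar>
        \<le> (\<integral>x. \<bar>?r x\<bar> \<partial>M)" unfolding eq by (rule integral_abs_bound)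
    also have "\<dots> \<le> (\<integral>x. C * (\<epsilon> * B)\<^sup>2 * \<bar>L x\<bar> powr \<alpha> \<partial>M)"
    proof (rule integral_mono_AE)
      show "AE x in M. \<bar>?r x\<bar> \<le> C * (\<epsilon> * B)\<^sup>2 * \<bar>L x\<bar> powr \<alpha>"
        using L0
      proof (rule AE_mp, intro AE_I2 impI)
        fix x assume x: "x \<in> space M" "L x \<noteq> 0"
        have "\<bar>?r x\<bar> \<le> C * (\<epsilon> * k x)\<^sup>2 * \<bar>L x\<bar> powr \<alpha>"
          using taylor[OF x(2) L1[OF x(1)], of "\<epsilon> * k x"] ek[OF x(1)] \<epsilon> by (simp add: mult_ac)
        also have "\<dots> \<le> C * (\<epsilon> * B)\<^sup>2 * \<bar>L x\<bar> powr \<alpha>"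
          using ek[OF x(1)] C \<epsilon> B by (intro mult_right_mono mult_left_mono) (auto simp: abs_le_square_iff[symmetric])
        finally show "\<bar>?r x\<bar> \<le> C * (\<epsilon> * B)\<^sup>2 * \<bar>L x\<bar> powr \<alpha>" .
      qed
    qed (use ir sing[rule_format, OF \<alpha>] in auto)
    also have "\<dots> = W * \<epsilon>\<^sup>2" by (simp add: W_def I_def power_mult_distrib)
    finally show ?thesis .
  qed
  show ?thesis
  proof (rule exI[of _ K], rule conjI, fact K, rule exI[of _ e], intro conjI allI impI)
    show "0 < e" using K B QR by (simp add: e_def)
    fix \<epsilon> \<tau> :: real and q f :: "'a \<Rightarrow> real"
    assume \<epsilon>: "0 < \<epsilon>" "\<epsilon> < e" and q[measurable]: "q \<in> borel_measurable M" and f[measurable]: "f \<in> borel_measurable M"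
      and qQ: "\<forall>x\<in>space M. \<bar>q x\<bar> \<le> Q" and fR: "\<forall>x\<in>space M. \<bar>f x - L x - \<epsilon> * q x\<bar> \<le> R * \<epsilon>\<^sup>2"
      and \<tau>: "(\<integral>x. \<bar>L x\<bar> powr (p - 2) * q x \<partial>M) = \<tau> * ?D"
    have ebound: "\<epsilon> * (R + K + B) \<le> 1"
      using \<epsilon>(2) K B QR by (simp add: e_def field_simps)
    have eB: "\<epsilon> * B \<le> 1" "\<epsilon> * (R + K) \<le> 1"
      using \<epsilon> K QR B
      by (auto intro!: order_trans[OF mult_left_mono[of _ "R + K + B" \<epsilon>] ebound])
    have i0: "integrable M (\<lambda>x. \<bar>L x\<bar> powr (p - 2))"
      by (rule integrable_const_bound[of _ 1]) (use L1 p in \<open>auto intro!: powr_le1\<close>)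
    have wk: "\<bar>\<bar>L x\<bar> powr (p - 2) * g\<bar> \<le> \<bar>g\<bar>" if "x \<in> space M" for g x
    proof -
      have "\<bar>L x\<bar> powr (p - 2) \<le> 1" using L1[OF that] p by (intro powr_le1) auto
      then show ?thesis using mult_right_mono[of "\<bar>L x\<bar> powr (p - 2)" 1 "\<bar>g\<bar>"] by (simp add: abs_mult)
    qed
    have iq: "integrable M (\<lambda>x. \<bar>L x\<bar> powr (p - 2) * q x)"
      using order_trans[OF wk] qQ by (intro integrable_const_bound[of _ Q] AE_I2) (simp_all del: abs_mult)
    define r where "r x = (f x - L x - \<epsilon> * q x) / \<epsilon>\<^sup>2" for x
    have r[measurable]: "r \<in> borel_measurable M" unfolding r_def[abs_def] by measurable
    have rR: "\<bar>r x\<bar> \<le> R" if "x \<in> space M" for x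
      using fR that \<epsilon> by (simp add: r_def abs_divide pos_divide_le_eq)
    have ir: "integrable M (\<lambda>x. \<bar>L x\<bar> powr (p - 2) * r x)"
      using order_trans[OF wk rR] by (intro integrable_const_bound[of _ R] AE_I2) (simp_all del: abs_mult)
    have rD: "\<bar>\<integral>x. \<bar>L x\<bar> powr (p - 2) * r x \<partial>M\<bar> \<le> R * ?D"
    proof -
      have "\<bar>\<integral>x. \<bar>L x\<bar> powr (p - 2) * r x \<partial>M\<bar> \<le> (\<integral>x. \<bar>\<bar>L x\<bar> powr (p - 2) * r x\<bar> \<partial>M)" by (rule integral_abs_bound)
      also have "\<dots> \<le> (\<integral>x. R * \<bar>L x\<bar> powr (p - 2) \<partial>M)"
        by (intro integral_mono integrable_abs ir integrable_mult_right i0)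
          (auto simp: abs_mult mult.commute[of R] intro!: mult_left_mono rR)
      finally show ?thesis by simp
    qed
    \<comment> \<open>\<tau> is a weighted average of q and inherits its bound.\<close>
    have qD: "\<bar>\<tau>\<bar> \<le> Q"
    proof -
      have "\<bar>\<integral>x. \<bar>L x\<bar> powr (p - 2) * q x \<partial>M\<bar> \<le> (\<integral>x. \<bar>\<bar>L x\<bar> powr (p - 2) * q x\<bar> \<partial>M)" by (rule integral_abs_bound)
      also have "\<dots> \<le> (\<integral>x. Q * \<bar>L x\<bar> powr (p - 2) \<partial>M)"
        using qQ by (intro integral_mono integrable_abs iq integrable_mult_right i0)
          (auto simp: abs_mult mult.commute[of Q] intro!: mult_left_mono)
      finally show ?thesis using D by (simp add: \<tau> abs_mult)
    qed
    \<comment> \<open>At t = \<epsilon> \<tau> - s \<epsilon>^2 the order-\<epsilon> term cancels by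
      the choice of \<tau>. The signs at s = K and s = -K are therefore decided at order
      \<epsilon>^2, where K outweighs both errors.\<close>
    have G: "\<bar>(\<integral>x. spow (p - 1) (f x - (\<epsilon> * \<tau> - s * \<epsilon>\<^sup>2)) \<partial>M)
        - (p - 1) * \<epsilon>\<^sup>2 * ((\<integral>x. \<bar>L x\<bar> powr (p - 2) * r x \<partial>M) + s * ?D)\<bar> \<le> W * \<epsilon>\<^sup>2"
      if "\<bar>s\<bar> = K" for s
    proof -
      let ?k = "\<lambda>x. q x - \<tau> + \<epsilon> * (r x + s)"
      have "\<bar>?k x\<bar> \<le> B" if x: "x \<in> space M" for x
      proof -
        have "\<bar>r x + s\<bar> \<le> R + K" using rR[OF x] \<open>\<bar>s\<bar> = K\<close> by linarith
        then have "\<epsilon> * \<bar>r x + s\<bar> \<le> \<epsilon> * (R + K)" using \<epsilon> by (intro mult_left_mono) auto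
        then have "\<bar>\<epsilon> * (r x + s)\<bar> \<le> 1" using eB(2) \<epsilon> by (simp only: abs_mult)
        moreover have "\<bar>q x\<bar> \<le> Q" using qQ x by blast
        ultimately show ?thesis using qD unfolding B_def by linarith
      qed
      moreover have "f x - (\<epsilon> * \<tau> - s * \<epsilon>\<^sup>2) = L x + \<epsilon> * ?k x" for x
        using \<epsilon> by (simp add: r_def field_simps power2_eq_square)
      moreover have "(\<integral>x. \<bar>L x\<bar> powr (p - 2) * ?k x \<partial>M) = \<epsilon> * ((\<integral>x. \<bar>L x\<bar> powr (p - 2) * r x \<partial>M) + s * ?D)"
      proof -
        have "(\<integral>x. \<bar>L x\<bar> powr (p - 2) * ?k x \<partial>M) = (\<integral>x. \<bar>L x\<bar> powr (p - 2) * q x - \<tau> * \<bar>L x\<bar> powr (p - 2)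
            + (\<epsilon> * (\<bar>L x\<bar> powr (p - 2) * r x) + \<epsilon> * s * \<bar>L x\<bar> powr (p - 2)) \<partial>M)"
          by (intro Bochner_Integration.integral_cong) (auto simp: algebra_simps)
        also have "\<dots> = \<epsilon> * ((\<integral>x. \<bar>L x\<bar> powr (p - 2) * r x \<partial>M) + s * ?D)"
          using iq ir i0 \<tau> by (simp add: Bochner_Integration.integral_add Bochner_Integration.integral_diff mult.assoc distrib_left)
        finally show ?thesis .
      qed
      ultimately show ?thesis
        using expand[of ?k \<epsilon>] \<epsilon> eB by (simp add: power2_eq_square mult_ac)
    qed
    have KW: "(p - 1) * ((K - R) * ?D) > W"
    proof -
      have "(p - 1) * ((K - R) * ?D) = W + (p - 1) * ?D"
        using p D by (simp add: K_def field_simps)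
      then show ?thesis using p D by simp
    qed
    have G1: "(\<integral>x. spow (p - 1) (f x - (\<epsilon> * \<tau> - K * \<epsilon>\<^sup>2)) \<partial>M) \<ge> 0"
    proof -
      have "(p - 1) * ((\<integral>x. \<bar>L x\<bar> powr (p - 2) * r x \<partial>M) + K * ?D) \<ge> (p - 1) * ((K - R) * ?D)"
        using rD p by (intro mult_left_mono) (auto simp: algebra_simps)
      then have "W * \<epsilon>\<^sup>2 \<le> (p - 1) * ((\<integral>x. \<bar>L x\<bar> powr (p - 2) * r x \<partial>M) + K * ?D) * \<epsilon>\<^sup>2"
        using KW by (intro mult_right_mono) auto
      then show ?thesis using G[of K] K by (simp add: mult_ac)
    qed
    have G2: "(\<integral>x. spow (p - 1) (f x - (\<epsilon> * \<tau> + K * \<epsilon>\<^sup>2)) \<partial>M) \<le> 0"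
    proof -
      have "(p - 1) * ((\<integral>x. \<bar>L x\<bar> powr (p - 2) * r x \<partial>M) + (- K) * ?D) \<le> (p - 1) * (- ((K - R) * ?D))"
        using rD p by (intro mult_left_mono) (auto simp: algebra_simps)
      then have "(p - 1) * ((\<integral>x. \<bar>L x\<bar> powr (p - 2) * r x \<partial>M) + (- K) * ?D) * \<epsilon>\<^sup>2 \<le> (- W) * \<epsilon>\<^sup>2"
        using KW by (intro mult_right_mono) auto
      then show ?thesis using G[of "- K"] K by (simp add: mult_ac)
    qed
    have fb: "\<bar>f x\<bar> \<le> 1 + \<epsilon> * Q + R * \<epsilon>\<^sup>2" if "x \<in> space M" for x
    proof -
      have "\<epsilon> * \<bar>q x\<bar> \<le> \<epsilon> * Q" using qQ that \<epsilon> by (intro mult_left_mono) auto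
      then have "\<bar>\<epsilon> * q x\<bar> \<le> \<epsilon> * Q" using \<epsilon> by (simp add: abs_mult)
      moreover have "\<bar>f x - L x - \<epsilon> * q x\<bar> \<le> R * \<epsilon>\<^sup>2" using fR that by blast
      ultimately show ?thesis using L1[OF that] by linarith
    qed
    obtain t where "\<epsilon> * \<tau> - K * \<epsilon>\<^sup>2 \<le> t" "t \<le> \<epsilon> * \<tau> + K * \<epsilon>\<^sup>2"
      "\<forall>t'. t' \<noteq> t \<longrightarrow> (\<integral>x. \<bar>f x - t\<bar> powr p \<partial>M) < (\<integral>x. \<bar>f x - t'\<bar> powr p \<partial>M)"
      using minimiser_between_sign_change[OF M pm _ f fb _ G1 G2] p K by force
    then show "\<exists>t. \<bar>t - \<epsilon> * \<tau>\<bar> \<le> K * \<epsilon>\<^sup>2 \<and>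
       (\<forall>t'. t' \<noteq> t \<longrightarrow> (\<integral>x. \<bar>f x - t\<bar> powr p \<partial>M) < (\<integral>x. \<bar>f x - t'\<bar> powr p \<partial>M))"
      by (intro exI[of _ t]) auto
  qed
qed

section \<open>Integrals over the Koranyi unit ball\<close>

lemma Beta_real_nonneg: "a > 0 \<Longrightarrow> b > 0 \<Longrightarrow> Beta a (b :: real) \<ge> 0"
  by (simp add: Beta_def Gamma_real_pos less_imp_le)

lemma nn_integral_Beta:
  assumes "a > 0" "b > (0::real)"
  shows "(\<integral>\<^sup>+t. ennreal (t powr (a - 1) * (1 - t) powr (b - 1)) * indicator {0..1} t \<partial>lborel) = ennreal (Beta a b)"
  by (rule nn_integral_has_integral_lebesgue'[OF _ has_integral_Beta_real[OF assms]]) auto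

text \<open>The two half intervals overlap in 0, where F vanishes, so the splitting is exact at
  every point.\<close>

lemma nn_integral_even_Icc:
  fixes F :: "real \<Rightarrow> real"
  assumes [measurable]: "F \<in> borel_measurable borel" and "\<And>x. F (- x) = F x" "F 0 = 0" and pos: "\<And>x. F x \<ge> 0"
  shows "(\<integral>\<^sup>+x. ennreal (F x) * indicator {-r..r} x \<partial>lborel) = 2 * (\<integral>\<^sup>+x. ennreal (F x) * indicator {0..r} x \<partial>lborel)"
proof -
  have "ennreal (F x) * indicator {-r..r} x = ennreal (F x) * indicator {0..r} x + ennreal (F x) * indicator {0..r} (- x)" for x
    using assms(3) by (cases "x = 0") (auto split: split_indicator)
  then have "(\<integral>\<^sup>+x. ennreal (F x) * indicator {-r..r} x \<partial>lborel) = (\<integral>\<^sup>+x. ennreal (F x) * indicator {0..r} x \<partial>lborel)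
     + (\<integral>\<^sup>+x. ennreal (F x) * indicator {0..r} (- x) \<partial>lborel)"
    by (simp add: nn_integral_add)
  also have "(\<integral>\<^sup>+x. ennreal (F x) * indicator {0..r} (- x) \<partial>lborel) = (\<integral>\<^sup>+x. ennreal (F x) * indicator {0..r} x \<partial>lborel)"
    using nn_integral_real_affine[of "\<lambda>x. ennreal (F x) * indicator {0..r} x" "-1" 0] assms(2) by simp
  finally show ?thesis by (simp add: mult_2)
qed

text \<open>The substitution t = (x / r)^2 turns the Beta integral into the half-interval version of
  this one; the power of r is the homogeneity degree. Nonnegative integrals give finiteness and
  value together, even with singular exponents.\<close>

lemma nn_integral_powr_Beta:
  assumes a: "a > -1" and c: "c > -1" and r: "r > 0"
  shows "(\<integral>\<^sup>+x. ennreal (\<bar>x\<bar> powr a * (r\<^sup>2 - x\<^sup>2) powr c) * indicator {-r..r} x \<partial>lborel)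
     = ennreal (r powr (a + 2 * c + 1) * Beta ((a + 1) / 2) (c + 1))"
proof -
  let ?f = "\<lambda>t. t powr ((a + 1) / 2 - 1) * (1 - t) powr c"
  have "ennreal (Beta ((a + 1) / 2) (c + 1)) = (\<integral>\<^sup>+t. ennreal (?f t) * indicator {0..1} t \<partial>lborel)"
    using nn_integral_Beta[of "(a + 1) / 2" "c + 1"] a c by simp
  also have "\<dots> = (\<integral>\<^sup>+t. ennreal (?f t) * indicator {(0 / r)\<^sup>2..(r / r)\<^sup>2} t \<partial>lborel)"
    using r by simp
  also have "\<dots> = (\<integral>\<^sup>+x. ennreal (?f ((x / r)\<^sup>2) * (2 * x / r\<^sup>2)) * indicator {0..r} x \<partial>lborel)"
    unfolding nn_integral_set_ennreal
  proof (rule nn_integral_substitution[where f = ?f and g = "\<lambda>x. (x / r)\<^sup>2" and g' = "\<lambda>x. 2 * x / r\<^sup>2"])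
    show "set_borel_measurable borel {(0 / r)\<^sup>2..(r / r)\<^sup>2} ?f"
      unfolding set_borel_measurable_def by measurable
    show "((\<lambda>x. (x / r)\<^sup>2) has_real_derivative 2 * x / r\<^sup>2) (at x)" for x
      using r by (auto intro!: derivative_eq_intros simp: power2_eq_square)
  qed (use r in \<open>auto intro!: continuous_intros\<close>)
  also have "\<dots> = (\<integral>\<^sup>+x. ennreal (2 / r powr (a + 2 * c + 1)) * (ennreal (\<bar>x\<bar> powr a * (r\<^sup>2 - x\<^sup>2) powr c) * indicator {0..r} x) \<partial>lborel)"
  proof (rule nn_integral_cong)
    fix x :: real
    have "?f ((x / r)\<^sup>2) * (2 * x / r\<^sup>2) = 2 / r powr (a + 2 * c + 1) * (\<bar>x\<bar> powr a * (r\<^sup>2 - x\<^sup>2) powr c)" if x: "0 < x" "x \<le> r"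
    proof -
      have "((x / r)\<^sup>2) powr ((a + 1) / 2 - 1) = (x / r) powr (a - 1)"
      proof -
        have "((x / r)\<^sup>2) powr ((a + 1) / 2 - 1) = ((x / r) powr 2) powr ((a + 1) / 2 - 1)"
          using x r by (simp add: powr_numeral)
        also have "\<dots> = (x / r) powr (2 * ((a + 1) / 2 - 1))" by (rule powr_powr)
        also have "2 * ((a + 1) / 2 - 1) = a - 1" by simp
        finally show ?thesis .
      qed
      then have 1: "((x / r)\<^sup>2) powr ((a + 1) / 2 - 1) = x powr a / x * r / r powr a"
        using x r by (simp add: powr_divide powr_diff)
      have "1 - (x / r)\<^sup>2 = (r\<^sup>2 - x\<^sup>2) / r\<^sup>2" using r by (simp add: field_simps)
      moreover have "r\<^sup>2 - x\<^sup>2 \<ge> 0" using x by (simp add: power_mono)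
      ultimately have "(1 - (x / r)\<^sup>2) powr c = (r\<^sup>2 - x\<^sup>2) powr c / (r\<^sup>2) powr c"
        by (simp add: powr_divide)
      moreover have "(r\<^sup>2) powr c = r powr (2 * c)"
        using r powr_powr[of r 2 c] by (simp add: powr_numeral)
      ultimately have 2: "(1 - (x / r)\<^sup>2) powr c = (r\<^sup>2 - x\<^sup>2) powr c / r powr (2 * c)" by simp
      have 3: "r powr (a + 2 * c + 1) = r powr a * r powr (2 * c) * r" using r by (simp add: powr_add)
      have 4: "r\<^sup>2 = r * r" by (simp add: power2_eq_square)
      show ?thesis unfolding 1 2 3 using x r by (simp add: 4 field_simps)
    qed
    then show "ennreal (?f ((x / r)\<^sup>2) * (2 * x / r\<^sup>2)) * indicator {0..r} x
      = ennreal (2 / r powr (a + 2 * c + 1)) * (ennreal (\<bar>x\<bar> powr a * (r\<^sup>2 - x\<^sup>2) powr c) * indicator {0..r} x)"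
      by (cases "x = 0") (auto simp: ennreal_mult[symmetric] split: split_indicator)
  qed
  also have "\<dots> = ennreal (2 / r powr (a + 2 * c + 1)) *
      (\<integral>\<^sup>+x. ennreal (\<bar>x\<bar> powr a * (r\<^sup>2 - x\<^sup>2) powr c) * indicator {0..r} x \<partial>lborel)"
    by (rule nn_integral_cmult) measurable
  finally have *: "ennreal (Beta ((a + 1) / 2) (c + 1)) = \<dots>" .
  have B: "Beta ((a + 1) / 2) (c + 1) \<ge> 0" using a c by (intro Beta_real_nonneg) auto
  have "ennreal (r powr (a + 2 * c + 1) * Beta ((a + 1) / 2) (c + 1))
     = ennreal (r powr (a + 2 * c + 1)) * ennreal (Beta ((a + 1) / 2) (c + 1))"
    using B by (intro ennreal_mult) auto
  also have "\<dots> = (ennreal (r powr (a + 2 * c + 1)) * ennreal (2 / r powr (a + 2 * c + 1))) *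
      (\<integral>\<^sup>+x. ennreal (\<bar>x\<bar> powr a * (r\<^sup>2 - x\<^sup>2) powr c) * indicator {0..r} x \<partial>lborel)"
    unfolding * by (simp add: mult.assoc)
  also have "ennreal (r powr (a + 2 * c + 1)) * ennreal (2 / r powr (a + 2 * c + 1)) = 2"
    using r by (simp add: ennreal_mult[symmetric])
  also have "2 * (\<integral>\<^sup>+x. ennreal (\<bar>x\<bar> powr a * (r\<^sup>2 - x\<^sup>2) powr c) * indicator {0..r} x \<partial>lborel)
    = (\<integral>\<^sup>+x. ennreal (\<bar>x\<bar> powr a * (r\<^sup>2 - x\<^sup>2) powr c) * indicator {-r..r} x \<partial>lborel)"
    \<comment> \<open>The value at 0 is 0 for every exponent a, because
      \<open>0 powr a = 0\<close>.\<close>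
    by (rule nn_integral_even_Icc[symmetric]) auto
  finally show ?thesis by simp
qed

lemma nn_integral_even_power_Icc:
  assumes "even b" "r \<ge> 0"
  shows "(\<integral>\<^sup>+x. ennreal (x ^ b) * indicator {-r..r} x \<partial>lborel) = ennreal (2 / (b + 1) * r ^ (b + 1))"
proof -
  have D: "((\<lambda>x. x ^ Suc b / real (Suc b)) has_real_derivative x ^ b) (at x)" for x
    using DERIV_cdivide[OF DERIV_pow[of "Suc b" x], of "real (Suc b)"] by simp
  have "(\<integral>\<^sup>+x. ennreal (x ^ b) * indicator {-r..r} x \<partial>lborel) = ennreal (r ^ Suc b / Suc b - (- r) ^ Suc b / Suc b)"
    using assms D
    by (intro nn_integral_FTC_Icc[where F = "\<lambda>x. x ^ Suc b / real (Suc b)"])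
      (auto simp: zero_le_even_power simp del: of_nat_Suc)
  also have "(- r) ^ Suc b = - (r ^ Suc b)" using assms by simp
  also have "x / c - (- x) / c = 2 / c * x" for x c :: real by (simp add: divide_inverse algebra_simps)
  finally show ?thesis by (simp add: add.commute)
qed

section \<open>Iterated integration over horizontal slices\<close>

lemma vec3_borel_measurable:
  "(\<lambda>(t, x, y). vector [x, y, t] :: real^3) \<in> borel_measurable (borel :: (real \<times> real \<times> real) measure)"
  by (intro borel_measurable_continuous_onI, subst continuous_on_componentwise)
    (auto simp: Basis_vec_def inner_axis forall_3 UNIV_3 case_prod_unfold intro!: continuous_intros)

text \<open>Lebesgue measure is determined by the volumes of boxes, and permuting coordinates maps
  boxes to boxes of equal volume. The vertical coordinate is placed first so that it becomes the
  outermost integration variable.\<close>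

lemma lborel_eq_distr_vec3:
  "(lborel :: (real^3) measure) = distr (lborel :: (real \<times> real \<times> real) measure) borel (\<lambda>(t, x, y). vector [x, y, t])"
proof (rule lborel_eqI)
  have B3: "Basis = {axis 1 1, axis 2 1, axis 3 (1 :: real) :: real^3}"
    by (auto simp: Basis_vec_def UNIV_3)
  have BP: "Basis = {(1, 0, 0), (0, 1, 0), (0, 0, 1) :: real \<times> real \<times> real}"
    by (auto simp: Basis_prod_def zero_prod_def)
  fix l u :: "real^3" assume le: "\<And>b. b \<in> Basis \<Longrightarrow> l \<bullet> b \<le> u \<bullet> b"
  then have le': "l $ 1 \<le> u $ 1" "l $ 2 \<le> u $ 2" "l $ 3 \<le> u $ 3" 
    using le[of "axis 1 1"] le[of "axis 2 1"] le[of "axis 3 1"] by (simp_all add: B3 inner_axis)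
  have "(\<lambda>(t, x, y). vector [x, y, t]) -` box l u = box (l $ 3, l $ 1, l $ 2) (u $ 3, u $ 1, u $ 2)"
    by (auto simp: mem_box B3 BP inner_axis)
  then have "emeasure (distr lborel borel (\<lambda>(t, x, y). vector [x, y, t])) (box l u)
     = emeasure lborel (box (l $ 3, l $ 1, l $ 2) (u $ 3, u $ 1, u $ 2))"
    using vec3_borel_measurable by (simp add: emeasure_distr)
  also have "\<dots> = (\<Prod>b\<in>Basis. ((u $ 3, u $ 1, u $ 2) - (l $ 3, l $ 1, l $ 2)) \<bullet> b)"
    using le' by (intro emeasure_lborel_box) (auto simp: BP)
  also have "\<dots> = (\<Prod>b\<in>Basis. (u - l) \<bullet> b)"
    by (simp add: BP B3 inner_axis axis_eq_axis mult_ac)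
  finally show "emeasure (distr lborel borel (\<lambda>(t, x, y). vector [x, y, t])) (box l u) = (\<Prod>b\<in>Basis. (u - l) \<bullet> b)" .
qed simp

lemma nn_integral_lborel_vec3:
  fixes F :: "real^3 \<Rightarrow> ennreal"
  assumes [measurable]: "F \<in> borel_measurable borel"
  shows "(\<integral>\<^sup>+z. F z \<partial>lborel) = (\<integral>\<^sup>+t. \<integral>\<^sup>+x. \<integral>\<^sup>+y. F (vector [x, y, t]) \<partial>lborel \<partial>lborel \<partial>lborel)"
proof -
  define G where "G = (\<lambda>w. F ((\<lambda>(t, x, y). vector [x, y, t]) w))"
  have G: "G \<in> borel_measurable borel"
    unfolding G_def using vec3_borel_measurable by measurable
  have Gt: "(\<lambda>w. G (t, w)) \<in> borel_measurable borel" for t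
    by (rule measurable_compose[OF _ G]) (intro borel_measurable_continuous_onI continuous_intros)
  have "(\<integral>\<^sup>+z. F z \<partial>lborel) = (\<integral>\<^sup>+w. G w \<partial>lborel)"
    unfolding G_def using vec3_borel_measurable
    by (subst lborel_eq_distr_vec3) (simp add: nn_integral_distr)
  also have "\<dots> = (\<integral>\<^sup>+w. G w \<partial>(lborel \<Otimes>\<^sub>M lborel))" by (simp only: lborel_prod)
  also have "\<dots> = (\<integral>\<^sup>+t. \<integral>\<^sup>+w. G (t, w) \<partial>lborel \<partial>lborel)"
    by (rule lborel.nn_integral_fst[symmetric]) (simp add: lborel_prod G)
  also have "\<dots> = (\<integral>\<^sup>+t. \<integral>\<^sup>+x. \<integral>\<^sup>+y. G (t, x, y) \<partial>lborel \<partial>lborel \<partial>lborel)"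
  proof (rule nn_integral_cong)
    fix t
    have "(\<integral>\<^sup>+w. G (t, w) \<partial>lborel) = (\<integral>\<^sup>+w. G (t, w) \<partial>(lborel \<Otimes>\<^sub>M lborel))" by (simp only: lborel_prod)
    also have "\<dots> = (\<integral>\<^sup>+x. \<integral>\<^sup>+y. G (t, x, y) \<partial>lborel \<partial>lborel)"
      by (rule lborel.nn_integral_fst[symmetric]) (simp add: lborel_prod Gt)
    finally show "(\<integral>\<^sup>+w. G (t, w) \<partial>lborel) = (\<integral>\<^sup>+x. \<integral>\<^sup>+y. G (t, x, y) \<partial>lborel \<partial>lborel)" .
  qed
  finally show ?thesis by (simp add: G_def)
qed

section \<open>The closed unit ball and its moments\<close>

definition koranyi_ball :: "(real^3) set" where
  "koranyi_ball = {z. ((z $ 1)\<^sup>2 + (z $ 2)\<^sup>2)\<^sup>2 + 16 * (z $ 3)\<^sup>2 \<le> 1}"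

lemma koranyi_ball_bounds:
  assumes "z \<in> koranyi_ball"
  shows "\<bar>z $ 1\<bar> \<le> 1" "\<bar>z $ 2\<bar> \<le> 1" "\<bar>z $ 3\<bar> \<le> 1 / 4"
proof -
  have *: "((z $ 1)\<^sup>2 + (z $ 2)\<^sup>2)\<^sup>2 + 16 * (z $ 3)\<^sup>2 \<le> 1" using assms by (simp add: koranyi_ball_def)
  have sq: "\<bar>a\<bar> \<le> 1" if "a\<^sup>2 + b \<le> 1" "0 \<le> b" for a b :: real
    using that by (intro abs_le_square_iff[THEN iffD2, of a 1, simplified]) linarith
  have s: "(z $ 1)\<^sup>2 + (z $ 2)\<^sup>2 \<le> 1" using sq[OF *] by simp
  show "\<bar>z $ 1\<bar> \<le> 1" using sq[OF s] by simp
  show "\<bar>z $ 2\<bar> \<le> 1" using sq[of "z $ 2" "(z $ 1)\<^sup>2"] s by (simp add: add.commute)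
  have "\<bar>4 * z $ 3\<bar> \<le> 1"
    using * by (intro sq[of _ "((z $ 1)\<^sup>2 + (z $ 2)\<^sup>2)\<^sup>2"]) (simp_all add: power_mult_distrib add.commute)
  then show "\<bar>z $ 3\<bar> \<le> 1 / 4" by (simp add: abs_mult)
qed

lemma closed_koranyi_ball: "closed koranyi_ball"
  unfolding koranyi_ball_def by (intro closed_Collect_le continuous_intros)

lemma koranyi_ball_borel [measurable]: "koranyi_ball \<in> sets borel"
  using closed_koranyi_ball by (rule borel_closed)

lemma compact_koranyi_ball: "compact koranyi_ball"
proof -
  have "norm z \<le> 3" if "z \<in> koranyi_ball" for z
    using koranyi_ball_bounds[OF that] norm_le_l1_cart[of z] by (simp add: sum_3)
  then have "bounded koranyi_ball" by (auto simp: bounded_iff)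
  then show ?thesis using closed_koranyi_ball compact_eq_bounded_closed by blast
qed

text \<open>For even b this is the integral of |z_1| powr a times z_2 ^ b over the unit ball. The
  factor 2 / (b + 1) comes from z_2, the first Beta value from z_1, and the last factor from z_3,
  with 1/4 the half-height of the ball.\<close>

definition koranyi_moment :: "real \<Rightarrow> nat \<Rightarrow> real" where
  "koranyi_moment a b = 2 / (b + 1) * Beta ((a + 1) / 2) ((real b + 3) / 2) * (Beta (1 / 2) ((a + b + 2) / 4 + 1) / 4)"

text \<open>The horizontal slices of the ball are discs, the one at height \<open>t\<close> having radius
  \<open>(1 - 16 t\<^sup>2) powr (1/4)\<close>; so the moments reduce to one-dimensional Beta integrals.\<close>

lemma nn_integral_koranyi_ball:
  assumes a: "a > -1" and b: "even b"
  shows "(\<integral>\<^sup>+z. ennreal (\<bar>z $ 1\<bar> powr a * (z $ 2) ^ b) * indicator koranyi_ball z \<partial>lborel) = ennreal (koranyi_moment a b)"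
proof -
  have b0: "y ^ b \<ge> 0" for y :: real using b by (simp add: zero_le_even_power)
  \<comment> \<open>A slice of radius r contributes a multiple of r powr (a + b + 2), and r^4 = 1 -
    16 t^2, hence the division by 4.\<close>
  define c where "c = (a + b + 2) / 4"
  have c: "c > 0" using a by (simp add: c_def)
  have Bnn: "Beta ((a + 1) / 2) ((real b + 3) / 2) \<ge> 0" "Beta (1 / 2) (c + 1) \<ge> 0"
    using a c by (auto intro!: Beta_real_nonneg)
  \<comment> \<open>The integral over one chord of the disc of radius r; its half-length is the
    square root of r^2 - x^2.\<close>
  have inner: "(\<integral>\<^sup>+y. ennreal (\<bar>x\<bar> powr a * y ^ b) * indicator koranyi_ball (vector [x, y, t] :: real^3) \<partial>lborel)
     = ennreal (2 / (b + 1)) * (ennreal (\<bar>x\<bar> powr a * (r\<^sup>2 - x\<^sup>2) powr ((b + 1) / 2)) * indicator {-r..r} x)"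
    if t: "r \<ge> 0" "r ^ 4 = 1 - 16 * t\<^sup>2" for x t r
  proof -
    have iff: "(vector [x, y, t] :: real^3) \<in> koranyi_ball \<longleftrightarrow> x\<^sup>2 + y\<^sup>2 \<le> r\<^sup>2" for y
    proof -
      have "(vector [x, y, t] :: real^3) \<in> koranyi_ball \<longleftrightarrow> (x\<^sup>2 + y\<^sup>2)\<^sup>2 \<le> (r\<^sup>2)\<^sup>2"
        using t by (simp add: koranyi_ball_def power_mult[symmetric]) argo
      also have "\<dots> \<longleftrightarrow> x\<^sup>2 + y\<^sup>2 \<le> r\<^sup>2"
        by (meson power2_le_imp_le power_mono sum_power2_ge_zero zero_le_power2)
      finally show ?thesis .
    qed
    show ?thesis
    proof (cases "x \<in> {-r..r}")
      case True
      then have "\<bar>x\<bar> \<le> r" by auto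
      then have xr: "x\<^sup>2 \<le> r\<^sup>2" using power_mono[of "\<bar>x\<bar>" r 2] by simp
      define s where "s = sqrt (r\<^sup>2 - x\<^sup>2)"
      have s: "s \<ge> 0" "s\<^sup>2 = r\<^sup>2 - x\<^sup>2" using xr by (auto simp: s_def)
      have "x\<^sup>2 + y\<^sup>2 \<le> r\<^sup>2 \<longleftrightarrow> y \<in> {-s..s}" for y
      proof -
        have "x\<^sup>2 + y\<^sup>2 \<le> r\<^sup>2 \<longleftrightarrow> y\<^sup>2 \<le> s\<^sup>2" using s by auto
        also have "\<dots> \<longleftrightarrow> \<bar>y\<bar> \<le> s" using s(1) abs_le_square_iff[of y s] by (simp only: abs_of_nonneg)
        finally show ?thesis by auto
      qed
      then have "(\<integral>\<^sup>+y. ennreal (\<bar>x\<bar> powr a * y ^ b) * indicator koranyi_ball (vector [x, y, t] :: real^3) \<partial>lborel)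
        = (\<integral>\<^sup>+y. ennreal (\<bar>x\<bar> powr a) * (ennreal (y ^ b) * indicator {-s..s} y) \<partial>lborel)"
        using iff b0 by (intro nn_integral_cong) (auto simp: ennreal_mult split: split_indicator)
      also have "\<dots> = ennreal (\<bar>x\<bar> powr a) * ennreal (2 / (b + 1) * s ^ (b + 1))"
        using nn_integral_even_power_Icc[OF b s(1)] by (subst nn_integral_cmult) (simp_all add: add.commute)
      also have "s ^ (b + 1) = (r\<^sup>2 - x\<^sup>2) powr ((b + 1) / 2)"
      proof (cases "s = 0")
        case False
        then have "s ^ (b + 1) = s powr real (b + 1)" using s by (subst powr_realpow) auto
        also have "real (b + 1) = 2 * ((b + 1) / 2)" by simp
        also have "s powr (2 * ((b + 1) / 2)) = (s powr 2) powr ((b + 1) / 2)" by (rule powr_powr[symmetric])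
        also have "s powr 2 = s\<^sup>2" using s False by (simp add: powr_numeral)
        finally show ?thesis by (simp add: s(2))
      qed (use s in auto)
      finally show ?thesis using True by (simp add: ennreal_mult[symmetric] mult_ac)
    next
      case False
      then have "r < \<bar>x\<bar>" by auto
      then have "r\<^sup>2 < x\<^sup>2" using t(1) abs_square_less_1 power_strict_mono[of r "\<bar>x\<bar>" 2] by simp
      then have "\<not> x\<^sup>2 + y\<^sup>2 \<le> r\<^sup>2" for y using zero_le_power2[of y] by linarith
      then show ?thesis using False iff by simp
    qed
  qed
  \<comment> \<open>The factor \<open>\<bar>t\<bar> powr 0\<close> brings the slice integral into
    the form of \<open>nn_integral_powr_Beta\<close>, and 16 powr c comes from 1 - 16 t^2 = 16
    ((1/4)^2 - t^2).\<close>
  have middle: "(\<integral>\<^sup>+x. \<integral>\<^sup>+y. ennreal (\<bar>x\<bar> powr a * y ^ b) * indicator koranyi_ball (vector [x, y, t] :: real^3) \<partial>lborel \<partial>lborel)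
     = ennreal (2 / (b + 1) * Beta ((a + 1) / 2) ((real b + 3) / 2) * 16 powr c) *
       (ennreal (\<bar>t\<bar> powr 0 * ((1/4)\<^sup>2 - t\<^sup>2) powr c) * indicator {-(1/4)..1/4} t)" if "t \<noteq> 0" "\<bar>t\<bar> \<noteq> 1 / 4" for t
  proof (cases "\<bar>t\<bar> < 1 / 4")
    case True
    then have "t \<in> {-(1/4)..1/4}" by auto
    have t2: "t\<^sup>2 < (1/4)\<^sup>2" using True power_strict_mono[of "\<bar>t\<bar>" "1/4" 2] by simp
    then have pos: "1 - 16 * t\<^sup>2 > 0" by (simp add: power2_eq_square)
    define r where "r = (1 - 16 * t\<^sup>2) powr (1 / 4)"
    have r: "r > 0" using pos by (simp add: r_def)
    have r4: "r ^ 4 = 1 - 16 * t\<^sup>2"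
      using pos r powr_realpow[of r 4] by (simp add: r_def powr_powr)
    have "(\<integral>\<^sup>+x. \<integral>\<^sup>+y. ennreal (\<bar>x\<bar> powr a * y ^ b) * indicator koranyi_ball (vector [x, y, t] :: real^3) \<partial>lborel \<partial>lborel)
      = ennreal (2 / (b + 1)) * (\<integral>\<^sup>+x. ennreal (\<bar>x\<bar> powr a * (r\<^sup>2 - x\<^sup>2) powr ((b + 1) / 2)) * indicator {-r..r} x \<partial>lborel)"
      by (subst inner[OF less_imp_le[OF r] r4], rule nn_integral_cmult) measurable
    also have "\<dots> = ennreal (2 / (b + 1)) * ennreal (r powr (a + 2 * ((b + 1) / 2) + 1) * Beta ((a + 1) / 2) ((b + 1) / 2 + 1))"
      using a r by (subst nn_integral_powr_Beta) auto
    also have "r powr (a + 2 * ((b + 1) / 2) + 1) = (1 - 16 * t\<^sup>2) powr c"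
    proof -
      have "1 / 4 * (a + 2 * ((b + 1) / 2) + 1) = c" by (simp add: c_def field_simps)
      then show ?thesis unfolding r_def powr_powr by simp
    qed
    also have "\<dots> = 16 powr c * ((1/4)\<^sup>2 - t\<^sup>2) powr c"
    proof -
      have "1 - 16 * t\<^sup>2 = 16 * ((1/4)\<^sup>2 - t\<^sup>2)" by (simp add: power2_eq_square)
      then show ?thesis using t2 by (simp only: powr_mult)
    qed
    also have "(b + 1) / 2 + 1 = (real b + 3) / 2" by simp
    finally show ?thesis
      using that Bnn \<open>t \<in> {-(1/4)..1/4}\<close> by (simp add: ennreal_mult[symmetric] mult_ac)
  next
    case False
    then have t4: "\<bar>t\<bar> > 1 / 4" using that by simp
    then have "(1/4)\<^sup>2 < t\<^sup>2" using power_strict_mono[of "1/4" "\<bar>t\<bar>" 2] by simp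
    then have "1 < 16 * t\<^sup>2" by (simp add: power2_eq_square)
    then have "(vector [x, y, t] :: real^3) \<notin> koranyi_ball" for x y
      using add_strict_increasing2[OF zero_le_power2[of "x\<^sup>2 + y\<^sup>2"], of 1 "16 * t\<^sup>2"]
      by (simp add: koranyi_ball_def not_le)
    then show ?thesis using t4 by (auto split: split_indicator)
  qed
  have "(\<integral>\<^sup>+z. ennreal (\<bar>z $ 1\<bar> powr a * (z $ 2) ^ b) * indicator koranyi_ball z \<partial>lborel)
    = (\<integral>\<^sup>+t. \<integral>\<^sup>+x. \<integral>\<^sup>+y. ennreal (\<bar>x\<bar> powr a * y ^ b) * indicator koranyi_ball (vector [x, y, t] :: real^3) \<partial>lborel \<partial>lborel \<partial>lborel)"
    by (subst nn_integral_lborel_vec3) (simp_all)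
  also have "\<dots> = (\<integral>\<^sup>+t. ennreal (2 / (b + 1) * Beta ((a + 1) / 2) ((real b + 3) / 2) * 16 powr c) *
       (ennreal (\<bar>t\<bar> powr 0 * ((1/4)\<^sup>2 - t\<^sup>2) powr c) * indicator {-(1/4)..1/4} t) \<partial>lborel)"
  proof (rule nn_integral_cong_AE)
    \<comment> \<open>At 0 the artificial factor is \<open>0 powr 0 = 0\<close> instead of 1, and at
      heights 1/4 and -1/4 the slice radius degenerates to 0.\<close>
    have "{0, 1/4, -1/4 :: real} \<in> null_sets lborel" by (intro finite_imp_null_set_lborel) auto
    from AE_not_in[OF this] show "AE t in lborel. (\<integral>\<^sup>+x. \<integral>\<^sup>+y. ennreal (\<bar>x\<bar> powr a * y ^ b) * indicator koranyi_ball (vector [x, y, t] :: real^3) \<partial>lborel \<partial>lborel)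
     = ennreal (2 / (b + 1) * Beta ((a + 1) / 2) ((real b + 3) / 2) * 16 powr c) *
       (ennreal (\<bar>t\<bar> powr 0 * ((1/4)\<^sup>2 - t\<^sup>2) powr c) * indicator {-(1/4)..1/4} t)"
    proof (rule AE_mp, intro AE_I2 impI)
      fix t :: real assume "t \<notin> {0, 1/4, -1/4}"
      then have "t \<noteq> 0" "\<bar>t\<bar> \<noteq> 1/4" by (auto simp: abs_if split: if_splits)
      then show "(\<integral>\<^sup>+x. \<integral>\<^sup>+y. ennreal (\<bar>x\<bar> powr a * y ^ b) * indicator koranyi_ball (vector [x, y, t] :: real^3) \<partial>lborel \<partial>lborel)
     = ennreal (2 / (b + 1) * Beta ((a + 1) / 2) ((real b + 3) / 2) * 16 powr c) *
       (ennreal (\<bar>t\<bar> powr 0 * ((1/4)\<^sup>2 - t\<^sup>2) powr c) * indicator {-(1/4)..1/4} t)" by (rule middle)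
    qed
  qed
  also have "\<dots> = ennreal (2 / (b + 1) * Beta ((a + 1) / 2) ((real b + 3) / 2) * 16 powr c) *
      ennreal ((1/4) powr (0 + 2 * c + 1) * Beta ((0 + 1) / 2) (c + 1))"
    using c by (subst nn_integral_cmult, measurable) (subst nn_integral_powr_Beta, auto)
  also have "(1/4 :: real) powr (0 + 2 * c + 1) = 1 / (4 * 16 powr c)"
  proof -
    have "(1/4 :: real) powr (2 * c) = ((1/4) powr 2) powr c" by (simp only: powr_powr)
    also have "\<dots> = 1 / 16 powr c" by (simp add: powr_divide power2_eq_square)
    finally show ?thesis by (simp add: powr_add)
  qed
  also have "ennreal (2 / (b + 1) * Beta ((a + 1) / 2) ((real b + 3) / 2) * 16 powr c) *
      ennreal (1 / (4 * 16 powr c) * Beta ((0 + 1) / 2) (c + 1)) = ennreal (koranyi_moment a b)"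
    using Bnn by (simp add: ennreal_mult[symmetric] koranyi_moment_def c_def add.commute mult_ac)
  finally show ?thesis .
qed

abbreviation koranyi_measure :: "(real^3) measure" where
  "koranyi_measure \<equiv> restrict_space lborel koranyi_ball"

lemma space_koranyi_measure: "space koranyi_measure = koranyi_ball"
  by (simp add: space_restrict_space)

lemma finite_measure_koranyi: "finite_measure koranyi_measure"
proof
  have "emeasure lborel koranyi_ball < \<infinity>"
    using compact_koranyi_ball emeasure_compact_finite by (simp add: emeasure_lborel_cbox_finite less_top emeasure_bounded_finite compact_imp_bounded)
  then show "emeasure koranyi_measure (space koranyi_measure) \<noteq> \<infinity>"
    by (simp add: space_koranyi_measure emeasure_restrict_space)
qed

lemma koranyi_moment_pos:
  assumes "a > -1"
  shows "koranyi_moment a b > 0"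
proof -
  have B: "Beta x y > 0" if "x > 0" "y > 0" for x y :: real
    using that by (simp add: Beta_def Gamma_real_pos)
  have "(a + real b + 2) / 4 + 1 > 0"
    using assms of_nat_0_le_iff[of b, where 'a = real] by (intro add_pos_nonneg add_nonneg_pos divide_nonneg_pos) linarith+
  then show ?thesis unfolding koranyi_moment_def using assms
    by (intro mult_pos_pos divide_pos_pos B) auto
qed

lemma has_bochner_integral_koranyi:
  assumes "a > -1" "even b"
  shows "has_bochner_integral koranyi_measure (\<lambda>z. \<bar>z $ 1\<bar> powr a * (z $ 2) ^ b) (koranyi_moment a b)"
proof (rule has_bochner_integral_nn_integral)
  show "(\<lambda>z. \<bar>z $ 1\<bar> powr a * (z $ 2) ^ b) \<in> borel_measurable koranyi_measure"
    by (intro measurable_restrict_space1) measurable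
  show "(\<integral>\<^sup>+z. ennreal (\<bar>z $ 1\<bar> powr a * (z $ 2) ^ b) \<partial>koranyi_measure) = ennreal (koranyi_moment a b)"
    using nn_integral_koranyi_ball[OF assms] by (simp add: nn_integral_restrict_space)
qed (use assms koranyi_moment_pos less_imp_le in \<open>auto simp: zero_le_even_power\<close>)

lemma Gamma_real_rec: "x > 0 \<Longrightarrow> Gamma (x + 1) = x * Gamma (x :: real)"
  by (rule Gamma_plus1) (auto elim!: nonpos_Ints_cases')

text \<open>The origin of the weight p - 1 on the second derivative along the gradient. Both moments
  have the same sum of exponents, hence the same vertical factor, and the horizontal factors differ
  by steps of the Gamma recursion.\<close>

lemma koranyi_moment_p_0:
  assumes "p \<ge> 2"
  shows "koranyi_moment p 0 = (p - 1) * koranyi_moment (p - 2) 2"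
proof -
  have 1: "Gamma ((p + 1) / 2) = (p - 1) / 2 * Gamma ((p - 1) / 2)"
    using Gamma_real_rec[of "(p - 1) / 2"] assms by (simp add: field_simps)
  have 2: "Gamma (5 / 2 :: real) = 3 / 2 * Gamma (3 / 2)"
    using Gamma_real_rec[of "3 / 2"] by simp
  have 3: "(p + 1) / 2 + 3 / 2 = p / 2 + 2" "(p - 1) / 2 + 5 / 2 = p / 2 + 2" by (simp_all add: field_simps)
  have "Beta ((p + 1) / 2) (3 / 2) = (p - 1) / 3 * Beta ((p - 1) / 2) (5 / 2)"
    unfolding Beta_def 1 2 3 by simp
  then show ?thesis by (simp add: koranyi_moment_def)
qed

text \<open>The origin of \<open>c_const\<close>. The horizontal factors contribute 1 / (p + 2), the
  vertical ones 4 / (p + 4) times the squared Gamma quotient. The 2 in front of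
  \<open>c_const\<close> is compensated by the 1/2 of the Taylor polynomial.\<close>

lemma koranyi_moment_ratio:
  assumes "p \<ge> 2"
  shows "koranyi_moment (p - 2) 2 = 2 * c_const p * koranyi_moment (p - 2) 0"
proof -
  define A where "A = Beta ((p - 1) / 2) (3 / 2)"
  define G1 where "G1 = Gamma (p / 4 + 1)"
  define G2 where "G2 = Gamma (p / 4 + 3 / 2)"
  have pos: "G1 > 0" "G2 > 0" using assms by (auto simp: G1_def G2_def intro!: Gamma_real_pos)
  have e: "1 / 2 + ((p + 2) / 4 + 1) = (p / 4 + 1) + 1" "(p + 2) / 4 + 1 = p / 4 + 3 / 2"
    "1 / 2 + (p / 4 + 1) = p / 4 + 3 / 2"
    "(p - 1) / 2 + 5 / 2 = (p / 2 + 1) + 1" "(p - 1) / 2 + 3 / 2 = p / 2 + 1" by (simp_all add: field_simps)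
  have g1: "Gamma ((p / 4 + 1) + 1) = (p / 4 + 1) * G1"
    using Gamma_real_rec[of "p / 4 + 1"] assms unfolding G1_def by simp
  have g2: "Gamma (5 / 2 :: real) = 3 / 2 * Gamma (3 / 2)"
    using Gamma_real_rec[of "3 / 2"] by simp
  have g3: "Gamma ((p / 2 + 1) + 1) = (p / 2 + 1) * Gamma (p / 2 + 1)"
    using Gamma_real_rec[of "p / 2 + 1"] assms by simp
  have "x * (3 / 2 * y) / ((p / 2 + 1) * z) = 3 / (p + 2) * (x * y / z)" for x y z
    using assms by (cases "z = 0") (auto simp: field_simps)
  then have B: "Beta ((p - 1) / 2) (5 / 2) = 3 / (p + 2) * A"
    unfolding A_def Beta_def e g2 g3 by blast
  have C: "Beta (1 / 2) ((p + 2) / 4 + 1) = Gamma (1 / 2) * G2 / ((p / 4 + 1) * G1)"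
    unfolding Beta_def e(1) g1 unfolding e(2) G2_def ..
  have D: "Beta (1 / 2) (p / 4 + 1) = Gamma (1 / 2) * G1 / G2"
    unfolding Beta_def e(3) G1_def G2_def ..
  have m2: "koranyi_moment (p - 2) 2 = 2 / 3 * (3 / (p + 2) * A) * (Gamma (1 / 2) * G2 / ((p / 4 + 1) * G1) / 4)"
    using B C by (simp add: koranyi_moment_def)
  have m0: "koranyi_moment (p - 2) 0 = 2 * A * (Gamma (1 / 2) * G1 / G2 / 4)"
    using D by (simp add: koranyi_moment_def A_def)
  have c: "c_const p = 2 / ((p + 2) * (p + 4)) * (G2 / G1)\<^sup>2"
    by (simp add: c_const_def G1_def G2_def)
  have 4: "p / 4 + 1 = (p + 4) / 4" by simp
  have gen: "2 / 3 * (3 / r * A) * (g * G2 / (q / 4 * G1) / 4)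
     = 2 * (2 / (r * q) * (G2 / G1)\<^sup>2) * (2 * A * (g * G1 / G2 / 4))" if "q > 0" "r > 0" for q r g
    using that pos by (simp add: field_simps power2_eq_square)
  show ?thesis unfolding m2 m0 c 4 using assms by (intro gen) auto
qed

text \<open>Reflecting one coordinate preserves both Lebesgue measure and the ball, so the integral
  equals its own negative. The reflection is written as a diagonal map with entries
  \<open>c b\<close> to match the affine transformation rule for \<open>lborel\<close>.\<close>

lemma integral_koranyi_odd:
  assumes [measurable]: "F \<in> borel_measurable borel"
    and odd: "\<And>z. F (\<chi> j. if j = i then - z $ j else z $ j) = - F z"
  shows "(\<integral>z. F z \<partial>koranyi_measure) = (0::real)"
proof -
  let ?T = "\<lambda>z::real^3. \<chi> j. if j = i then - z $ j else z $ j"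
  define c where "c b = (if b = axis i 1 then -1 else 1 :: real)" for b :: "real^3"
  have T: "?T = (\<lambda>z. 0 + (\<Sum>b\<in>Basis. (c b * (z \<bullet> b)) *\<^sub>R b))"
  proof
    fix z show "?T z = 0 + (\<Sum>b\<in>Basis. (c b * (z \<bullet> b)) *\<^sub>R b)"
    proof (rule euclidean_eqI)
      fix b :: "real^3" assume b: "b \<in> Basis"
      then obtain k where k: "b = axis k 1" by (auto simp: Basis_vec_def)
      then have "?T z \<bullet> b = c b * (z \<bullet> b)" by (simp add: inner_axis c_def axis_eq_axis)
      also have "\<dots> = (\<Sum>b\<in>Basis. (c b * (z \<bullet> b)) *\<^sub>R b) \<bullet> b" using b by (simp add: inner_sum_left_Basis)
      finally show "?T z \<bullet> b = (0 + (\<Sum>b\<in>Basis. (c b * (z \<bullet> b)) *\<^sub>R b)) \<bullet> b" by simp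
    qed
  qed
  have cabs: "(\<Prod>b\<in>(Basis::(real^3) set). \<bar>c b\<bar>) = 1"
    by (rule prod.neutral) (auto simp: c_def)
  have "(lborel :: (real^3) measure) = density (distr lborel borel (\<lambda>z. 0 + (\<Sum>b\<in>Basis. (c b * (z \<bullet> b)) *\<^sub>R b)))
     (\<lambda>_. (\<Prod>b\<in>Basis. \<bar>c b\<bar>))"
    by (rule lborel_affine_euclidean) (auto simp: c_def)
  then have L: "(lborel :: (real^3) measure) = distr lborel borel ?T"
    unfolding T[symmetric] cabs by (simp add: density_1)
  have Tm [measurable]: "?T \<in> borel_measurable borel" by (subst T) measurable
  have ball: "?T z \<in> koranyi_ball \<longleftrightarrow> z \<in> koranyi_ball" for z
    by (simp add: koranyi_ball_def)
  have "(\<integral>z. F z \<partial>koranyi_measure) = (\<integral>z. indicator koranyi_ball z *\<^sub>R F z \<partial>lborel)"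
    by (simp add: integral_restrict_space)
  also have "\<dots> = (\<integral>z. indicator koranyi_ball (?T z) *\<^sub>R F (?T z) \<partial>lborel)"
    by (subst L, subst integral_distr) auto
  also have "\<dots> = (\<integral>z. - (indicator koranyi_ball z *\<^sub>R F z) \<partial>lborel)"
    using ball odd by (intro Bochner_Integration.integral_cong) (auto split: split_indicator)
  also have "\<dots> = - (\<integral>z. F z \<partial>koranyi_measure)"
    by (simp add: integral_restrict_space)
  finally show ?thesis by simp
qed

lemma AE_koranyi_nonzero: "AE z in koranyi_measure. z $ 1 \<noteq> 0"
proof -
  have "negligible {z :: real^3. axis 1 1 \<bullet> z = 0}"
    by (rule negligible_hyperplane) (simp add: axis_eq_0_iff)
  then have "{z :: real^3. z $ 1 = 0} \<in> null_sets lebesgue"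
    by (simp add: negligible_iff_null_sets inner_axis')
  then have "{z :: real^3. z $ 1 = 0} \<in> null_sets lborel"
    using null_sets_completion_iff[of "{z :: real^3. z $ 1 = 0}" lborel] by simp
  from AE_not_in[OF this] show ?thesis by (subst AE_restrict_space_iff) auto
qed

lemma integral_koranyi_spow: "(\<integral>z. spow q (z $ 1) \<partial>koranyi_measure) = 0"
  by (rule integral_koranyi_odd[of _ 1]) (auto simp: spow_minus)

lemma integrable_koranyi_bounded:
  assumes "F \<in> borel_measurable borel" "\<And>z. z \<in> koranyi_ball \<Longrightarrow> \<bar>F z\<bar> \<le> (K::real)"
  shows "integrable koranyi_measure F"
  by (rule finite_measure.integrable_const_bound[OF finite_measure_koranyi, of _ K])
    (use assms in \<open>auto simp: space_koranyi_measure intro!: AE_I2 measurable_restrict_space1\<close>)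

text \<open>The mixed term is odd in z_1 and the E-term is odd in z_3, so both integrate to zero.
  The squares are evaluated by the two moment identities, which turn A/2 and C/2 into multiples of
  (p - 1) A and C.\<close>

lemma integral_koranyi_quadratic:
  assumes p: "p \<ge> 2"
  shows "(\<integral>z. \<bar>z $ 1\<bar> powr (p - 2) * (1/2 * (A * (z $ 1)\<^sup>2 + B * (z $ 1 * z $ 2) + C * (z $ 2)\<^sup>2) + E * z $ 3) \<partial>koranyi_measure)
   = c_const p * ((p - 1) * A + C) * (\<integral>z. \<bar>z $ 1\<bar> powr (p - 2) \<partial>koranyi_measure)"
proof -
  have h1: "has_bochner_integral koranyi_measure (\<lambda>z. \<bar>z $ 1\<bar> powr (p - 2) * (z $ 1)\<^sup>2) (koranyi_moment p 0)"
  proof -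
    have "\<bar>x\<bar> powr (p - 2) * x\<^sup>2 = \<bar>x\<bar> powr p" for x :: real
      by (cases "x = 0") (simp_all add: powr_diff powr_numeral)
    then show ?thesis using has_bochner_integral_koranyi[of p 0] p by simp
  qed
  have h2: "has_bochner_integral koranyi_measure (\<lambda>z. \<bar>z $ 1\<bar> powr (p - 2) * (z $ 2)\<^sup>2) (koranyi_moment (p - 2) 2)"
    using has_bochner_integral_koranyi[of "p - 2" 2] p by simp
  have h0: "has_bochner_integral koranyi_measure (\<lambda>z. \<bar>z $ 1\<bar> powr (p - 2)) (koranyi_moment (p - 2) 0)"
    using has_bochner_integral_koranyi[of "p - 2" 0] p by simp
  have bd: "\<bar>\<bar>z $ 1\<bar> powr (p - 2) * (a * b)\<bar> \<le> 1" if "z \<in> koranyi_ball" "\<bar>a\<bar> \<le> 1" "\<bar>b\<bar> \<le> 1" for z :: "real^3" and a b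
  proof -
    have "\<bar>z $ 1\<bar> powr (p - 2) \<le> 1" using koranyi_ball_bounds[OF that(1)] p by (intro powr_le1) auto
    then show ?thesis unfolding abs_mult using that
      by (intro mult_le_one mult_nonneg_nonneg) auto
  qed
  have h12: "has_bochner_integral koranyi_measure (\<lambda>z. \<bar>z $ 1\<bar> powr (p - 2) * (z $ 1 * z $ 2)) 0"
    unfolding has_bochner_integral_iff
    by (intro conjI integrable_koranyi_bounded[of _ 1] integral_koranyi_odd[of _ 1] bd)
      (auto dest: koranyi_ball_bounds)
  have h3: "has_bochner_integral koranyi_measure (\<lambda>z. \<bar>z $ 1\<bar> powr (p - 2) * (1 * z $ 3)) 0"
    unfolding has_bochner_integral_iff
    by (intro conjI integrable_koranyi_bounded[of _ 1] integral_koranyi_odd[of _ 3] bd)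
      (auto dest: koranyi_ball_bounds(3))
  have "has_bochner_integral koranyi_measure (\<lambda>z. (A / 2) * (\<bar>z $ 1\<bar> powr (p - 2) * (z $ 1)\<^sup>2)
       + (B / 2) * (\<bar>z $ 1\<bar> powr (p - 2) * (z $ 1 * z $ 2)) + (C / 2) * (\<bar>z $ 1\<bar> powr (p - 2) * (z $ 2)\<^sup>2)
       + E * (\<bar>z $ 1\<bar> powr (p - 2) * (1 * z $ 3)))
     ((A / 2) * koranyi_moment p 0 + (B / 2) * 0 + (C / 2) * koranyi_moment (p - 2) 2 + E * 0)"
    by (intro has_bochner_integral_add has_bochner_integral_mult_right h1 h2 h3 h12)
  moreover have "(\<lambda>z. (A / 2) * (\<bar>z $ 1\<bar> powr (p - 2) * (z $ 1)\<^sup>2)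
       + (B / 2) * (\<bar>z $ 1\<bar> powr (p - 2) * (z $ 1 * z $ 2)) + (C / 2) * (\<bar>z $ 1\<bar> powr (p - 2) * (z $ 2)\<^sup>2)
       + E * (\<bar>z $ 1\<bar> powr (p - 2) * (1 * z $ 3)))
    = (\<lambda>z. \<bar>z $ 1\<bar> powr (p - 2) * (1/2 * (A * (z $ 1)\<^sup>2 + B * (z $ 1 * z $ 2) + C * (z $ 2)\<^sup>2) + E * z $ 3))"
    by (auto simp: algebra_simps)
  ultimately show ?thesis
    using h0 koranyi_moment_p_0[OF p] koranyi_moment_ratio[OF p]
    by (simp add: has_bochner_integral_iff algebra_simps)
qed

section \<open>Heisenberg balls and extended domains\<close>

text \<open>The fourth power of the gauge: a polynomial, so that most arguments need no
  roots.\<close>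

definition koranyi_quartic :: "real^3 \<Rightarrow> real" where
  "koranyi_quartic z = ((z $ 1)\<^sup>2 + (z $ 2)\<^sup>2)\<^sup>2 + 16 * (z $ 3)\<^sup>2"

lemma koranyi_quartic_nonneg: "koranyi_quartic z \<ge> 0"
  by (simp add: koranyi_quartic_def)

lemma koranyi_ball_iff: "z \<in> koranyi_ball \<longleftrightarrow> koranyi_quartic z \<le> 1"
  by (simp add: koranyi_ball_def koranyi_quartic_def)

lemma koranyi_gauge_eq: "koranyi_gauge z = root 4 (koranyi_quartic z)"
  by (simp add: koranyi_gauge_def koranyi_quartic_def)

lemma koranyi_gauge_less_iff: "r > 0 \<Longrightarrow> koranyi_gauge z < r \<longleftrightarrow> koranyi_quartic z < r ^ 4"
  using real_root_less_iff[of 4 "koranyi_quartic z" "r ^ 4"]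
  by (simp add: koranyi_gauge_eq real_root_power_cancel)

lemma koranyi_gauge_le_1_iff: "koranyi_gauge z \<le> 1 \<longleftrightarrow> z \<in> koranyi_ball"
  by (simp add: koranyi_gauge_eq koranyi_ball_iff)

lemma koranyi_gauge_nonneg: "koranyi_gauge z \<ge> 0"
  by (simp add: koranyi_gauge_eq koranyi_quartic_nonneg)

lemma koranyi_quartic_minus: "koranyi_quartic (- z) = koranyi_quartic z"
  by (simp add: koranyi_quartic_def)

lemma koranyi_quartic_dil: "koranyi_quartic (heis_dil s z) = s ^ 4 * koranyi_quartic z"
  by (simp add: koranyi_quartic_def power2_eq_square power4_eq_xxxx algebra_simps)

lemma heis_inv_nth [simp]: "heis_inv x $ i = - (x $ i)"
  by (simp add: heis_inv_def)

lemma heis_mult_inv_cancel: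
  "heis_mult (heis_inv x) (heis_mult x w) = w" "heis_mult x (heis_mult (heis_inv x) w) = w"
  by (simp_all add: vec_eq_iff forall_3 algebra_simps)

lemma heis_inv_mult_swap: "heis_mult (heis_inv x) y = - heis_mult (heis_inv y) x"
  by (simp add: vec_eq_iff forall_3 algebra_simps)

lemma heis_dist_commute: "heis_dist x y = heis_dist y x"
  unfolding heis_dist_def by (subst heis_inv_mult_swap) (simp add: koranyi_gauge_eq koranyi_quartic_minus)

lemma heis_dist_mult: "heis_dist x (heis_mult x z) = koranyi_gauge z"
  by (simp add: heis_dist_def heis_mult_inv_cancel)

lemma continuous_on_heis_mult:
  fixes f g :: "'a::t2_space \<Rightarrow> real^3"
  assumes "continuous_on A f" "continuous_on A g"
  shows "continuous_on A (\<lambda>x. heis_mult (f x) (g x))"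
  by (subst continuous_on_componentwise)
    (use assms in \<open>auto simp: Basis_vec_def inner_axis UNIV_3 intro!: continuous_intros\<close>)

lemma continuous_on_koranyi_quartic:
  assumes "continuous_on A f"
  shows "continuous_on A (\<lambda>x. koranyi_quartic (f x))"
  unfolding koranyi_quartic_def using assms by (intro continuous_intros)

lemma continuous_on_heis_dist: "continuous_on A (\<lambda>y. heis_dist x y)"
  unfolding heis_dist_def koranyi_gauge_eq
  by (intro continuous_on_real_root continuous_on_koranyi_quartic continuous_on_heis_mult continuous_intros)

text \<open>Euclidean scaling rather than dilation: both summands shrink at least by the factor s^2.
  It serves to approximate points of a closed gauge ball from the open one.\<close>

lemma koranyi_quartic_scaleR_less:
  assumes "0 \<le> s" "s < 1" "koranyi_quartic w \<le> b" "b > 0"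
  shows "koranyi_quartic (s *\<^sub>R w) < b"
proof -
  have "koranyi_quartic (s *\<^sub>R w) = s ^ 4 * ((w $ 1)\<^sup>2 + (w $ 2)\<^sup>2)\<^sup>2 + s\<^sup>2 * (16 * (w $ 3)\<^sup>2)"
    by (simp add: koranyi_quartic_def power2_eq_square power4_eq_xxxx algebra_simps)
  also have "\<dots> \<le> s\<^sup>2 * ((w $ 1)\<^sup>2 + (w $ 2)\<^sup>2)\<^sup>2 + s\<^sup>2 * (16 * (w $ 3)\<^sup>2)"
    using assms by (intro add_right_mono mult_right_mono power_decreasing) auto
  also have "\<dots> = s\<^sup>2 * koranyi_quartic w" by (simp add: koranyi_quartic_def algebra_simps)
  also have "\<dots> \<le> s\<^sup>2 * b" using assms by (intro mult_left_mono) auto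
  also have "\<dots> < b" using assms by (simp add: power_less_one_iff)
  finally show ?thesis .
qed

text \<open>\<open>p_mean\<close> uses the topological closure, whereas the integrals use a
  polynomial inequality. A boundary point is the limit of points obtained by shrinking its
  coordinate w relative to the centre.\<close>

lemma closure_heis_ball:
  assumes "r > 0"
  shows "closure (heis_ball x r) = {y. koranyi_quartic (heis_mult (heis_inv x) y) \<le> r ^ 4}" (is "_ = ?B")
proof
  have b: "heis_ball x r = {y. koranyi_quartic (heis_mult (heis_inv x) y) < r ^ 4}"
    using assms by (auto simp: heis_ball_def heis_dist_def koranyi_gauge_less_iff)
  have "closed ?B"
    by (intro closed_Collect_le continuous_on_koranyi_quartic continuous_on_heis_mult continuous_intros)
  then show "closure (heis_ball x r) \<subseteq> ?B"
    by (intro closure_minimal) (auto simp: b)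
  show "?B \<subseteq> closure (heis_ball x r)"
  proof
    fix y assume y: "y \<in> ?B"
    define w where "w = heis_mult (heis_inv x) y"
    have "(\<lambda>n. heis_mult x ((1 - inverse (real (Suc n))) *\<^sub>R w)) \<longlonglongrightarrow> heis_mult x ((1 - 0) *\<^sub>R w)"
    proof (rule continuous_on_tendsto_compose[of UNIV "heis_mult x"])
      show "continuous_on UNIV (heis_mult x)"
        by (rule continuous_on_heis_mult[of UNIV "\<lambda>_. x" "\<lambda>y. y"]) (intro continuous_intros)+
      show "(\<lambda>n. (1 - inverse (real (Suc n))) *\<^sub>R w) \<longlonglongrightarrow> (1 - 0) *\<^sub>R w"
        by (intro tendsto_intros LIMSEQ_inverse_real_of_nat)
    qed auto
    moreover have "heis_mult x ((1 - inverse (real (Suc n))) *\<^sub>R w) \<in> heis_ball x r" for n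
    proof -
      have "koranyi_quartic ((1 - inverse (real (Suc n))) *\<^sub>R w) < r ^ 4"
        using y assms by (intro koranyi_quartic_scaleR_less) (auto simp: w_def inverse_le_1_iff)
      then show ?thesis by (simp add: b heis_mult_inv_cancel)
    qed
    moreover have "heis_mult x ((1 - 0) *\<^sub>R w) = y" by (simp add: w_def heis_mult_inv_cancel)
    ultimately show "y \<in> closure (heis_ball x r)"
      unfolding closure_sequential by (intro exI conjI allI) auto
  qed
qed

section \<open>Charts of balls and change of variables\<close>

definition heis_rot :: "real^2 \<Rightarrow> real^3 \<Rightarrow> real^3" where
  "heis_rot e z = vector [e $ 1 * z $ 1 - e $ 2 * z $ 2, e $ 2 * z $ 1 + e $ 1 * z $ 2, z $ 3]"

lemma heis_rot_nth [simp]: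
  "heis_rot e z $ 1 = e $ 1 * z $ 1 - e $ 2 * z $ 2" "heis_rot e z $ 2 = e $ 2 * z $ 1 + e $ 1 * z $ 2"
  "heis_rot e z $ 3 = z $ 3"
  by (simp_all add: heis_rot_def)

lemma koranyi_quartic_rot:
  assumes "(e $ 1)\<^sup>2 + (e $ 2)\<^sup>2 = 1"
  shows "koranyi_quartic (heis_rot e z) = koranyi_quartic z"
proof -
  have "(e $ 1 * z $ 1 - e $ 2 * z $ 2)\<^sup>2 + (e $ 2 * z $ 1 + e $ 1 * z $ 2)\<^sup>2
    = ((e $ 1)\<^sup>2 + (e $ 2)\<^sup>2) * ((z $ 1)\<^sup>2 + (z $ 2)\<^sup>2)" by (simp add: power2_eq_square algebra_simps)
  then show ?thesis by (simp add: koranyi_quartic_def assms)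
qed

text \<open>Parametrizes the ball of radius \<open>\<epsilon>\<close> about \<open>x\<close> by the unit ball; the rotation is used to
  align the first axis with the horizontal gradient.\<close>

definition heis_chart :: "real^3 \<Rightarrow> real \<Rightarrow> real^2 \<Rightarrow> real^3 \<Rightarrow> real^3" where
  "heis_chart x \<epsilon> e z = heis_mult x (heis_dil \<epsilon> (heis_rot e z))"

text \<open>Translation and rotation preserve the gauge distance and dilation scales it, so the
  fourth power of the distance to x is \<epsilon>^4 times that of z to the origin. The remaining
  point is surjectivity.\<close>

lemma heis_chart_image:
  assumes \<epsilon>: "\<epsilon> > 0" and e: "(e $ 1)\<^sup>2 + (e $ 2)\<^sup>2 = 1"
  shows "heis_chart x \<epsilon> e ` koranyi_ball = closure (heis_ball x \<epsilon>)"
proof -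
  have N: "koranyi_quartic (heis_mult (heis_inv x) (heis_chart x \<epsilon> e z)) = \<epsilon> ^ 4 * koranyi_quartic z" for z
    by (simp add: heis_chart_def heis_mult_inv_cancel koranyi_quartic_dil koranyi_quartic_rot[OF e])
  have surj: "\<exists>z. y = heis_chart x \<epsilon> e z" for y
  proof -
    \<comment> \<open>\<open>heis_rot e\<close> multiplies z_1 + i z_2 by e_1 + i e_2; for a unit
      vector the complex conjugate gives the inverse rotation.\<close>
    define e' :: "real^2" where "e' = vector [e $ 1, - e $ 2]"
    define w where "w = heis_mult (heis_inv x) y"
    have "heis_rot e (heis_rot e' v) = v" for v
    proof -
      have "e $ 1 * (e $ 1 * v $ 1 + e $ 2 * v $ 2) - e $ 2 * (e $ 1 * v $ 2 - e $ 2 * v $ 1) = ((e $ 1)\<^sup>2 + (e $ 2)\<^sup>2) * v $ 1"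
        "e $ 2 * (e $ 1 * v $ 1 + e $ 2 * v $ 2) + e $ 1 * (e $ 1 * v $ 2 - e $ 2 * v $ 1) = ((e $ 1)\<^sup>2 + (e $ 2)\<^sup>2) * v $ 2"
        by (simp_all add: power2_eq_square algebra_simps)
      then show ?thesis by (simp add: vec_eq_iff forall_3 e'_def e)
    qed
    moreover have "heis_dil \<epsilon> (heis_dil (1 / \<epsilon>) w) = w"
      using \<epsilon> by (simp add: vec_eq_iff forall_3 power_divide)
    ultimately have "heis_chart x \<epsilon> e (heis_rot e' (heis_dil (1 / \<epsilon>) w)) = y"
      by (simp add: heis_chart_def w_def heis_mult_inv_cancel)
    then show ?thesis by metis
  qed
  show ?thesis
  proof (intro equalityI subsetI)
    fix y assume "y \<in> heis_chart x \<epsilon> e ` koranyi_ball"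
    then show "y \<in> closure (heis_ball x \<epsilon>)"
      using \<epsilon> by (auto simp: closure_heis_ball N koranyi_ball_iff)
  next
    fix y assume y: "y \<in> closure (heis_ball x \<epsilon>)"
    obtain z where z: "y = heis_chart x \<epsilon> e z" using surj by blast
    then have "\<epsilon> ^ 4 * koranyi_quartic z \<le> \<epsilon> ^ 4 * 1" using y \<epsilon> by (simp add: closure_heis_ball N)
    then have "z \<in> koranyi_ball" using \<epsilon> by (simp add: koranyi_ball_iff)
    then show "y \<in> heis_chart x \<epsilon> e ` koranyi_ball" using z by blast
  qed
qed

lemma heis_chart_inj:
  assumes \<epsilon>: "\<epsilon> > 0" and e: "(e $ 1)\<^sup>2 + (e $ 2)\<^sup>2 = 1"
  shows "inj (heis_chart x \<epsilon> e)"
proof (rule injI)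
  fix z w assume *: "heis_chart x \<epsilon> e z = heis_chart x \<epsilon> e w"
  then have "heis_dil \<epsilon> (heis_rot e z) = heis_dil \<epsilon> (heis_rot e w)"
    unfolding heis_chart_def using heis_mult_inv_cancel(1) by metis
  then have eq: "e $ 1 * z $ 1 - e $ 2 * z $ 2 = e $ 1 * w $ 1 - e $ 2 * w $ 2"
    "e $ 2 * z $ 1 + e $ 1 * z $ 2 = e $ 2 * w $ 1 + e $ 1 * w $ 2" "z $ 3 = w $ 3"
    using \<epsilon> by (auto simp: vec_eq_iff forall_3)
  have r: "((e $ 1)\<^sup>2 + (e $ 2)\<^sup>2) * v $ 1 = e $ 1 * (e $ 1 * v $ 1 - e $ 2 * v $ 2) + e $ 2 * (e $ 2 * v $ 1 + e $ 1 * v $ 2)"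
    "((e $ 1)\<^sup>2 + (e $ 2)\<^sup>2) * v $ 2 = e $ 1 * (e $ 2 * v $ 1 + e $ 1 * v $ 2) - e $ 2 * (e $ 1 * v $ 1 - e $ 2 * v $ 2)" for v :: "real^3"
    by (simp_all add: power2_eq_square algebra_simps)
  have "z $ 1 = w $ 1" "z $ 2 = w $ 2"
    using r[of z, unfolded e eq] r[of w, unfolded e] by simp_all
  then show "z = w" using eq by (simp add: vec_eq_iff forall_3)
qed

text \<open>For fixed x the group law is affine in its second argument and dilations are linear. The
  chart is therefore affine, and this linear part is its derivative at every point.\<close>

definition heis_chart_linear :: "real^3 \<Rightarrow> real \<Rightarrow> real^2 \<Rightarrow> real^3 \<Rightarrow> real^3" where
  "heis_chart_linear x \<epsilon> e z = (let y = heis_dil \<epsilon> (heis_rot e z) in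
     vector [y $ 1, y $ 2, y $ 3 + (1/2) * (x $ 1 * y $ 2 - x $ 2 * y $ 1)])"

lemma heis_chart_has_derivative:
  "(heis_chart x \<epsilon> e has_derivative heis_chart_linear x \<epsilon> e) (at z within S)"
proof -
  have "linear (heis_chart_linear x \<epsilon> e)"
    by (rule linearI) (simp_all add: heis_chart_linear_def vec_eq_iff forall_3 algebra_simps add_divide_distrib diff_divide_distrib)
  then have "((\<lambda>z. x + heis_chart_linear x \<epsilon> e z) has_derivative heis_chart_linear x \<epsilon> e) (at z within S)"
    by (auto intro!: derivative_eq_intros linear_imp_has_derivative)
  moreover have "heis_chart x \<epsilon> e = (\<lambda>z. x + heis_chart_linear x \<epsilon> e z)"
    by (simp add: fun_eq_iff heis_chart_def heis_chart_linear_def vec_eq_iff forall_3)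
  ultimately show ?thesis by simp
qed

text \<open>The rotation and the shear depending on x have determinant 1, and the dilation
  contributes \<epsilon> \<epsilon> \<epsilon>^2, reflecting homogeneous dimension four.\<close>

lemma det_heis_chart_linear:
  assumes e: "(e $ 1)\<^sup>2 + (e $ 2)\<^sup>2 = 1"
  shows "det (matrix (heis_chart_linear x \<epsilon> e)) = \<epsilon> ^ 4"
proof -
  have "det (matrix (heis_chart_linear x \<epsilon> e)) = \<epsilon> ^ 4 * ((e $ 1)\<^sup>2 + (e $ 2)\<^sup>2)"
    by (simp add: det_3 matrix_def heis_chart_linear_def axis_def power2_eq_square power4_eq_xxxx algebra_simps)
  then show ?thesis by (simp add: e)
qed

lemma set_integrable_compact_continuous:
  fixes F :: "'a::euclidean_space \<Rightarrow> real"
  assumes "compact S" "continuous_on S F"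
  shows "F absolutely_integrable_on S"
proof -
  have "integrable lborel (\<lambda>x. indicator S x *\<^sub>R F x)"
    using assms by (intro borel_integrable_compact) auto
  from integrable_completion[THEN iffD2, OF borel_measurable_integrable[OF this] this]
  show ?thesis unfolding set_integrable_def .
qed

lemma integral_heis_ball_chart:
  fixes F :: "real^3 \<Rightarrow> real"
  assumes \<epsilon>: "\<epsilon> > 0" and e: "(e $ 1)\<^sup>2 + (e $ 2)\<^sup>2 = 1" and F: "continuous_on (closure (heis_ball x \<epsilon>)) F"
  shows "(LINT y:closure (heis_ball x \<epsilon>)|lebesgue. F y) = \<epsilon> ^ 4 * (\<integral>z. F (heis_chart x \<epsilon> e z) \<partial>koranyi_measure)"
proof -
  let ?T = "heis_chart x \<epsilon> e"
  have contT: "continuous_on A ?T" for A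
    by (rule has_derivative_continuous_on[OF heis_chart_has_derivative])
  have im: "closure (heis_ball x \<epsilon>) = ?T ` koranyi_ball" using heis_chart_image[OF \<epsilon> e] by simp
  have compT: "compact (?T ` koranyi_ball)"
    by (intro compact_continuous_image contT compact_koranyi_ball)
  have contFT: "continuous_on koranyi_ball (\<lambda>z. F (?T z))"
    using continuous_on_compose2[OF F contT] im by auto
  have absF: "F absolutely_integrable_on (?T ` koranyi_ball)"
    using set_integrable_compact_continuous[OF compT] F im by simp
  have absFT: "(\<lambda>z. F (?T z)) absolutely_integrable_on koranyi_ball"
    by (rule set_integrable_compact_continuous[OF compact_koranyi_ball contFT])
  have d: "\<bar>det (matrix (heis_chart_linear x \<epsilon> e))\<bar> = \<epsilon> ^ 4"
    using \<epsilon> by (simp add: det_heis_chart_linear[OF e])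
  \<comment> \<open>The change of variables theorem is phrased for functions into a space of real
    vectors, so F is regarded as having values in \<open>real^1\<close>.\<close>
  have "(\<lambda>z. \<bar>det (matrix (heis_chart_linear x \<epsilon> e))\<bar> *\<^sub>R (vec (F (?T z)) :: real^1)) absolutely_integrable_on koranyi_ball
     \<and> integral koranyi_ball (\<lambda>z. \<bar>det (matrix (heis_chart_linear x \<epsilon> e))\<bar> *\<^sub>R (vec (F (?T z)) :: real^1))
         = vec (integral (?T ` koranyi_ball) F)"
  proof (rule has_absolute_integral_change_of_variables[THEN iffD2, OF _ heis_chart_has_derivative])
    show "koranyi_ball \<in> sets lebesgue" using koranyi_ball_borel by simp
    show "inj_on ?T koranyi_ball" using heis_chart_inj[OF \<epsilon> e] inj_on_subset by blast
    show "(\<lambda>y. vec (F y) :: real^1) absolutely_integrable_on ?T ` koranyi_ball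
      \<and> integral (?T ` koranyi_ball) (\<lambda>y. vec (F y) :: real^1) = vec (integral (?T ` koranyi_ball) F)"
      using absF by (auto simp: absolutely_integrable_on_1_iff integral_on_1_eq)
  qed
  then have "integral koranyi_ball (\<lambda>z. \<epsilon> ^ 4 * F (?T z)) = integral (?T ` koranyi_ball) F"
    unfolding d by (auto simp: integral_on_1_eq vec_eq_iff)
  then have "integral (?T ` koranyi_ball) F = \<epsilon> ^ 4 * integral koranyi_ball (\<lambda>z. F (?T z))"
    by simp
  moreover have "integral (?T ` koranyi_ball) F = (LINT y:closure (heis_ball x \<epsilon>)|lebesgue. F y)"
    unfolding im using set_lebesgue_integral_eq_integral(2)[OF absF] by simp
  moreover have "integral koranyi_ball (\<lambda>z. F (?T z)) = (LINT z:koranyi_ball|lebesgue. F (?T z))"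
    using set_lebesgue_integral_eq_integral(2)[OF absFT] by simp
  moreover have "\<dots> = (\<integral>z. F (?T z) \<partial>koranyi_measure)"
  proof -
    have "integrable lborel (\<lambda>z. indicator koranyi_ball z *\<^sub>R F (?T z))"
      by (rule borel_integrable_compact[OF compact_koranyi_ball contFT])
    then show ?thesis unfolding set_lebesgue_integral_def
      by (subst integral_completion) (auto simp: integral_restrict_space)
  qed
  ultimately show ?thesis by simp
qed

text \<open>This presents the extended domain as a continuous image of a compact product, from which
  compactness and the inclusion of small balls around points of the closure are immediate.\<close>

lemma ext_domain_eq:
  assumes "bounded_domain \<Omega>"
  shows "ext_domain \<Omega> = (\<lambda>(x, z). heis_mult x z) ` (closure \<Omega> \<times> koranyi_ball)"
proof (intro equalityI subsetI)
  have ne: "\<Omega> \<noteq> {}" and comp: "compact (closure \<Omega>)"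
    using assms by (auto simp: bounded_domain_def)
  fix x assume x: "x \<in> ext_domain \<Omega>"
  show "x \<in> (\<lambda>(x, z). heis_mult x z) ` (closure \<Omega> \<times> koranyi_ball)"
  proof (cases "x \<in> \<Omega>")
    case True
    have "x = heis_mult x 0" by (simp add: vec_eq_iff forall_3)
    moreover have "(x, 0) \<in> closure \<Omega> \<times> koranyi_ball"
      using True closure_subset by (auto simp: koranyi_ball_def)
    ultimately show ?thesis by force
  next
    case False
    then have d: "heis_setdist x \<Omega> \<le> 1" using x by (simp add: ext_domain_def)
    \<comment> \<open>The infimum over \<Omega> itself need not be attained, hence the minimisation
      over the compact closure.\<close>
    obtain y where y: "y \<in> closure \<Omega>" "\<And>y'. y' \<in> closure \<Omega> \<Longrightarrow> heis_dist x y \<le> heis_dist x y'"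
      using continuous_attains_inf[OF comp _ continuous_on_heis_dist[of _ x]] ne by auto
    have "heis_dist x y \<le> heis_setdist x \<Omega>"
      unfolding heis_setdist_def using ne y(2) closure_subset by (intro cINF_greatest) auto
    then have "koranyi_gauge (heis_mult (heis_inv y) x) \<le> 1"
      using d heis_dist_commute[of x y] by (simp add: heis_dist_def)
    then have "(y, heis_mult (heis_inv y) x) \<in> closure \<Omega> \<times> koranyi_ball"
      using y by (simp add: koranyi_gauge_le_1_iff)
    moreover have "x = heis_mult y (heis_mult (heis_inv y) x)" by (simp add: heis_mult_inv_cancel)
    ultimately show ?thesis by force
  qed
next
  fix x assume "x \<in> (\<lambda>(x, z). heis_mult x z) ` (closure \<Omega> \<times> koranyi_ball)"
  then obtain y z where y: "y \<in> closure \<Omega>" and z: "z \<in> koranyi_ball" and x: "x = heis_mult y z" by auto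
  have d: "heis_dist x y \<le> 1"
    using z by (subst heis_dist_commute) (simp add: x heis_dist_mult koranyi_gauge_le_1_iff)
  have "heis_setdist x \<Omega> \<le> 1"
  \<comment> \<open>The point y lies only in the closure, whereas the infimum runs over \<Omega>; a
    nearby point of \<Omega> costs an arbitrarily small \<delta>.\<close>
  proof (rule field_le_epsilon)
    fix \<delta> :: real assume \<delta>: "\<delta> > 0"
    have "isCont (heis_dist x) y"
      using continuous_on_heis_dist[of UNIV x] by (simp add: continuous_on_eq_continuous_at)
    then obtain r where r: "r > 0" "\<And>y'. dist y' y < r \<Longrightarrow> dist (heis_dist x y') (heis_dist x y) < \<delta>"
      unfolding continuous_at_eps_delta using \<delta> by blast
    obtain y' where y': "y' \<in> \<Omega>" "dist y' y < r"
      using y r(1) closure_approachable by blast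
    have "heis_setdist x \<Omega> \<le> heis_dist x y'"
      unfolding heis_setdist_def
      by (rule cINF_lower[OF _ y'(1)]) (auto simp: heis_dist_def intro!: bdd_belowI[of _ 0] koranyi_gauge_nonneg)
    also have "\<dots> \<le> 1 + \<delta>" using r(2)[OF y'(2)] d by (simp add: dist_real_def)
    finally show "heis_setdist x \<Omega> \<le> 1 + \<delta>" .
  qed
  then show "x \<in> ext_domain \<Omega>" by (auto simp: ext_domain_def)
qed

lemma compact_ext_domain:
  assumes "bounded_domain \<Omega>"
  shows "compact (ext_domain \<Omega>)"
  unfolding ext_domain_eq[OF assms] case_prod_unfold
  using assms by (intro compact_continuous_image continuous_on_heis_mult continuous_intros compact_Times
      compact_koranyi_ball) (simp add: bounded_domain_def compact_closure)

lemma heis_mult_dil_in_ext_domain: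
  assumes "bounded_domain \<Omega>" "x \<in> closure \<Omega>" "z \<in> koranyi_ball" "0 \<le> s" "s \<le> 1"
  shows "heis_mult x (heis_dil s z) \<in> ext_domain \<Omega>"
proof -
  have "s ^ 4 * koranyi_quartic z \<le> 1 * 1"
    using assms koranyi_quartic_nonneg by (intro mult_mono power_le_one) (auto simp: koranyi_ball_iff)
  then have "(x, heis_dil s z) \<in> closure \<Omega> \<times> koranyi_ball"
    using assms by (simp add: koranyi_ball_iff koranyi_quartic_dil)
  then show ?thesis unfolding ext_domain_eq[OF assms(1)] by force
qed

section \<open>Asymptotics of the natural p-mean\<close>

text \<open>In the orthonormal frame formed by e and (-e_2, e_1) the horizontal Laplacian is the sum
  of the two diagonal Hessian entries. Adding (p - 2) times the entry along e gives weight p - 1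
  there.\<close>

lemma norm_p_laplace_eq:
  assumes "heis_grad u x = a *\<^sub>R e" "a > 0" "norm e = 1"
  shows "norm_p_laplace p u x =
    (p - 1) * ((e $ 1)\<^sup>2 * X1 (X1 u) x + e $ 1 * e $ 2 * (X1 (X2 u) x + X2 (X1 u) x) + (e $ 2)\<^sup>2 * X2 (X2 u) x)
    + ((e $ 2)\<^sup>2 * X1 (X1 u) x - e $ 1 * e $ 2 * (X1 (X2 u) x + X2 (X1 u) x) + (e $ 1)\<^sup>2 * X2 (X2 u) x)"
proof -
  have s: "sgn (heis_grad u x) = e"
    using assms by (simp add: sgn_div_norm)
  have e: "(e $ 1)\<^sup>2 + (e $ 2)\<^sup>2 = 1"
    using assms(3) by (simp add: norm_vec_def L2_set_def sum_2 real_sqrt_eq_1_iff)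
  have "X1 (X1 u) x + X2 (X2 u) x = ((e $ 1)\<^sup>2 + (e $ 2)\<^sup>2) * X1 (X1 u) x + ((e $ 1)\<^sup>2 + (e $ 2)\<^sup>2) * X2 (X2 u) x"
    by (simp add: e)
  then have "heis_laplace u x = \<dots>" by (simp add: heis_laplace_def)
  then show ?thesis
    by (simp add: norm_p_laplace_def s heis_hess_def matrix_vector_mult_def inner_vec_def sum_2 Xh_simps
        power2_eq_square algebra_simps)
qed

lemma horiz_deriv_words:
  "horiz_deriv [1] u = X1 u" "horiz_deriv [2] u = X2 u"
  "horiz_deriv [1,1] u = X1 (X1 u)" "horiz_deriv [1,2] u = X1 (X2 u)"
  "horiz_deriv [2,1] u = X2 (X1 u)" "horiz_deriv [2,2] u = X2 (X2 u)"
  by (simp_all add: horiz_deriv_simps Xh_simps)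

lemma heis_dil_dil: "heis_dil s (heis_dil t y) = heis_dil (s * t) y"
  by (simp add: vec_eq_iff forall_3 power_mult_distrib)

lemma heis_dil_koranyi_ball:
  assumes "z \<in> koranyi_ball" "0 \<le> s" "s \<le> 1"
  shows "heis_dil s z \<in> koranyi_ball"
proof -
  have "s ^ 4 * koranyi_quartic z \<le> 1 * 1"
    using assms koranyi_quartic_nonneg by (intro mult_mono power_le_one) (auto simp: koranyi_ball_iff)
  then show ?thesis by (simp add: koranyi_ball_iff koranyi_quartic_dil)
qed

text \<open>The chart and the affine change of values l = b + a t multiply the p-th power integral
  by \<epsilon>^4 and a powr p, so minimisers correspond. Strictness settles uniqueness, which the
  \<open>THE\<close> in \<open>p_mean\<close> requires.\<close>

lemma p_mean_eqI:
  assumes p: "p > 0" and \<epsilon>: "\<epsilon> > 0" and a: "a > 0" and e: "(e $ 1)\<^sup>2 + (e $ 2)\<^sup>2 = 1"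
    and u: "continuous_on (closure (heis_ball x \<epsilon>)) u"
    and f: "\<And>z. f z = (u (heis_chart x \<epsilon> e z) - b) / a"
    and min: "\<And>t'. t' \<noteq> t \<Longrightarrow> (\<integral>z. \<bar>f z - t\<bar> powr p \<partial>koranyi_measure) < (\<integral>z. \<bar>f z - t'\<bar> powr p \<partial>koranyi_measure)"
  shows "p_mean p u \<epsilon> x = b + a * t"
proof -
  let ?B = "closure (heis_ball x \<epsilon>)"
  define \<Phi> where "\<Phi> t = (\<integral>z. \<bar>f z - t\<bar> powr p \<partial>koranyi_measure)" for t
  have Lp: "Lp_norm_on p ?B (\<lambda>y. u y - l) = (\<epsilon> ^ 4 * (a powr p * \<Phi> ((l - b) / a))) powr (1 / p)" for l
  proof -
    have pt: "\<bar>u (heis_chart x \<epsilon> e z) - l\<bar> powr p = a powr p * \<bar>f z - (l - b) / a\<bar> powr p" for z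
    proof -
      have "u (heis_chart x \<epsilon> e z) - l = a * (f z - (l - b) / a)" using a by (simp add: f field_simps)
      then show ?thesis using a by (simp add: abs_mult powr_mult)
    qed
    have "(LINT y:?B|lebesgue. \<bar>u y - l\<bar> powr p) = \<epsilon> ^ 4 * (\<integral>z. \<bar>u (heis_chart x \<epsilon> e z) - l\<bar> powr p \<partial>koranyi_measure)"
      using u p by (intro integral_heis_ball_chart[OF \<epsilon> e] continuous_on_powr' continuous_intros) auto
    then show ?thesis by (simp add: Lp_norm_on_def \<Phi>_def pt)
  qed
  have strict: "Lp_norm_on p ?B (\<lambda>y. u y - (b + a * t)) < Lp_norm_on p ?B (\<lambda>y. u y - l)" if "l \<noteq> b + a * t" for l
  proof -
    have "(l - b) / a \<noteq> t" using that a by (auto simp: field_simps)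
    then have "\<Phi> t < \<Phi> ((l - b) / a)" unfolding \<Phi>_def by (rule min)
    moreover have "\<Phi> t \<ge> 0" unfolding \<Phi>_def by (intro Bochner_Integration.integral_nonneg) auto
    ultimately show ?thesis unfolding Lp using a p \<epsilon>
      by (intro powr_less_mono2 mult_strict_left_mono mult_nonneg_nonneg) auto
  qed
  show ?thesis unfolding p_mean_def
  proof (rule the_equality)
    show "\<forall>l'. Lp_norm_on p ?B (\<lambda>y. u y - (b + a * t)) \<le> Lp_norm_on p ?B (\<lambda>y. u y - l')"
      using strict less_imp_le order_refl by metis
    show "l = b + a * t" if "\<forall>l'. Lp_norm_on p ?B (\<lambda>y. u y - l) \<le> Lp_norm_on p ?B (\<lambda>y. u y - l')" for l
      using strict that not_less by blast
  qed
qed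

text \<open>Both constants are fixed by p, m and B before u and x enter, and derivative bounds are
  required only on the ball in question.\<close>

lemma p_mean_expansion:
  assumes p: "p \<ge> 2" and m: "m > 0" and B: "B \<ge> 0"
  shows "\<exists>C>0. \<exists>\<delta>>0. \<forall>U u x \<epsilon>. open U \<longrightarrow> smooth_on U u \<longrightarrow> 0 < \<epsilon> \<longrightarrow> \<epsilon> < \<delta> \<longrightarrow>
     (\<forall>z\<in>koranyi_ball. heis_mult x (heis_dil \<epsilon> z) \<in> U) \<longrightarrow>
     (\<forall>z\<in>koranyi_ball. \<forall>w. w \<noteq> [] \<longrightarrow> length w \<le> 4 \<longrightarrow> \<bar>horiz_deriv w u (heis_mult x (heis_dil \<epsilon> z))\<bar> \<le> B) \<longrightarrow>
     m \<le> norm (heis_grad u x) \<longrightarrow>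
     \<bar>p_mean p u \<epsilon> x - u x - c_const p * \<epsilon>\<^sup>2 * norm_p_laplace p u x\<bar> \<le> C * \<epsilon> ^ 3"
proof -
  have L: "(\<lambda>z. z $ 1) \<in> borel_measurable koranyi_measure"
    by (intro measurable_restrict_space1) measurable
  have D: "(\<integral>z. \<bar>z $ 1\<bar> powr (p - 2) \<partial>koranyi_measure) > 0"
    using has_bochner_integral_koranyi[of "p - 2" 0] koranyi_moment_pos[of "p - 2" 0] p
    by (simp add: has_bochner_integral_iff)
  have sing: "\<forall>\<alpha>>-1. integrable koranyi_measure (\<lambda>z. \<bar>z $ 1\<bar> powr \<alpha>)"
    using has_bochner_integral_koranyi[of _ 0] by (auto simp: has_bochner_integral_iff)
  \<comment> \<open>6B is the crude bound B + 2B + B + 2B for the four terms of the quadratic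
    polynomial on the unit ball, and 18B is the Taylor constant. Both are divided by the gradient
    length, which is at least m.\<close>
  obtain K \<delta> where K: "K > 0" and \<delta>: "\<delta> > 0" and main:
    "\<And>\<epsilon> q f \<tau>. 0 < \<epsilon> \<Longrightarrow> \<epsilon> < \<delta> \<Longrightarrow> q \<in> borel_measurable koranyi_measure \<Longrightarrow> f \<in> borel_measurable koranyi_measure \<Longrightarrow>
     (\<forall>z\<in>koranyi_ball. \<bar>q z\<bar> \<le> 6 * B / m) \<Longrightarrow> (\<forall>z\<in>koranyi_ball. \<bar>f z - z $ 1 - \<epsilon> * q z\<bar> \<le> 18 * B / m * \<epsilon>\<^sup>2) \<Longrightarrow>
     (\<integral>z. \<bar>z $ 1\<bar> powr (p - 2) * q z \<partial>koranyi_measure) = \<tau> * (\<integral>z. \<bar>z $ 1\<bar> powr (p - 2) \<partial>koranyi_measure) \<Longrightarrow>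
     \<exists>t. \<bar>t - \<epsilon> * \<tau>\<bar> \<le> K * \<epsilon>\<^sup>2 \<and>
       (\<forall>t'. t' \<noteq> t \<longrightarrow> (\<integral>z. \<bar>f z - t\<bar> powr p \<partial>koranyi_measure) < (\<integral>z. \<bar>f z - t'\<bar> powr p \<partial>koranyi_measure))"
  proof -
    have L1: "\<forall>z\<in>space koranyi_measure. \<bar>z $ 1\<bar> \<le> 1"
      using koranyi_ball_bounds(1) unfolding space_koranyi_measure by blast
    have "6 * B / m \<ge> 0" "18 * B / m \<ge> 0" using m B by auto
    from perturbed_mean[OF finite_measure_koranyi p L L1 AE_koranyi_nonzero integral_koranyi_spow D sing this,
        unfolded space_koranyi_measure]
    show ?thesis using that by (elim exE conjE) blast
  qed
  \<comment> \<open>The gradient length is at most 2B, and undoing the normalisation multiplies the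
    error K \<epsilon>^2 by \<epsilon> times this length. The 1 keeps the constant positive when B =
    0.\<close>
  have C0: "2 * B * K + 1 > 0" using B K by (intro add_nonneg_pos) auto
  show ?thesis
  proof (rule exI[of _ "2 * B * K + 1"], rule conjI, fact C0, rule exI[of _ "min \<delta> 1"],
      rule conjI, use \<delta> in simp, intro allI impI)
    fix U and u :: "real^3 \<Rightarrow> real" and x :: "real^3" and \<epsilon> :: real
    assume U: "open U" "smooth_on U u" and \<epsilon>: "0 < \<epsilon>" "\<epsilon> < min \<delta> 1"
      and inU: "\<forall>z\<in>koranyi_ball. heis_mult x (heis_dil \<epsilon> z) \<in> U"
      and bd: "\<forall>z\<in>koranyi_ball. \<forall>w. w \<noteq> [] \<longrightarrow> length w \<le> 4 \<longrightarrow> \<bar>horiz_deriv w u (heis_mult x (heis_dil \<epsilon> z))\<bar> \<le> B"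
      and grad: "m \<le> norm (heis_grad u x)"
    define a where "a = norm (heis_grad u x)"
    define e where "e = (1 / a) *\<^sub>R heis_grad u x"
    have a: "a \<ge> m" "a > 0" using grad m by (auto simp: a_def)
    have g: "heis_grad u x = a *\<^sub>R e" using a by (simp add: e_def)
    have ne: "norm e = 1" using a by (simp add: e_def a_def)
    then have e: "(e $ 1)\<^sup>2 + (e $ 2)\<^sup>2 = 1"
      by (simp add: norm_vec_def L2_set_def sum_2 real_sqrt_eq_1_iff)
    have X: "X1 u x = a * e $ 1" "X2 u x = a * e $ 2"
      using arg_cong[OF g, of "\<lambda>v. v $ 1"] arg_cong[OF g, of "\<lambda>v. v $ 2"] by (simp_all add: heis_grad_def Xh_def)
    \<comment> \<open>The hypotheses speak of dilation by \<epsilon> only; a smaller s is reached by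
      first dilating z by s / \<epsilon>, which stays in the unit ball.\<close>
    have path: "heis_mult x (heis_dil s z) \<in> U"
      "w \<noteq> [] \<Longrightarrow> length w \<le> 4 \<Longrightarrow> \<bar>horiz_deriv w u (heis_mult x (heis_dil s z))\<bar> \<le> B"
      if "z \<in> koranyi_ball" "0 \<le> s" "s \<le> \<epsilon>" for s z w
    proof -
      have "heis_dil (s / \<epsilon>) z \<in> koranyi_ball" using that \<epsilon> by (intro heis_dil_koranyi_ball) auto
      moreover have "heis_dil s z = heis_dil \<epsilon> (heis_dil (s / \<epsilon>) z)" using \<epsilon> by (simp add: heis_dil_dil)
      ultimately show "heis_mult x (heis_dil s z) \<in> U"
        "w \<noteq> [] \<Longrightarrow> length w \<le> 4 \<Longrightarrow> \<bar>horiz_deriv w u (heis_mult x (heis_dil s z))\<bar> \<le> B"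
        using inU bd by simp_all
    qed
    have zero: "0 \<in> koranyi_ball" by (simp add: koranyi_ball_def)
    have bx: "\<bar>horiz_deriv w u x\<bar> \<le> B" if "w \<noteq> []" "length w \<le> 4" for w
      using path(2)[OF zero _ _ that, of 0] \<epsilon> by simp
    have Xb: "\<bar>X1 u x\<bar> \<le> B" "\<bar>X2 u x\<bar> \<le> B" "\<bar>X1 (X1 u) x\<bar> \<le> B" "\<bar>X1 (X2 u) x\<bar> \<le> B" "\<bar>X2 (X1 u) x\<bar> \<le> B" "\<bar>X2 (X2 u) x\<bar> \<le> B"
      using bx[of "[1]"] bx[of "[2]"] bx[of "[1,1]"] bx[of "[1,2]"] bx[of "[2,1]"] bx[of "[2,2]"]
      by (simp_all add: horiz_deriv_words)
    have aB: "a \<le> 2 * B"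
      unfolding a_def using norm_le_l1_cart[of "heis_grad u x"] Xb(1,2) by (simp add: sum_2 heis_grad_def Xh_def)
    define Q where "Q y = 1/2 * ((y $ 1)\<^sup>2 * X1 (X1 u) x + y $ 1 * y $ 2 * (X1 (X2 u) x + X2 (X1 u) x)
        + (y $ 2)\<^sup>2 * X2 (X2 u) x) + y $ 3 * (X1 (X2 u) x - X2 (X1 u) x)" for y :: "real^3"
    define q where "q z = Q (heis_rot e z) / a" for z
    define f where "f z = (u (heis_chart x \<epsilon> e z) - u x) / (\<epsilon> * a)" for z
    have rot: "heis_rot e z \<in> koranyi_ball" if "z \<in> koranyi_ball" for z
      using that by (simp add: koranyi_ball_iff koranyi_quartic_rot[OF e])
    have ballU: "closure (heis_ball x \<epsilon>) \<subseteq> U"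
      unfolding heis_chart_image[OF \<epsilon>(1) e, symmetric] heis_chart_def using inU rot by auto
    have uc: "continuous_on (closure (heis_ball x \<epsilon>)) u"
      using continuous_on_subset[OF smooth_on_continuous_on[OF U(2)] ballU] .
    have chartc: "continuous_on A (heis_chart x \<epsilon> e)" for A
      by (rule has_derivative_continuous_on[OF heis_chart_has_derivative])
    have sets: "sets koranyi_measure = sets (restrict_space borel koranyi_ball)"
      by (rule sets_restrict_space_cong) simp
    have fm: "f \<in> borel_measurable koranyi_measure"
    proof -
      have "continuous_on koranyi_ball (\<lambda>z. u (heis_chart x \<epsilon> e z))"
        using continuous_on_compose2[OF uc chartc] heis_chart_image[OF \<epsilon>(1) e] by auto
      then have "continuous_on koranyi_ball f"
        unfolding f_def[abs_def] using \<epsilon> a by (intro continuous_intros) auto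
      then show ?thesis
        using borel_measurable_continuous_on_restrict measurable_cong_sets[OF sets refl] by blast
    qed
    have qm: "q \<in> borel_measurable koranyi_measure"
      unfolding q_def[abs_def] Q_def by (intro measurable_restrict_space1) (simp, measurable)
    have QB: "\<bar>Q y\<bar> \<le> 6 * B" if "y \<in> koranyi_ball" for y
    proof -
      have m1: "\<bar>c * d\<bar> \<le> D" if "\<bar>c\<bar> \<le> 1" "\<bar>d\<bar> \<le> D" for c d D :: real
        using mult_mono[of "\<bar>c\<bar>" 1 "\<bar>d\<bar>" D] that by (simp add: abs_mult)
      note yb = koranyi_ball_bounds[OF that]
      have h12: "\<bar>X1 (X2 u) x + X2 (X1 u) x\<bar> \<le> B + B" "\<bar>X1 (X2 u) x - X2 (X1 u) x\<bar> \<le> B + B"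
        by (rule order_trans[OF abs_triangle_ineq add_mono[OF Xb(4,5)]], rule abs_sub_bound[OF Xb(4,5)])
      have "Q y = 1/2 * (y $ 1 * (y $ 1 * X1 (X1 u) x)) + 1/2 * (y $ 1 * (y $ 2 * (X1 (X2 u) x + X2 (X1 u) x)))
          + 1/2 * (y $ 2 * (y $ 2 * X2 (X2 u) x)) + y $ 3 * (X1 (X2 u) x - X2 (X1 u) x)"
        by (simp add: Q_def power2_eq_square algebra_simps)
      then show ?thesis
        by (rule abs_sum4_bound[OF _ m1[OF _ m1[OF yb(1) m1[OF yb(1) Xb(3)]]] m1[OF _ m1[OF yb(1) m1[OF yb(2) h12(1)]]]
              m1[OF _ m1[OF yb(2) m1[OF yb(2) Xb(6)]]] m1[OF _ h12(2)]])
          (use yb(3) in auto)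
    qed
    have qB: "\<forall>z\<in>koranyi_ball. \<bar>q z\<bar> \<le> 6 * B / m"
    proof
      fix z assume "z \<in> koranyi_ball"
      then have "\<bar>Q (heis_rot e z)\<bar> / a \<le> 6 * B / m"
        using QB rot a m B by (intro frac_le) auto
      then show "\<bar>q z\<bar> \<le> 6 * B / m" using a by (simp add: q_def)
    qed
    have fB: "\<forall>z\<in>koranyi_ball. \<bar>f z - z $ 1 - \<epsilon> * q z\<bar> \<le> 18 * B / m * \<epsilon>\<^sup>2"
    proof
      fix z assume z: "z \<in> koranyi_ball"
      define y where "y = heis_rot e z"
      have y: "y \<in> koranyi_ball" using rot z by (simp add: y_def)
      have T: "\<bar>u (heis_mult x (heis_dil \<epsilon> y)) - u x - \<epsilon> * (y $ 1 * X1 u x + y $ 2 * X2 u x) - \<epsilon>\<^sup>2 * Q y\<bar> \<le> 18 * B * \<epsilon> ^ 3"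
        unfolding Q_def
      proof (rule heis_taylor[OF U \<epsilon>(1)])
        show "\<bar>y $ 1\<bar> \<le> 1" "\<bar>y $ 2\<bar> \<le> 1" "2 * \<bar>y $ 3\<bar> \<le> 1" using koranyi_ball_bounds[OF y] by auto
        show "\<epsilon> \<le> 1" using \<epsilon> by simp
      qed (use path y in auto)
      \<comment> \<open>This is the purpose of the rotation: pairing the rotated horizontal vector
        with e returns its first coordinate before rotation.\<close>
      have "y $ 1 * X1 u x + y $ 2 * X2 u x = a * ((e $ 1)\<^sup>2 + (e $ 2)\<^sup>2) * z $ 1"
        by (simp add: X y_def power2_eq_square algebra_simps)
      then have lin: "y $ 1 * X1 u x + y $ 2 * X2 u x = a * z $ 1" by (simp add: e)
      have "f z - z $ 1 - \<epsilon> * q z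
        = (u (heis_mult x (heis_dil \<epsilon> y)) - u x - \<epsilon> * (y $ 1 * X1 u x + y $ 2 * X2 u x) - \<epsilon>\<^sup>2 * Q y) / (\<epsilon> * a)"
        unfolding lin f_def q_def heis_chart_def y_def[symmetric] using \<epsilon> a by (simp add: field_simps power2_eq_square)
      then have "\<bar>f z - z $ 1 - \<epsilon> * q z\<bar> \<le> 18 * B * \<epsilon> ^ 3 / (\<epsilon> * a)"
        using T \<epsilon> a by (simp add: abs_divide divide_right_mono)
      also have "\<dots> = 18 * B * \<epsilon>\<^sup>2 / a" using \<epsilon> by (simp add: power2_eq_square power3_eq_cube)
      also have "\<dots> \<le> 18 * B * \<epsilon>\<^sup>2 / m" using a m B by (intro divide_left_mono) auto
      finally show "\<bar>f z - z $ 1 - \<epsilon> * q z\<bar> \<le> 18 * B / m * \<epsilon>\<^sup>2" by simp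
    qed
    \<comment> \<open>Chosen so that the predicted shift \<epsilon> \<tau>, multiplied by the scale
      \<epsilon> a, is the second-order term of the claim.\<close>
    define \<tau> where "\<tau> = c_const p * norm_p_laplace p u x / a"
    let ?h11 = "X1 (X1 u) x" and ?h12 = "X1 (X2 u) x + X2 (X1 u) x" and ?h22 = "X2 (X2 u) x"
    \<comment> \<open>\<open>A0\<close> and \<open>C0\<close> are the Hessian entries along e and
      along (-e_2, e_1), and \<open>D'\<close> is the normalised mixed coefficient of the rotated
      quadratic form.\<close>
    define A0 where "A0 = (e $ 1)\<^sup>2 * ?h11 + e $ 1 * e $ 2 * ?h12 + (e $ 2)\<^sup>2 * ?h22"
    define C0 where "C0 = (e $ 2)\<^sup>2 * ?h11 - e $ 1 * e $ 2 * ?h12 + (e $ 1)\<^sup>2 * ?h22"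
    define D' where "D' = (- 2 * e $ 1 * e $ 2 * ?h11 + ((e $ 1)\<^sup>2 - (e $ 2)\<^sup>2) * ?h12 + 2 * e $ 1 * e $ 2 * ?h22) / a"
    have qeq: "q z = 1/2 * (A0 / a * (z $ 1)\<^sup>2 + D' * (z $ 1 * z $ 2) + C0 / a * (z $ 2)\<^sup>2) + ((X1 (X2 u) x - X2 (X1 u) x) / a) * z $ 3" for z
      using a by (simp add: q_def Q_def A0_def C0_def D'_def power2_eq_square field_simps)
    have "c * (k * v + w) / a = c * (k * (v / a) + w / a)" for c k v w
      using a by (simp add: field_simps)
    then have \<tau>eq: "\<tau> = c_const p * ((p - 1) * (A0 / a) + C0 / a)"
      unfolding \<tau>_def norm_p_laplace_eq[OF g a(2) ne] A0_def C0_def by blast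
    have "(\<integral>z. \<bar>z $ 1\<bar> powr (p - 2) * q z \<partial>koranyi_measure) = \<tau> * (\<integral>z. \<bar>z $ 1\<bar> powr (p - 2) \<partial>koranyi_measure)"
      unfolding qeq \<tau>eq by (rule integral_koranyi_quadratic[OF p])
    then obtain t where t: "\<bar>t - \<epsilon> * \<tau>\<bar> \<le> K * \<epsilon>\<^sup>2"
      "\<And>t'. t' \<noteq> t \<Longrightarrow> (\<integral>z. \<bar>f z - t\<bar> powr p \<partial>koranyi_measure) < (\<integral>z. \<bar>f z - t'\<bar> powr p \<partial>koranyi_measure)"
      using main[OF \<epsilon>(1) _ qm fm qB fB] \<epsilon>(2) by auto
    have "p_mean p u \<epsilon> x = u x + \<epsilon> * a * t"
      using p \<epsilon> a t(2) by (intro p_mean_eqI[OF _ _ _ e uc]) (auto simp: f_def)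
    then have "p_mean p u \<epsilon> x - u x - c_const p * \<epsilon>\<^sup>2 * norm_p_laplace p u x = \<epsilon> * a * (t - \<epsilon> * \<tau>)"
      using a by (simp add: \<tau>_def power2_eq_square field_simps)
    also have "\<bar>\<epsilon> * a * (t - \<epsilon> * \<tau>)\<bar> = \<epsilon> * a * \<bar>t - \<epsilon> * \<tau>\<bar>" using \<epsilon> a by (simp add: abs_mult)
    finally have "\<bar>p_mean p u \<epsilon> x - u x - c_const p * \<epsilon>\<^sup>2 * norm_p_laplace p u x\<bar> \<le> \<epsilon> * (2 * B) * (K * \<epsilon>\<^sup>2)"
      using mult_mono[OF mult_left_mono[OF aB, of \<epsilon>] t(1)] \<epsilon> B by simp
    also have "\<dots> \<le> (2 * B * K + 1) * \<epsilon> ^ 3" using \<epsilon> by (simp add: power2_eq_square power3_eq_cube algebra_simps)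
    finally show "\<bar>p_mean p u \<epsilon> x - u x - c_const p * \<epsilon>\<^sup>2 * norm_p_laplace p u x\<bar> \<le> (2 * B * K + 1) * \<epsilon> ^ 3" .
  qed
qed

section \<open>Uniform constants and compactness\<close>

lemma subset_ext_domain: "\<Omega> \<subseteq> ext_domain \<Omega>"
  by (auto simp: ext_domain_def)

lemma smooth_inD:
  assumes "smooth_in S u"
  obtains U where "open U" "S \<subseteq> U" "smooth_on U u"
  using assms unfolding smooth_in_def smooth_on_def by blast

lemma p_mean_uniform_estimate:
  assumes p: "p \<ge> 2" and m: "m > 0"
  shows "\<exists>C>0. \<exists>e>0. \<forall>\<Omega> u. bounded_domain \<Omega> \<and> smooth_in (ext_domain \<Omega>) u \<and>
           (\<forall>x\<in>ext_domain \<Omega>. m \<le> norm (heis_grad u x)) \<and>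
           (\<forall>w. w \<noteq> [] \<longrightarrow> (\<forall>x\<in>ext_domain \<Omega>. \<bar>horiz_deriv w u x\<bar> \<le> M (length w))) \<longrightarrow>
           (\<forall>\<epsilon> x0. 0 < \<epsilon> \<and> \<epsilon> < e \<and> x0 \<in> closure \<Omega> \<longrightarrow>
             \<bar>p_mean p u \<epsilon> x0 - u x0 - c_const p * \<epsilon>^2 * norm_p_laplace p u x0\<bar> \<le> C * \<epsilon>^3)"
proof -
  \<comment> \<open>One number bounding all words of length at most four; absolute values make it
    nonnegative whatever M is.\<close>
  define B where "B = (\<Sum>n\<le>4. \<bar>M n\<bar>)"
  have "B \<ge> 0" by (simp add: B_def sum_nonneg)
  have MB: "M n \<le> B" if "n \<le> 4" for n
    unfolding B_def using member_le_sum[of n "{..4}" "\<lambda>n. \<bar>M n\<bar>"] that by simp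
  obtain C \<delta> where C: "C > 0" and \<delta>: "\<delta> > 0" and main:
    "\<And>U u x \<epsilon>. open U \<Longrightarrow> smooth_on U u \<Longrightarrow> 0 < \<epsilon> \<Longrightarrow> \<epsilon> < \<delta> \<Longrightarrow>
     (\<forall>z\<in>koranyi_ball. heis_mult x (heis_dil \<epsilon> z) \<in> U) \<Longrightarrow>
     (\<forall>z\<in>koranyi_ball. \<forall>w. w \<noteq> [] \<longrightarrow> length w \<le> 4 \<longrightarrow> \<bar>horiz_deriv w u (heis_mult x (heis_dil \<epsilon> z))\<bar> \<le> B) \<Longrightarrow>
     m \<le> norm (heis_grad u x) \<Longrightarrow>
     \<bar>p_mean p u \<epsilon> x - u x - c_const p * \<epsilon>\<^sup>2 * norm_p_laplace p u x\<bar> \<le> C * \<epsilon> ^ 3"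
    using p_mean_expansion[OF p m \<open>B \<ge> 0\<close>] by metis
  show ?thesis
  \<comment> \<open>Radii below 1 keep the closed ball inside the extended domain, where smoothness
    and derivative bounds are assumed.\<close>
  proof (rule exI[of _ C], rule conjI, fact C, rule exI[of _ "min \<delta> 1"], rule conjI, use \<delta> in simp,
      intro allI impI, elim conjE)
    fix \<Omega> :: "(real^3) set" and u :: "real^3 \<Rightarrow> real" and \<epsilon> :: real and x :: "real^3"
    assume \<Omega>: "bounded_domain \<Omega>" and u: "smooth_in (ext_domain \<Omega>) u"
      and grad: "\<forall>x\<in>ext_domain \<Omega>. m \<le> norm (heis_grad u x)"
      and bd: "\<forall>w. w \<noteq> [] \<longrightarrow> (\<forall>x\<in>ext_domain \<Omega>. \<bar>horiz_deriv w u x\<bar> \<le> M (length w))"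
      and \<epsilon>: "0 < \<epsilon>" "\<epsilon> < min \<delta> 1" and x: "x \<in> closure \<Omega>"
    obtain U where U: "open U" "ext_domain \<Omega> \<subseteq> U" "smooth_on U u" using smooth_inD[OF u] .
    have ext: "heis_mult x (heis_dil \<epsilon> z) \<in> ext_domain \<Omega>" if "z \<in> koranyi_ball" for z
      using heis_mult_dil_in_ext_domain[OF \<Omega> x that] \<epsilon> by simp
    have "0 \<in> koranyi_ball" by (simp add: koranyi_ball_def)
    then have "x \<in> ext_domain \<Omega>"
      using heis_mult_dil_in_ext_domain[OF \<Omega> x, of 0 0] by simp
    then show "\<bar>p_mean p u \<epsilon> x - u x - c_const p * \<epsilon>^2 * norm_p_laplace p u x\<bar> \<le> C * \<epsilon>^3"
      using ext U \<epsilon> grad bd MB order_trans by (intro main[OF U(1,3)]) (auto, blast)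
  qed
qed

text \<open>Horizontal derivatives and the gradient norm are continuous on the compact extended
  domain, so each word has a bound and the nonvanishing gradient has a positive minimum.\<close>

lemma horiz_deriv_bounds:
  assumes \<Omega>: "bounded_domain \<Omega>" and u: "smooth_in (ext_domain \<Omega>) u"
    and grad: "\<forall>x\<in>ext_domain \<Omega>. heis_grad u x \<noteq> 0"
  obtains M m where "m > 0" "\<forall>x\<in>ext_domain \<Omega>. m \<le> norm (heis_grad u x)"
    "\<forall>w. w \<noteq> [] \<longrightarrow> (\<forall>x\<in>ext_domain \<Omega>. \<bar>horiz_deriv w u x\<bar> \<le> M (length w))"
proof -
  obtain U where U: "open U" "ext_domain \<Omega> \<subseteq> U" "smooth_on U u" using smooth_inD[OF u] .
  have comp: "compact (ext_domain \<Omega>)" by (rule compact_ext_domain[OF \<Omega>])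
  have ne: "ext_domain \<Omega> \<noteq> {}" using \<Omega> subset_ext_domain[of \<Omega>] by (auto simp: bounded_domain_def)
  have cont: "continuous_on (ext_domain \<Omega>) (horiz_deriv w u)" for w
    using continuous_on_subset[OF smooth_on_continuous_on[OF smooth_on_horiz_deriv[OF U(1,3)]] U(2)] .
  have "\<exists>b. \<forall>x\<in>ext_domain \<Omega>. \<bar>horiz_deriv w u x\<bar> \<le> b" for w
    using compact_imp_bounded[OF compact_continuous_image[OF cont comp, of w]] by (auto simp: bounded_iff)
  then obtain b where b: "\<And>w x. x \<in> ext_domain \<Omega> \<Longrightarrow> \<bar>horiz_deriv w u x\<bar> \<le> b w" by metis
  \<comment> \<open>There are only finitely many words of each length, so their individual bounds
    can be summed.\<close>
  define M where "M n = (\<Sum>w | length w = n. \<bar>b w\<bar>)" for n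
  have M: "\<forall>w. w \<noteq> [] \<longrightarrow> (\<forall>x\<in>ext_domain \<Omega>. \<bar>horiz_deriv w u x\<bar> \<le> M (length w))"
  proof (intro allI impI ballI)
    fix w :: "2 list" and x assume "x \<in> ext_domain \<Omega>"
    then have "\<bar>horiz_deriv w u x\<bar> \<le> \<bar>b w\<bar>" using b[of x w] by simp
    also have "\<dots> \<le> M (length w)"
      unfolding M_def using finite_lists_length_eq[of "UNIV :: 2 set" "length w"]
      by (intro member_le_sum) auto
    finally show "\<bar>horiz_deriv w u x\<bar> \<le> M (length w)" .
  qed
  have "continuous_on (ext_domain \<Omega>) (Xh i u)" for i
    using cont[of "[i]"] by (simp add: horiz_deriv_simps)
  then have "continuous_on (ext_domain \<Omega>) (\<lambda>x. norm (heis_grad u x))"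
    unfolding heis_grad_def by (intro continuous_intros)
  then obtain y where y: "y \<in> ext_domain \<Omega>" "\<forall>x\<in>ext_domain \<Omega>. norm (heis_grad u y) \<le> norm (heis_grad u x)"
    using continuous_attains_inf[OF comp ne] by blast
  show thesis
    by (rule that[of "norm (heis_grad u y)", OF _ y(2) M]) (use grad y(1) in simp)
qed

theorem proposition1p8:
  fixes p :: real
  assumes "2 \<le> p"
  shows
    "(\<forall>\<Omega> u. bounded_domain \<Omega> \<and> smooth_in (ext_domain \<Omega>) u \<and>
        (\<forall>x\<in>ext_domain \<Omega>. heis_grad u x \<noteq> 0) \<longrightarrow>
        (\<exists>C>0. \<exists>e>0. \<forall>\<epsilon> x0. 0 < \<epsilon> \<and> \<epsilon> < e \<and> x0 \<in> closure \<Omega> \<longrightarrow>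
           \<bar>p_mean p u \<epsilon> x0 - u x0 - c_const p * \<epsilon>^2 * norm_p_laplace p u x0\<bar> \<le> C * \<epsilon>^3))
     \<and>
     (\<forall>(M :: nat \<Rightarrow> real) (m :: real). 0 < m \<longrightarrow>
        (\<exists>C>0. \<exists>e>0. \<forall>\<Omega> u. bounded_domain \<Omega> \<and> smooth_in (ext_domain \<Omega>) u \<and>
           (\<forall>x\<in>ext_domain \<Omega>. m \<le> norm (heis_grad u x)) \<and>
           (\<forall>w. w \<noteq> [] \<longrightarrow> (\<forall>x\<in>ext_domain \<Omega>. \<bar>horiz_deriv w u x\<bar> \<le> M (length w))) \<longrightarrow>
           (\<forall>\<epsilon> x0. 0 < \<epsilon> \<and> \<epsilon> < e \<and> x0 \<in> closure \<Omega> \<longrightarrow>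
             \<bar>p_mean p u \<epsilon> x0 - u x0 - c_const p * \<epsilon>^2 * norm_p_laplace p u x0\<bar> \<le> C * \<epsilon>^3)))"
proof (intro conjI allI impI)
  fix \<Omega> u
  assume *: "bounded_domain \<Omega> \<and> smooth_in (ext_domain \<Omega>) u \<and> (\<forall>x\<in>ext_domain \<Omega>. heis_grad u x \<noteq> 0)"
  \<comment> \<open>With these bounds a single pair of \<Omega> and u becomes an instance of the
    uniform estimate.\<close>
  then obtain M m where Mm: "m > 0" "\<forall>x\<in>ext_domain \<Omega>. m \<le> norm (heis_grad u x)"
    "\<forall>w. w \<noteq> [] \<longrightarrow> (\<forall>x\<in>ext_domain \<Omega>. \<bar>horiz_deriv w u x\<bar> \<le> M (length w))"
    using horiz_deriv_bounds[of \<Omega> u] by metis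
  obtain C e where "C > 0" "e > 0" and est: "\<And>\<Omega> u. bounded_domain \<Omega> \<and> smooth_in (ext_domain \<Omega>) u \<and>
           (\<forall>x\<in>ext_domain \<Omega>. m \<le> norm (heis_grad u x)) \<and>
           (\<forall>w. w \<noteq> [] \<longrightarrow> (\<forall>x\<in>ext_domain \<Omega>. \<bar>horiz_deriv w u x\<bar> \<le> M (length w))) \<Longrightarrow>
           (\<forall>\<epsilon> x0. 0 < \<epsilon> \<and> \<epsilon> < e \<and> x0 \<in> closure \<Omega> \<longrightarrow>
             \<bar>p_mean p u \<epsilon> x0 - u x0 - c_const p * \<epsilon>^2 * norm_p_laplace p u x0\<bar> \<le> C * \<epsilon>^3)"
    using p_mean_uniform_estimate[OF assms Mm(1), of M] by metis
  moreover have "\<forall>\<epsilon> x0. 0 < \<epsilon> \<and> \<epsilon> < e \<and> x0 \<in> closure \<Omega> \<longrightarrow>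
           \<bar>p_mean p u \<epsilon> x0 - u x0 - c_const p * \<epsilon>^2 * norm_p_laplace p u x0\<bar> \<le> C * \<epsilon>^3"
    using * Mm(2,3) by (intro est) blast
  ultimately show "\<exists>C>0. \<exists>e>0. \<forall>\<epsilon> x0. 0 < \<epsilon> \<and> \<epsilon> < e \<and> x0 \<in> closure \<Omega> \<longrightarrow>
           \<bar>p_mean p u \<epsilon> x0 - u x0 - c_const p * \<epsilon>^2 * norm_p_laplace p u x0\<bar> \<le> C * \<epsilon>^3"
    by blast
qed (rule p_mean_uniform_estimate[OF assms])

end
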